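(* Let $(\mathcal{M}_1,g_1)$ and $(\mathcal{M}_2,g_2)$ be connected (nonempty) Riemannian manifolds and let $(\mathcal{M}_1\times\mathcal{M}_2,g)$ be their Riemannian product. Then, each manifold being regarded as a metric space with the distance function induced by its Riemannian metric, $$\mathrm{rank}_E(\mathcal{M}_1,g_1)+\mathrm{rank}_E(\mathcal{M}_2,g_2)=\mathrm{rank}_E(\mathcal{M}_1\times\mathcal{M}_2,g).$$
   Context: A map between metric spaces is called isometric if it preserves distances (it need not be surjective). $\mathbb{E}^n$ denotes $\mathbb{R}^n$ with the Euclidean metric. For a metric space $(X,d)$ the Euclidean rank is $\mathrm{rank}_E(X,d) := \sup\{n \in\mathbb{N} : \text{there exists an isometric map } \mathbb{E}^n\to (X,d)\}$, where $0\in\mathbb{N}$; it takes values in $\mathbb{N}\cup\{\infty\}$. *)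

theory Defs
  imports "HOL-Analysis.Analysis"
begin

subsection \<open>Smooth maps\<close>

primrec Ck_on :: "nat \<Rightarrow> 'a::euclidean_space set \<Rightarrow> ('a \<Rightarrow> 'b::real_normed_vector) \<Rightarrow> bool" where
  "Ck_on 0 W f \<longleftrightarrow> continuous_on W f"
| "Ck_on (Suc k) W f \<longleftrightarrow>
     (\<forall>x\<in>W. f differentiable (at x)) \<and> (\<forall>v. Ck_on k W (\<lambda>x. frechet_derivative f (at x) v))"

text \<open>
  Smoothness on an arbitrary subset \<open>S\<close>: near each point of \<open>S\<close> the map extends to a
  \<open>C\<^sup>\<infinity>\<close> map on an open subset of the ambient space. If \<open>S\<close> is open, or relatively open in a
  linear subspace, this is the usual notion.
\<close>

definition smooth_on :: "'a::euclidean_space set \<Rightarrow> ('a \<Rightarrow> 'b::real_normed_vector) \<Rightarrow> bool" where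
  "smooth_on S f \<longleftrightarrow>
     (\<forall>x\<in>S. \<exists>W h. open W \<and> x \<in> W \<and> (\<forall>k. Ck_on k W h) \<and> (\<forall>y\<in>S \<inter> W. h y = f y))"

subsection \<open>Riemannian manifolds\<close>

text \<open>
  A manifold is a topological space with a smooth atlas, given as an indexed family of charts
  and not required to be maximal. Charts take values in a linear subspace \<open>model\<close> of a Euclidean
  space; a type of class \<open>euclidean_space\<close> has positive dimension, so charts onto open subsets
  of the type itself would exclude manifolds of dimension \<open>0\<close>.

  Via the chart with index \<open>i\<close>, tangent vectors are represented by elements of \<open>model\<close>.
  \<open>tensor M i x v w\<close> is the value of the metric tensor at the point with coordinates
  \<open>x\<close> on the tangent vectors represented by \<open>v\<close> and \<open>w\<close>. Only \<open>x\<close> in the image of the chart and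
  \<open>v\<close>, \<open>w\<close> in \<open>model\<close> are relevant.
\<close>

record ('i, 'm, 'a) riemannian =
  mtop :: "'m topology"
  model :: "'a set"
  charts :: "'i set"
  cdom :: "'i \<Rightarrow> 'm set"
  cmap :: "'i \<Rightarrow> 'm \<Rightarrow> 'a"
  tensor :: "'i \<Rightarrow> 'a \<Rightarrow> 'a \<Rightarrow> 'a \<Rightarrow> real"

definition transition :: "('i, 'm, 'a) riemannian \<Rightarrow> 'i \<Rightarrow> 'i \<Rightarrow> 'a \<Rightarrow> 'a" where
  "transition M i j = cmap M j \<circ> inv_into (cdom M i) (cmap M i)"

locale smooth_manifold =
  fixes M :: "('i, 'm, 'a::euclidean_space) riemannian"
  assumes Hausdorff: "Hausdorff_space (mtop M)"
    and second_countable: "second_countable (mtop M)"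
    and subspace_model: "subspace (model M)"
    and charts_cover: "(\<Union>i\<in>charts M. cdom M i) = topspace (mtop M)"
    and chart_domain: "i \<in> charts M \<Longrightarrow> openin (mtop M) (cdom M i)"
    and chart_image: "i \<in> charts M \<Longrightarrow> openin (top_of_set (model M)) (cmap M i ` cdom M i)"
    and chart_homeomorphic:
      "i \<in> charts M \<Longrightarrow>
         homeomorphic_map (subtopology (mtop M) (cdom M i)) (top_of_set (cmap M i ` cdom M i)) (cmap M i)"
    and transition_smooth:
      "\<lbrakk>i \<in> charts M; j \<in> charts M\<rbrakk> \<Longrightarrow>
         smooth_on (cmap M i ` (cdom M i \<inter> cdom M j)) (transition M i j)"

text \<open>
  In the last axiom, the transformation law of the metric tensor, the restriction of \<open>D\<close> to
  \<open>model M\<close> is uniquely determined; it is the differential of the coordinate change.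
\<close>

locale riemannian_manifold = smooth_manifold M
  for M :: "('i, 'm, 'a::euclidean_space) riemannian" +
  assumes tensor_sym:
      "\<lbrakk>i \<in> charts M; x \<in> cmap M i ` cdom M i; v \<in> model M; w \<in> model M\<rbrakk> \<Longrightarrow>
         tensor M i x v w = tensor M i x w v"
    and tensor_linear:
      "\<lbrakk>i \<in> charts M; x \<in> cmap M i ` cdom M i; u \<in> model M; v \<in> model M; w \<in> model M\<rbrakk> \<Longrightarrow>
         tensor M i x (r *\<^sub>R u + s *\<^sub>R v) w = r * tensor M i x u w + s * tensor M i x v w"
    and tensor_pos:
      "\<lbrakk>i \<in> charts M; x \<in> cmap M i ` cdom M i; v \<in> model M; v \<noteq> 0\<rbrakk> \<Longrightarrow> tensor M i x v v > 0"
    and tensor_smooth: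
      "\<lbrakk>i \<in> charts M; v \<in> model M; w \<in> model M\<rbrakk> \<Longrightarrow>
         smooth_on (cmap M i ` cdom M i) (\<lambda>x. tensor M i x v w)"
    and tensor_transform:
      "\<lbrakk>i \<in> charts M; j \<in> charts M; x \<in> cmap M i ` (cdom M i \<inter> cdom M j);
        (transition M i j has_derivative D) (at x within cmap M i ` (cdom M i \<inter> cdom M j));
        v \<in> model M; w \<in> model M\<rbrakk> \<Longrightarrow>
         tensor M i x v w = tensor M j (transition M i j x) (D v) (D w)"

definition riemannian_product ::
    "('i, 'm, 'a) riemannian \<Rightarrow> ('j, 'n, 'b) riemannian \<Rightarrow> ('i \<times> 'j, 'm \<times> 'n, 'a \<times> 'b) riemannian"
  where
  "riemannian_product M N =
     \<lparr>mtop = prod_topology (mtop M) (mtop N),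
      model = model M \<times> model N,
      charts = charts M \<times> charts N,
      cdom = (\<lambda>(i, j). cdom M i \<times> cdom N j),
      cmap = (\<lambda>(i, j). map_prod (cmap M i) (cmap N j)),
      tensor = (\<lambda>(i, j) (x, y) (v, v') (w, w'). tensor M i x v w + tensor N j y v' w')\<rparr>"

subsection \<open>The Riemannian distance\<close>

definition C1_curve_on :: "('i, 'm, 'a::euclidean_space) riemannian \<Rightarrow> real set \<Rightarrow> (real \<Rightarrow> 'm) \<Rightarrow> bool"
  where
  "C1_curve_on M T c \<longleftrightarrow>
     (\<forall>i\<in>charts M. \<exists>D. continuous_on {t \<in> T. c t \<in> cdom M i} D \<and>
        (\<forall>t\<in>T. c t \<in> cdom M i \<longrightarrow> (cmap M i \<circ> c has_vector_derivative D t) (at t within T)))"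

definition piecewise_C1_curve :: "('i, 'm, 'a::euclidean_space) riemannian \<Rightarrow> (real \<Rightarrow> 'm) \<Rightarrow> bool"
  where
  "piecewise_C1_curve M c \<longleftrightarrow>
     pathin (mtop M) c \<and>
     (\<exists>n s. s 0 = 0 \<and> s n = 1 \<and>
        (\<forall>k<n. s k < s (Suc k) \<and> C1_curve_on M {s k..s (Suc k)} c))"

text \<open>
  On a Riemannian manifold the speed does not depend on the chart selected by \<open>SOME\<close>. At the
  finitely many break points of a piecewise \<open>C\<^sup>1\<close> curve its value is irrelevant for the length.
\<close>

definition speed :: "('i, 'm, 'a::euclidean_space) riemannian \<Rightarrow> (real \<Rightarrow> 'm) \<Rightarrow> real \<Rightarrow> real" where
  "speed M c t =
     (let i = (SOME i. i \<in> charts M \<and> c t \<in> cdom M i);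
          v = vector_derivative (cmap M i \<circ> c) (at t within {0..1})
      in sqrt (tensor M i (cmap M i (c t)) v v))"

definition curve_length :: "('i, 'm, 'a::euclidean_space) riemannian \<Rightarrow> (real \<Rightarrow> 'm) \<Rightarrow> real" where
  "curve_length M c = integral {0..1} (speed M c)"

definition riemannian_dist :: "('i, 'm, 'a::euclidean_space) riemannian \<Rightarrow> 'm \<Rightarrow> 'm \<Rightarrow> real" where
  "riemannian_dist M p q =
     Inf {curve_length M c | c. piecewise_C1_curve M c \<and> c 0 = p \<and> c 1 = q}"

subsection \<open>The Euclidean rank\<close>

definition isometric_map ::
    "'a set \<Rightarrow> ('a \<Rightarrow> 'a \<Rightarrow> real) \<Rightarrow> 'b set \<Rightarrow> ('b \<Rightarrow> 'b \<Rightarrow> real) \<Rightarrow> ('a \<Rightarrow> 'b) \<Rightarrow> bool" where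
  "isometric_map X d Y e f \<longleftrightarrow> f \<in> X \<rightarrow> Y \<and> (\<forall>x\<in>X. \<forall>y\<in>X. e (f x) (f y) = d x y)"

text \<open>
  The points of \<open>topspace (Euclidean_space n)\<close> are the real sequences vanishing from index \<open>n\<close> on.
\<close>

definition euclidean_rank :: "'m set \<Rightarrow> ('m \<Rightarrow> 'm \<Rightarrow> real) \<Rightarrow> enat" where
  "euclidean_rank X d =
     Sup {enat n | n. \<exists>f. isometric_map (topspace (Euclidean_space n))
                          (\<lambda>x y. L2_set (\<lambda>i. x i - y i) {..<n}) X d f}"

end

theory Submission
  imports Defs "HOL-Library.Function_Algebras"
begin

text \<open>
  For an isometric map \<open>f = (f\<^sub>1, f\<^sub>2)\<close> from \<open>E\<^sup>n\<close> into the product, the equality case of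
  Minkowski's inequality makes both components affine along lines, and since parallel lines stay at
  bounded distance one gets \<open>d\<^sub>i (f\<^sub>i x) (f\<^sub>i y) = N\<^sub>i (x - y)\<close> for seminorms with
  \<open>N\<^sub>1\<^sup>2 + N\<^sub>2\<^sup>2 = |_|\<^sup>2\<close>. A Riemannian manifold is infinitesimally Euclidean, so its distance satisfies,
  up to a factor tending to \<open>1\<close> in small balls, the inequality between the diagonals and the sides of
  a quadrilateral; rescaling turns this into the parallelogram law for \<open>N\<^sub>i\<close>. Hence \<open>N\<^sub>i\<close> comes from a
  bilinear form. If \<open>k\<^sub>i\<close> is the maximal
  size of an \<open>N\<^sub>i\<close>-orthonormal family, then such a family spans a Euclidean space of dimension \<open>k\<^sub>i\<close>
  that \<open>f\<^sub>i\<close> maps isometrically into the factor \<open>i\<close>, and \<open>k\<^sub>1 + k\<^sub>2 \<ge> n\<close>, because otherwise some nonzero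
  vector is orthogonal to both families and is annihilated by \<open>N\<^sub>1\<close> and \<open>N\<^sub>2\<close>.
\<close>

subsection \<open>Seminorms and isometric maps into products of metric spaces\<close>

text \<open>Rank and geometry meet in the formula d((p, q), (p', q'))^2 = d1(p, p')^2 + d2(q, q')^2.
  Its upper bound is the delicate half: completeness is not assumed, so shortest curves need not
  exist, and a pair of almost shortest curves has the right length only if both run at nearly
  constant speed. Hence distances are handled through curves on the unit interval with a uniform
  speed bound K, and the distance is the infimum of such K. The comparison with a Euclidean norm
  needs a lower bound of lengths by coordinate displacements. Its obstacle is a curve that leaves
  the chart; leaving a compact coordinate ball costs a definite amount of length, so short curves
  stay inside. The dimension n is a variable, so no type stands for E^n: all these spaces are
  realised on the sequences \<open>nat \<Rightarrow> real\<close>, where the Euclidean length of the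
  first n coordinates is a seminorm.\<close>

instantiation "fun" :: (type, real_vector) real_vector
begin

definition scaleR_fun :: "real \<Rightarrow> ('a \<Rightarrow> 'b) \<Rightarrow> 'a \<Rightarrow> 'b" where
  "scaleR_fun r f = (\<lambda>x. r *\<^sub>R f x)"

instance
  by standard (simp_all add: scaleR_fun_def fun_eq_iff scaleR_add_right scaleR_add_left)

end

lemma scaleR_fun_apply [simp]: "(r *\<^sub>R f) x = r *\<^sub>R f x"
  by (simp add: scaleR_fun_def)

lemma sum_fun_apply: "(\<Sum>i\<in>A. f i) x = (\<Sum>i\<in>A. f i x)"
  for f :: "'i \<Rightarrow> 'a \<Rightarrow> 'b::real_vector"
  by (induction A rule: infinite_finite_induct) auto

section \<open>Seminorms, the parallelogram law and polarisation\<close>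

locale seminorm =
  fixes N :: "'v::real_vector \<Rightarrow> real"
  assumes scale: "N (t *\<^sub>R x) = \<bar>t\<bar> * N x"
    and triangle: "N (x + y) \<le> N x + N y"
begin

lemma zero [simp]: "N 0 = 0"
  using scale[of 0 0] by simp

lemma minus [simp]: "N (- x) = N x"
  using scale[of "-1" x] by simp

lemma diff_commute: "N (x - y) = N (y - x)"
  using minus[of "x - y"] by simp

lemma nonneg [simp]: "0 \<le> N x"
  using triangle[of x "- x"] by simp

end

locale quadratic_seminorm = seminorm N for N :: "'v::real_vector \<Rightarrow> real" +
  assumes parallelogram: "(N (x + y))\<^sup>2 + (N (x - y))\<^sup>2 = 2 * (N x)\<^sup>2 + 2 * (N y)\<^sup>2"
begin

definition form :: "'v \<Rightarrow> 'v \<Rightarrow> real" where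
  "form x y = ((N (x + y))\<^sup>2 - (N (x - y))\<^sup>2) / 4"

lemma form_self: "form x x = (N x)\<^sup>2"
  using scale[of 2 x] by (simp add: form_def power_mult_distrib scaleR_2)

lemma form_sym: "form x y = form y x"
  by (simp add: form_def add.commute diff_commute)

text \<open>The Jordan-von Neumann argument: \<open>h\<close> is the difference of the parallelogram
  laws for the pairs (a + z, b) and (a - z, b). With the half sum and the half difference of x and y
  as a and b its left side becomes the sum wanted, and the doubling rule \<open>s\<close> absorbs
  the factor 2 on the right.\<close>

lemma form_add: "form (x + y) z = form x z + form y z"
proof -
  have p: "(N (a + b))\<^sup>2 + (N (a - b))\<^sup>2 = 2 * (N a)\<^sup>2 + 2 * (N b)\<^sup>2" for a b
    by (rule parallelogram)
  have s: "form (2 *\<^sub>R a) b = 2 * form a b" for a b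
  proof -
    have e: "a + b + a = 2 *\<^sub>R a + b" "a + b - a = b" "a - b + a = 2 *\<^sub>R a - b" "a - b - a = - b"
      by (simp_all add: scaleR_2)
    show ?thesis using p[of "a + b" a, unfolded e] p[of "a - b" a, unfolded e] by (simp add: form_def)
  qed
  have h: "form (a + b) z + form (a - b) z = 2 * form a z" for a b
  proof -
    have e: "a + z + b = a + b + z" "a + z - b = a - b + z" "a - z + b = a + b - z" "a - z - b = a - b - z"
      by simp_all
    show ?thesis
      using p[of "a + z" b, unfolded e] p[of "a - z" b, unfolded e] unfolding form_def by argo
  qed
  show ?thesis
    using h[of "(1/2) *\<^sub>R (x + y)" "(1/2) *\<^sub>R (x - y)"] s[of "(1/2) *\<^sub>R (x + y)" z]
    by (simp add: scaleR_add_right scaleR_diff_right flip: scaleR_add_left)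
qed

text \<open>An additive function of a real variable that is bounded on the unit interval is linear.\<close>

lemma form_scale: "form (t *\<^sub>R x) z = t * form x z"
proof -
  \<comment> \<open>The defect of linearity in the scalar. It is additive and vanishes at 1, hence
    at all integers.\<close>
  define g where "g s = form (s *\<^sub>R x) z - s * form x z" for s
  have add: "g (r + s) = g r + g s" for r s
    by (simp add: g_def scaleR_add_left form_add algebra_simps)
  have g0: "g 0 = 0" using add[of 0 0] by simp
  have gneg: "g (- s) = - g s" for s using add[of s "- s"] g0 by simp
  have gn: "g (real n * s) = real n * g s" for n s
    by (induction n) (simp_all add: g0 add algebra_simps)
  have g1: "g 1 = 0" by (simp add: g_def)
  have gN: "g (real n) = 0" for n using gn[of n 1] g1 by simp
  have gi: "g (real_of_int k) = 0" for k
    using gN[of "nat k"] gN[of "nat (- k)"] gneg[of "real_of_int k"] by (cases "k \<ge> 0") auto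
  \<comment> \<open>For s in the unit interval s x + z and s x - z have seminorm at most N x + N z,
    so the square bounds the form; the other summand bounds \<open>s * form x z\<close>.\<close>
  define C where "C = (N x + N z)\<^sup>2 + \<bar>form x z\<bar>"
  have bd: "\<bar>g s\<bar> \<le> C" if "0 \<le> s" "s \<le> 1" for s
  proof -
    have sN: "s * N x \<le> N x" using that mult_left_le_one_le[of "N x" s] by simp
    have "N (s *\<^sub>R x + z) \<le> N x + N z" 
      using triangle[of "s *\<^sub>R x" z] that sN by (simp add: scale)
    moreover have "N (s *\<^sub>R x - z) \<le> N x + N z"
      using triangle[of "s *\<^sub>R x" "- z"] that sN by (simp add: scale)
    ultimately have "(N (s *\<^sub>R x + z))\<^sup>2 \<le> (N x + N z)\<^sup>2" "(N (s *\<^sub>R x - z))\<^sup>2 \<le> (N x + N z)\<^sup>2"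
      by (auto intro!: power_mono)
    moreover have "\<bar>(P - Q) / 4\<bar> \<le> C" if "0 \<le> P" "0 \<le> Q" "P \<le> C" "Q \<le> C" for P Q C :: real
      using that by (simp add: abs_le_iff)
    ultimately have "\<bar>form (s *\<^sub>R x) z\<bar> \<le> (N x + N z)\<^sup>2"
      unfolding form_def by simp
    moreover have "\<bar>s * form x z\<bar> \<le> \<bar>form x z\<bar>"
      using that by (simp add: abs_mult mult_left_le_one_le)
    ultimately show ?thesis unfolding g_def C_def by linarith
  qed
  \<comment> \<open>Vanishing at the integers makes \<open>g\<close> periodic with period 1, so the
    bound on the unit interval is global; multiples of a nonzero value would violate it.\<close>
  have bd': "\<bar>g s\<bar> \<le> C" for s
  proof -
    have "g s = g (frac s)"
      using add[of "real_of_int \<lfloor>s\<rfloor>" "frac s"] gi by (simp add: frac_def)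
    then show ?thesis using bd[of "frac s"] frac_lt_1[of s] frac_ge_0[of s] by simp
  qed
  have "g t = 0"
  proof (rule ccontr)
    assume "g t \<noteq> 0"
    then obtain n where "C < real n * \<bar>g t\<bar>"
      using reals_Archimedean3[of "\<bar>g t\<bar>"] by auto
    then show False using bd'[of "real n * t"] by (simp add: gn abs_mult)
  qed
  then show ?thesis by (simp add: g_def)
qed

lemma form_sum: "form (\<Sum>j\<in>J. c j *\<^sub>R e j) z = (\<Sum>j\<in>J. c j * form (e j) z)"
proof (induction J rule: infinite_finite_induct)
  case (insert x F) then show ?case by (simp add: form_add form_scale)
qed (use form_scale[of 0 0 z] in simp_all)

lemma norm_sum_orthonormal:
  fixes m :: nat
  assumes "\<And>j k. j < m \<Longrightarrow> k < m \<Longrightarrow> form (e j) (e k) = (if j = k then 1 else 0)"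
  shows "(N (\<Sum>j<m. c j *\<^sub>R e j))\<^sup>2 = (\<Sum>j<m. (c j)\<^sup>2)"
proof -
  have *: "form (e j) (\<Sum>k<m. c k *\<^sub>R e k) = c j" if "j < m" for j
  proof -
    have "form (e j) (\<Sum>k<m. c k *\<^sub>R e k) = (\<Sum>k<m. c k * form (e k) (e j))"
      by (subst form_sym) (rule form_sum)
    also have "\<dots> = (\<Sum>k<m. if k = j then c k else 0)"
      by (rule sum.cong) (use assms that in auto)
    also have "\<dots> = c j" using that by (subst sum.delta) auto
    finally show ?thesis .
  qed
  show ?thesis
    unfolding form_self[symmetric] by (simp add: form_sum * power2_eq_square)
qed

end

text \<open>Induction on the number of equations, with the index set left arbitrary: an equation
  with nonzero coefficient at \<open>i0\<close> eliminates that unknown, which leaves one equation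
  and one unknown fewer.\<close>

lemma homogeneous_system_nontrivial:
  fixes a :: "nat \<Rightarrow> 'i \<Rightarrow> real"
  assumes "finite I" "m < card I"
  shows "\<exists>v. (\<exists>i\<in>I. v i \<noteq> 0) \<and> (\<forall>k<m. (\<Sum>i\<in>I. a k i * v i) = 0)"
  using assms
proof (induction m arbitrary: a I)
  case 0
  then have "I \<noteq> {}" by auto
  then show ?case by (intro exI[of _ "\<lambda>_. 1"]) auto
next
  case (Suc m)
  show ?case
  proof (cases "\<forall>i\<in>I. a m i = 0")
    case True
    then show ?thesis using Suc.IH[OF Suc.prems(1), of a] Suc.prems(2) by (auto simp: less_Suc_eq)
  next
    case False
    then obtain i0 where i0: "i0 \<in> I" "a m i0 \<noteq> 0" by auto
    define J where "J = I - {i0}"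
    have J: "finite J" "m < card J" "i0 \<notin> J" "I = insert i0 J" 
      using Suc.prems i0 by (auto simp: J_def card_Diff_singleton)
    \<comment> \<open>These are the coefficients that remain after equation \<open>m\<close> is
      solved for the unknown \<open>i0\<close> and substituted into the others.\<close>
    obtain v where v: "\<exists>i\<in>J. v i \<noteq> 0" "\<And>k. k < m \<Longrightarrow> (\<Sum>i\<in>J. (a k i - a k i0 * a m i / a m i0) * v i) = 0"
      using Suc.IH[OF J(1,2), of "\<lambda>k i. a k i - a k i0 * a m i / a m i0"] by blast
    define w where "w = v(i0 := - (\<Sum>i\<in>J. a m i * v i) / a m i0)"
    have s: "(\<Sum>i\<in>I. a k i * w i) = a k i0 * w i0 + (\<Sum>i\<in>J. a k i * v i)" for k
      using J by (auto simp: w_def intro!: sum.cong)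
    have "(\<Sum>i\<in>I. a k i * w i) = 0" if "k < Suc m" for k
    proof (cases "k = m")
      case True then show ?thesis using i0 by (simp add: s) (simp add: w_def)
    next
      case False
      have "(\<Sum>i\<in>J. a k i * v i) = (\<Sum>i\<in>J. (a k i0 / a m i0) * (a m i * v i))"
        using v(2)[of k] False that by (simp add: left_diff_distrib sum_subtractf mult.assoc)
      also have "\<dots> = (a k i0 / a m i0) * (\<Sum>i\<in>J. a m i * v i)" by (rule sum_distrib_left[symmetric])
      finally show ?thesis using i0 by (simp add: s) (simp add: w_def)
    qed
    moreover have "\<exists>i\<in>I. w i \<noteq> 0" using v(1) J by (auto simp: w_def)
    ultimately show ?thesis by blast
  qed
qed

text \<open>(a, a'), (b, b') and (c, c') are planar vectors of lengths s E, t E and (s + t) E, and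
  the third is dominated componentwise by the sum of the first two. So equality holds in Minkowski's
  inequality, which forces the first two to be proportional in the ratio s : t.\<close>

lemma planar_triangle_equality:
  fixes a b c a' b' c' s t E :: real
  assumes nn: "0 \<le> c" "0 \<le> c'" "0 \<le> s" "0 \<le> t" "0 \<le> E" 
    and le: "c \<le> a + b" "c' \<le> a' + b'"
    and a: "a\<^sup>2 + a'\<^sup>2 = (s * E)\<^sup>2" and b: "b\<^sup>2 + b'\<^sup>2 = (t * E)\<^sup>2" and c: "c\<^sup>2 + c'\<^sup>2 = ((s + t) * E)\<^sup>2"
  shows "c = a + b" "c' = a' + b'" "t * a = s * b" "t * a' = s * b'"
proof -
  \<comment> \<open>Lagrange's identity, that is, Cauchy-Schwarz with its remainder term.\<close>
  have "(a * b + a' * b')\<^sup>2 + (a * b' - a' * b)\<^sup>2 = (a\<^sup>2 + a'\<^sup>2) * (b\<^sup>2 + b'\<^sup>2)" by algebra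
  then have "(a * b + a' * b')\<^sup>2 \<le> (s * t * E\<^sup>2)\<^sup>2"
    using a b by (smt (verit) zero_le_power2 power_mult_distrib power2_eq_square mult.assoc mult.left_commute)
  then have ip: "a * b + a' * b' \<le> s * t * E\<^sup>2" using nn by (meson mult_nonneg_nonneg zero_le_power2 power2_le_imp_le)
  have sq: "(a + b)\<^sup>2 + (a' + b')\<^sup>2 = (s * E)\<^sup>2 + (t * E)\<^sup>2 + 2 * (a * b + a' * b')"
    using a b by (simp add: power2_eq_square algebra_simps)
  have cc: "c\<^sup>2 \<le> (a + b)\<^sup>2" "c'\<^sup>2 \<le> (a' + b')\<^sup>2" using le nn by (auto intro: power_mono)
  have ce: "((s + t) * E)\<^sup>2 = (s * E)\<^sup>2 + (t * E)\<^sup>2 + 2 * (s * t * E\<^sup>2)"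
    by (simp add: power2_eq_square algebra_simps)
  have ge: "(a + b)\<^sup>2 + (a' + b')\<^sup>2 \<le> c\<^sup>2 + c'\<^sup>2"
    unfolding sq c ce using ip by simp
  have e1: "c\<^sup>2 = (a + b)\<^sup>2" using cc ge by linarith
  have e1': "c'\<^sup>2 = (a' + b')\<^sup>2" using cc ge by linarith
  have e2: "a * b + a' * b' = s * t * E\<^sup>2"
    using c[unfolded ce e1 e1' sq] by simp
  show "c = a + b" "c' = a' + b'"     using power2_eq_imp_eq[OF e1] power2_eq_imp_eq[OF e1'] nn le by linarith+
  \<comment> \<open>Proportionality is read off from the squared length of t (a, a') - s (b,
    b').\<close>
  have "(t * a - s * b)\<^sup>2 + (t * a' - s * b')\<^sup>2 = t\<^sup>2 * (a\<^sup>2 + a'\<^sup>2) + s\<^sup>2 * (b\<^sup>2 + b'\<^sup>2) - 2 * s * t * (a * b + a' * b')"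
    by algebra
  also have "\<dots> = t\<^sup>2 * (s * E)\<^sup>2 + s\<^sup>2 * (t * E)\<^sup>2 - 2 * s * t * (s * t * E\<^sup>2)"
    by (simp only: a b e2)
  also have "\<dots> = 0" by (simp add: power2_eq_square)
  finally show "t * a = s * b" "t * a' = s * b'"
    by (simp_all only: sum_power2_eq_zero_iff right_minus_eq)
qed

section \<open>Isometric maps into products of pseudometric spaces\<close>

locale pseudometric =
  fixes X :: "'m set" and d :: "'m \<Rightarrow> 'm \<Rightarrow> real"
  assumes d_self: "p \<in> X \<Longrightarrow> d p p = 0"
    and d_sym: "\<lbrakk>p \<in> X; q \<in> X\<rbrakk> \<Longrightarrow> d p q = d q p"
    and d_triangle: "\<lbrakk>p \<in> X; q \<in> X; r \<in> X\<rbrakk> \<Longrightarrow> d p r \<le> d p q + d q r"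
begin

lemma d_nonneg: "\<lbrakk>p \<in> X; q \<in> X\<rbrakk> \<Longrightarrow> 0 \<le> d p q"
  using d_triangle[of p q p] d_sym[of p q] d_self[of p] by simp

end

text \<open>
  Along a line both components are affinely parametrised by the equality case of Minkowski's
  inequality; the speeds along parallel lines agree since such lines stay at bounded distance.
\<close>

lemma isometric_into_product_component:
  fixes E :: "'v::real_vector \<Rightarrow> real"
  assumes "seminorm E" "pseudometric X\<^sub>1 d\<^sub>1" "pseudometric X\<^sub>2 d\<^sub>2"
    and f: "\<And>x. f\<^sub>1 x \<in> X\<^sub>1" "\<And>x. f\<^sub>2 x \<in> X\<^sub>2"
    and iso: "\<And>x y. (d\<^sub>1 (f\<^sub>1 x) (f\<^sub>1 y))\<^sup>2 + (d\<^sub>2 (f\<^sub>2 x) (f\<^sub>2 y))\<^sup>2 = (E (x - y))\<^sup>2"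
  shows "\<exists>N. seminorm N \<and> (\<forall>x y. d\<^sub>1 (f\<^sub>1 x) (f\<^sub>1 y) = N (x - y))"
proof -
  interpret E: seminorm E by fact
  interpret p1: pseudometric X\<^sub>1 d\<^sub>1 by fact
  interpret p2: pseudometric X\<^sub>2 d\<^sub>2 by fact
  \<comment> \<open>The distance in the first factor between the images of x and x + v. The aim is
    independence of x, which turns it into a function of v alone.\<close>
  define h where "h x v = d\<^sub>1 (f\<^sub>1 x) (f\<^sub>1 (x + v))" for x v
  have hE: "d\<^sub>1 (f\<^sub>1 x) (f\<^sub>1 y) \<le> E (x - y)" for x y
    using iso[of x y] E.nonneg[of "x - y"] by (metis le_add_same_cancel1 power2_le_imp_le zero_le_power2)
  \<comment> \<open>The points x, x + v and x + (1 + t) v are collinear in this order, with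
    consecutive distances E v and t E v.\<close>
  have add: "h x ((1 + t) *\<^sub>R v) = (1 + t) * h x v" if "t \<ge> 0" for x v t
  proof -
    have E1: "E (x - (x + v)) = E v" using E.diff_commute[of x "x + v"] by simp
    have E2: "E (x + v - (x + (1 + t) *\<^sub>R v)) = t * E v"
      using that E.diff_commute[of "x + v"] by (simp add: algebra_simps E.scale)
    have E3: "E (x - (x + (1 + t) *\<^sub>R v)) = (1 + t) * E v"
      using that E.diff_commute[of x] E.scale[of "1 + t" v] by (simp)
    note pt = planar_triangle_equality[of "d\<^sub>1 (f\<^sub>1 x) (f\<^sub>1 (x + (1 + t) *\<^sub>R v))" "d\<^sub>2 (f\<^sub>2 x) (f\<^sub>2 (x + (1 + t) *\<^sub>R v))" 1 t "E v"
      "d\<^sub>1 (f\<^sub>1 x) (f\<^sub>1 (x + v))" "d\<^sub>1 (f\<^sub>1 (x + v)) (f\<^sub>1 (x + (1 + t) *\<^sub>R v))"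
      "d\<^sub>2 (f\<^sub>2 x) (f\<^sub>2 (x + v))" "d\<^sub>2 (f\<^sub>2 (x + v)) (f\<^sub>2 (x + (1 + t) *\<^sub>R v))"]
    have a: "d\<^sub>1 (f\<^sub>1 x) (f\<^sub>1 (x + (1 + t) *\<^sub>R v)) = d\<^sub>1 (f\<^sub>1 x) (f\<^sub>1 (x + v)) + d\<^sub>1 (f\<^sub>1 (x + v)) (f\<^sub>1 (x + (1 + t) *\<^sub>R v))"
      by (rule pt(1)) (simp_all only: iso E1 E2 E3, simp_all add: that f p1.d_nonneg p2.d_nonneg p1.d_triangle p2.d_triangle)
    have b: "t * d\<^sub>1 (f\<^sub>1 x) (f\<^sub>1 (x + v)) = 1 * d\<^sub>1 (f\<^sub>1 (x + v)) (f\<^sub>1 (x + (1 + t) *\<^sub>R v))"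
      by (rule pt(3)) (simp_all only: iso E1 E2 E3, simp_all add: that f p1.d_nonneg p2.d_nonneg p1.d_triangle p2.d_triangle)
    show ?thesis using a b by (simp add: h_def algebra_simps)
  qed
  have pos: "h x (r *\<^sub>R v) = r * h x v" if "r > 0" for r x v
  proof (cases "r \<ge> 1")
    case True then show ?thesis using add[of "r - 1" x v] by simp
  next
    case False
    then have "h x v = (1 / r) * h x (r *\<^sub>R v)"
      using add[of "1 / r - 1" x "r *\<^sub>R v"] that by (simp add: field_simps)
    then show ?thesis using that by simp
  qed
  have transl: "h x v \<le> h y v" for x y v
  proof (rule ccontr)
    assume "\<not> ?thesis"
    then have "0 < h x v - h y v" by simp
    \<comment> \<open>\<open>n\<close> is large enough for the linearly growing gap to exceed 2 E (x
      - y), the cost of changing from one of the two parallel lines to the other and back.\<close>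
    then obtain n where n: "2 * E (x - y) < real n * (h x v - h y v)" 
      using reals_Archimedean3 by blast
    have n0: "real n > 0" using n E.nonneg[of "x - y"] by (cases n) auto
    let ?x = "x + real n *\<^sub>R v" and ?y = "y + real n *\<^sub>R v"
    have "h x (real n *\<^sub>R v) \<le> d\<^sub>1 (f\<^sub>1 x) (f\<^sub>1 y) + d\<^sub>1 (f\<^sub>1 y) (f\<^sub>1 ?y) + d\<^sub>1 (f\<^sub>1 ?y) (f\<^sub>1 ?x)"
      unfolding h_def using p1.d_triangle[OF f(1) f(1) f(1), of x ?x y] p1.d_triangle[OF f(1) f(1) f(1), of y ?x ?y] by linarith
    also have "\<dots> \<le> E (x - y) + h y (real n *\<^sub>R v) + E (x - y)"
      using hE[of x y] hE[of ?y ?x] by (simp add: h_def E.diff_commute[of y])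
    finally show False using n n0 by (simp add: pos algebra_simps)
  qed
  define N where "N = h 0"
  have hN: "h x v = N v" for x v unfolding N_def using transl[of x v 0] transl[of 0 v x] by simp
  have N0: "N 0 = 0" by (simp add: N_def h_def p1.d_self f)
  have Nneg: "N (- v) = N v" for v
  proof -
    have "N (- v) = h v (- v)" by (simp add: hN)
    also have "\<dots> = h 0 v" unfolding h_def using p1.d_sym[OF f(1) f(1)] by simp
    finally show ?thesis by (simp add: N_def)
  qed
  have d: "d\<^sub>1 (f\<^sub>1 x) (f\<^sub>1 y) = N (x - y)" for x y
    using hN[of x "y - x"] Nneg[of "x - y"] by (simp add: h_def)
  have "seminorm N"
  proof
    fix t :: real and v w :: 'v
    have "N (t *\<^sub>R v) = t * N v" if "t > 0" for t v using pos[OF that, of 0 v] by (simp add: hN)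
    from this[of t v] this[of "- t" v] show "N (t *\<^sub>R v) = \<bar>t\<bar> * N v"
      using Nneg[of "t *\<^sub>R v"] N0 by (cases t "0::real" rule: linorder_cases) auto
    show "N (v + w) \<le> N v + N w"
      using p1.d_triangle[OF f(1) f(1) f(1), of "v + w" 0 w] by (simp add: d)
  qed
  then show ?thesis using d by blast
qed

text \<open>In an inner product space the right side minus the left side for
  \<open>\<eta> = 1\<close> is the squared norm of a - b + c - e. The condition speaks of distances
  only, so it can be pulled back along maps that preserve them.\<close>

definition locally_quadrilateral :: "'m set \<Rightarrow> ('m \<Rightarrow> 'm \<Rightarrow> real) \<Rightarrow> bool" where
  "locally_quadrilateral X d \<longleftrightarrow>
     (\<forall>p\<in>X. \<forall>\<eta>>1. \<exists>\<delta>>0. \<forall>a\<in>X. \<forall>b\<in>X. \<forall>c\<in>X. \<forall>e\<in>X.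
        d p a < \<delta> \<and> d p b < \<delta> \<and> d p c < \<delta> \<and> d p e < \<delta> \<longrightarrow>
        (d a c)\<^sup>2 + (d b e)\<^sup>2 \<le> \<eta> * ((d a b)\<^sup>2 + (d b c)\<^sup>2 + (d c e)\<^sup>2 + (d e a)\<^sup>2))"

text \<open>The images of 0, t u, t (u + v) and t v form a small quadrilateral; by homogeneity the
  factor t^2 cancels, and \<open>\<eta>\<close> tending to 1 leaves one half of the parallelogram
  law, which implies the other half.\<close>

lemma seminorm_quadratic:
  assumes "seminorm N" "locally_quadrilateral X d"
    and f: "\<And>x. f x \<in> X" "\<And>x y. d (f x) (f y) = N (x - y)"
  shows "quadratic_seminorm N"
proof -
  interpret seminorm N by fact
  have le\<eta>: "(N (u + v))\<^sup>2 + (N (u - v))\<^sup>2 \<le> \<eta> * (2 * (N u)\<^sup>2 + 2 * (N v)\<^sup>2)" if \<eta>: "\<eta> > 1" for u v \<eta>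
  proof -
    obtain \<delta> where "\<delta> > 0" and \<delta>: "\<And>a b c e. a \<in> X \<Longrightarrow> b \<in> X \<Longrightarrow> c \<in> X \<Longrightarrow> e \<in> X \<Longrightarrow>
        d (f 0) a < \<delta> \<and> d (f 0) b < \<delta> \<and> d (f 0) c < \<delta> \<and> d (f 0) e < \<delta> \<Longrightarrow>
        (d a c)\<^sup>2 + (d b e)\<^sup>2 \<le> \<eta> * ((d a b)\<^sup>2 + (d b c)\<^sup>2 + (d c e)\<^sup>2 + (d e a)\<^sup>2)"
      using assms(2) f(1)[of 0] \<eta> unfolding locally_quadrilateral_def by metis
    \<comment> \<open>Each of N u, N v and N (u + v) lies below 1 + N u + N v, so all vertices fall
      into the ball of radius \<open>\<delta>\<close>; the summand 1 keeps the denominator positive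
      when both seminorms vanish.\<close>
    define t where "t = \<delta> / (1 + N u + N v)"
    have den: "1 + N u + N v > 0" using nonneg[of u] nonneg[of v] by linarith
    have t: "t > 0" using \<open>\<delta> > 0\<close> den by (simp add: t_def)
    have small: "t * s < \<delta>" if "s < 1 + N u + N v" for s
      using mult_strict_left_mono[OF that t] den by (simp add: t_def)
    have d0: "d (f 0) (f (t *\<^sub>R w)) = t * N w" for w using t by (simp add: f(2) scale)
    have *: "d (f (t *\<^sub>R w)) (f (t *\<^sub>R w')) = t * N (w - w')" for w w'
      using t scale[of t "w - w'"] by (simp add: f(2) scaleR_diff_right)
    have "(d (f (t *\<^sub>R 0)) (f (t *\<^sub>R (u + v))))\<^sup>2 + (d (f (t *\<^sub>R u)) (f (t *\<^sub>R v)))\<^sup>2 \<le>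
      \<eta> * ((d (f (t *\<^sub>R 0)) (f (t *\<^sub>R u)))\<^sup>2 + (d (f (t *\<^sub>R u)) (f (t *\<^sub>R (u + v))))\<^sup>2 +
           (d (f (t *\<^sub>R (u + v))) (f (t *\<^sub>R v)))\<^sup>2 + (d (f (t *\<^sub>R v)) (f (t *\<^sub>R 0)))\<^sup>2)"
      by (rule \<delta>) (use triangle[of u v] nonneg[of u] nonneg[of v] f(1) small \<open>\<delta> > 0\<close> d0[of 0] in
        \<open>auto simp: d0 simp del: nonneg\<close>)
    then have "t\<^sup>2 * ((N (u + v))\<^sup>2 + (N (u - v))\<^sup>2) \<le> t\<^sup>2 * (\<eta> * (2 * (N u)\<^sup>2 + 2 * (N v)\<^sup>2))"
      unfolding * using minus[of "u+v"] by (simp add: power_mult_distrib algebra_simps)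
    then show ?thesis using t by (simp)
  qed
  have le: "(N (u + v))\<^sup>2 + (N (u - v))\<^sup>2 \<le> 2 * (N u)\<^sup>2 + 2 * (N v)\<^sup>2" for u v
  proof (rule field_le_mult_one_interval)
    fix z :: real assume z: "0 < z" "z < 1"
    then show "z * ((N (u + v))\<^sup>2 + (N (u - v))\<^sup>2) \<le> 2 * (N u)\<^sup>2 + 2 * (N v)\<^sup>2"
      using mult_left_mono[OF le\<eta>[of "1 / z" u v], of z] by simp
  qed
  show ?thesis
  proof
    fix x y
    \<comment> \<open>The opposite inequality is \<open>le\<close> for the pair x + y, x - y, whose
      sum and difference are 2 x and 2 y.\<close>
    have "(N (2 *\<^sub>R x))\<^sup>2 + (N (2 *\<^sub>R y))\<^sup>2 \<le> 2 * (N (x + y))\<^sup>2 + 2 * (N (x - y))\<^sup>2"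
      using le[of "x + y" "x - y"] by (simp add: scaleR_2 algebra_simps)
    then show "(N (x + y))\<^sup>2 + (N (x - y))\<^sup>2 = 2 * (N x)\<^sup>2 + 2 * (N y)\<^sup>2"
      using le[of x y] by (simp add: scale power_mult_distrib)
  qed
qed

section \<open>Embedded Euclidean spaces and the rank\<close>

definition euclidean_space_embeds :: "nat \<Rightarrow> 'm set \<Rightarrow> ('m \<Rightarrow> 'm \<Rightarrow> real) \<Rightarrow> bool" where
  "euclidean_space_embeds n X d \<longleftrightarrow>
     (\<exists>f. isometric_map (topspace (Euclidean_space n)) (\<lambda>x y. L2_set (\<lambda>i. x i - y i) {..<n}) X d f)"

lemma euclidean_rank_eq: "euclidean_rank X d = Sup {enat n | n. euclidean_space_embeds n X d}"
  by (simp add: euclidean_rank_def euclidean_space_embeds_def)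

lemma euclidean_space_embeds_le_rank: "euclidean_space_embeds n X d \<Longrightarrow> enat n \<le> euclidean_rank X d"
  unfolding euclidean_rank_eq by (rule Sup_upper) blast

text \<open>The supremum may be infinite, but every finite number below it is reached: otherwise all
  embedded dimensions would be at most n - 1. The embedded point settles n = 0, since the empty set
  also has supremum 0.\<close>

lemma euclidean_rank_attained:
  assumes "euclidean_space_embeds 0 X d" "enat n \<le> euclidean_rank X d"
  shows "\<exists>m\<ge>n. euclidean_space_embeds m X d"
proof (rule ccontr)
  assume *: "\<not> ?thesis"
  then obtain k where k: "n = Suc k" using assms(1) by (cases n) auto
  have "euclidean_rank X d \<le> enat k"
    unfolding euclidean_rank_eq
  proof (rule Sup_least, safe)
    fix m assume "euclidean_space_embeds m X d"
    then have "\<not> n \<le> m" using * by blast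
    then show "enat m \<le> enat k" using k by simp
  qed
  then have "enat n \<le> enat k" using assms(2) order_trans by blast
  then show False using k by simp
qed

text \<open>Truncating sequences at n extends a map from the sequences that vanish from n on to all
  sequences. The domain thus becomes a real vector space that is the same for every n, and only the
  seminorm depends on n.\<close>

lemma euclidean_space_embeds_iff:
  "euclidean_space_embeds n X d \<longleftrightarrow> (\<exists>f. (\<forall>x. f x \<in> X) \<and> (\<forall>x y. d (f x) (f y) = L2_set (x - y) {..<n}))"
    (is "?L \<longleftrightarrow> ?R")
proof
  assume ?L
  then obtain f where f: "\<And>x. \<forall>i\<ge>n. x i = 0 \<Longrightarrow> f x \<in> X"
    "\<And>x y. \<forall>i\<ge>n. x i = 0 \<Longrightarrow> \<forall>i\<ge>n. y i = 0 \<Longrightarrow> d (f x) (f y) = L2_set (\<lambda>i. x i - y i) {..<n}"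
    unfolding euclidean_space_embeds_def isometric_map_def topspace_Euclidean_space Pi_iff by blast
  define tr where "tr x = (\<lambda>i. if i < n then x i else 0)" for x :: "nat \<Rightarrow> real"
  have "f (tr x) \<in> X" for x by (rule f) (simp add: tr_def)
  moreover have "d (f (tr x)) (f (tr y)) = L2_set (x - y) {..<n}" for x y
    by (subst f(2)) (auto simp: tr_def intro!: L2_set_cong)
  ultimately show ?R by (intro exI[of _ "f \<circ> tr"]) simp
next
  assume ?R
  then show ?L
    by (auto simp: euclidean_space_embeds_def isometric_map_def fun_diff_def)
qed

lemma euclidean_space_embeds_0:
  assumes "pseudometric X d" "X \<noteq> {}"
  shows "euclidean_space_embeds 0 X d"
proof -
  obtain p where "p \<in> X" using assms by auto
  then show ?thesis
    using pseudometric.d_self[OF assms(1)] by (auto simp: euclidean_space_embeds_iff intro!: exI[of _ "\<lambda>_. p"])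
qed

lemma seminorm_L2_set: "seminorm (\<lambda>x :: nat \<Rightarrow> real. L2_set x {..<n})"
proof
  fix t :: real and x y :: "nat \<Rightarrow> real"
  show "L2_set (t *\<^sub>R x) {..<n} = \<bar>t\<bar> * L2_set x {..<n}"
    by (simp add: L2_set_def scaleR_fun_def power_mult_distrib real_sqrt_mult flip: sum_distrib_left)
  show "L2_set (x + y) {..<n} \<le> L2_set x {..<n} + L2_set y {..<n}"
    using L2_set_triangle_ineq[of x y "{..<n}"] by (simp add: plus_fun_def)
qed

definition (in quadratic_seminorm) orthonormal :: "nat \<Rightarrow> (nat \<Rightarrow> 'v) \<Rightarrow> bool" where
  "orthonormal m e \<longleftrightarrow> (\<forall>j<m. \<forall>k<m. form (e j) (e k) = (if j = k then 1 else 0))"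

lemma (in quadratic_seminorm) orthonormal_embeds:
  assumes "orthonormal m e" "\<And>x. f x \<in> X" "\<And>x y. d (f x) (f y) = N (x - y)"
  shows "euclidean_space_embeds m X d"
proof -
  have "N ((\<Sum>j<m. x j *\<^sub>R e j) - (\<Sum>j<m. y j *\<^sub>R e j)) = L2_set (x - y) {..<m}" for x y
  proof (rule power2_eq_imp_eq)
    have "(\<Sum>j<m. x j *\<^sub>R e j) - (\<Sum>j<m. y j *\<^sub>R e j) = (\<Sum>j<m. (x - y) j *\<^sub>R e j)"
      by (simp add: scaleR_diff_left sum_subtractf)
    then show "(N ((\<Sum>j<m. x j *\<^sub>R e j) - (\<Sum>j<m. y j *\<^sub>R e j)))\<^sup>2 = (L2_set (x - y) {..<m})\<^sup>2"
      using norm_sum_orthonormal[of m e "x - y"] assms(1)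
      by (simp add: orthonormal_def L2_set_def sum_nonneg)
  qed auto
  then show ?thesis
    unfolding euclidean_space_embeds_iff using assms(2,3)
    by (intro exI[of _ "\<lambda>y. f (\<Sum>j<m. y j *\<^sub>R e j)"]) auto
qed

text \<open>A Gram-Schmidt step, meant for contraposition: a vector orthogonal to an orthonormal
  family of maximal size has seminorm 0.\<close>

lemma (in quadratic_seminorm) orthonormal_extend:
  assumes e: "orthonormal m e" and v: "N v \<noteq> 0" "\<And>j. j < m \<Longrightarrow> form (e j) v = 0"
  shows "\<exists>e'. orthonormal (Suc m) e'"
proof -
  let ?w = "(1 / N v) *\<^sub>R v"
  have "form ?w ?w = 1" using v(1) by (simp add: form_self scale)
  moreover have "form (e j) ?w = 0" "form ?w (e j) = 0" if "j < m" for j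
    using v(2)[OF that] form_scale[of "1 / N v" v "e j"] by (simp_all only: form_sym[of "e j"] mult_zero_right)
  ultimately have "orthonormal (Suc m) (e(m := ?w))"
    using e by (auto simp: orthonormal_def less_Suc_eq)
  then show ?thesis by blast
qed

lemma euclidean_space_embeds_product_le:
  assumes p1: "pseudometric X\<^sub>1 d\<^sub>1" and p2: "pseudometric X\<^sub>2 d\<^sub>2"
    and q1: "locally_quadrilateral X\<^sub>1 d\<^sub>1" and q2: "locally_quadrilateral X\<^sub>2 d\<^sub>2"
    and D: "\<And>p q p' q'. \<lbrakk>p \<in> X\<^sub>1; q \<in> X\<^sub>2; p' \<in> X\<^sub>1; q' \<in> X\<^sub>2\<rbrakk> \<Longrightarrow>
      D (p, q) (p', q') = sqrt ((d\<^sub>1 p p')\<^sup>2 + (d\<^sub>2 q q')\<^sup>2)"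
    and emb: "euclidean_space_embeds n (X\<^sub>1 \<times> X\<^sub>2) D"
  shows "enat n \<le> euclidean_rank X\<^sub>1 d\<^sub>1 + euclidean_rank X\<^sub>2 d\<^sub>2"
\<comment> \<open>An infinite rank leaves nothing to show. Finite ranks bound the sizes of
  orthonormal families, so families of maximal size exist.\<close>
proof (cases "euclidean_rank X\<^sub>1 d\<^sub>1 = \<infinity> \<or> euclidean_rank X\<^sub>2 d\<^sub>2 = \<infinity>")
  case True
  then show ?thesis by auto
next
  case False
  then obtain r1 r2 where r1: "euclidean_rank X\<^sub>1 d\<^sub>1 = enat r1" and r2: "euclidean_rank X\<^sub>2 d\<^sub>2 = enat r2"
    by auto
  obtain f where f: "\<And>x. f x \<in> X\<^sub>1 \<times> X\<^sub>2" "\<And>x y. D (f x) (f y) = L2_set (x - y) {..<n}"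
    using emb by (auto simp: euclidean_space_embeds_iff)
  define f1 f2 where "f1 = fst \<circ> f" and "f2 = snd \<circ> f"
  have f1: "f1 x \<in> X\<^sub>1" and f2: "f2 x \<in> X\<^sub>2" for x using f(1)[of x] by (auto simp: f1_def f2_def mem_Times_iff)
  have eq: "(d\<^sub>1 (f1 x) (f1 y))\<^sup>2 + (d\<^sub>2 (f2 x) (f2 y))\<^sup>2 = (L2_set (x - y) {..<n})\<^sup>2" for x y
  proof -
    have "D (f1 x, f2 x) (f1 y, f2 y) = L2_set (x - y) {..<n}" using f(2)[of x y] by (simp add: f1_def f2_def)
    then have "L2_set (x - y) {..<n} = sqrt ((d\<^sub>1 (f1 x) (f1 y))\<^sup>2 + (d\<^sub>2 (f2 x) (f2 y))\<^sup>2)"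
      using D[OF f1 f2 f1 f2, of x x y y] by simp
    then show ?thesis by simp
  qed
  have "\<exists>N. seminorm N \<and> (\<forall>x y. d\<^sub>1 (f1 x) (f1 y) = N (x - y))"
    by (rule isometric_into_product_component[OF seminorm_L2_set p1 p2 f1 f2]) (rule eq)
  then obtain N1 where N1: "seminorm N1" "\<And>x y. d\<^sub>1 (f1 x) (f1 y) = N1 (x - y)"
    by blast
  have eq': "(d\<^sub>2 (f2 x) (f2 y))\<^sup>2 + (d\<^sub>1 (f1 x) (f1 y))\<^sup>2 = (L2_set (x - y) {..<n})\<^sup>2" for x y
    using eq[of x y] by simp
  have "\<exists>N. seminorm N \<and> (\<forall>x y. d\<^sub>2 (f2 x) (f2 y) = N (x - y))"
    by (rule isometric_into_product_component[OF seminorm_L2_set p2 p1 f2 f1]) (rule eq')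
  then obtain N2 where N2: "seminorm N2" "\<And>x y. d\<^sub>2 (f2 x) (f2 y) = N2 (x - y)"
    by blast
  interpret N1: quadratic_seminorm N1 using seminorm_quadratic[where f = f1, OF N1(1) q1 f1 N1(2)] .
  interpret N2: quadratic_seminorm N2 using seminorm_quadratic[where f = f2, OF N2(1) q2 f2 N2(2)] .
  have b1: "m \<le> r1" if "N1.orthonormal m e" for m e
    using euclidean_space_embeds_le_rank[OF N1.orthonormal_embeds[where f = f1, OF that f1 N1(2)]] r1 by simp
  have b2: "m \<le> r2" if "N2.orthonormal m e" for m e
    using euclidean_space_embeds_le_rank[OF N2.orthonormal_embeds[where f = f2, OF that f2 N2(2)]] r2 by simp
  obtain m1 where m1: "\<exists>e. N1.orthonormal m1 e" "\<And>m. (\<exists>e. N1.orthonormal m e) \<Longrightarrow> m \<le> m1"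
  proof -
    have "\<exists>e. N1.orthonormal 0 e" by (simp add: N1.orthonormal_def)
    then show ?thesis
      using Nat.ex_has_greatest_nat[of "\<lambda>m. \<exists>e. N1.orthonormal m e" 0 r1] b1 that by blast
  qed
  obtain m2 where m2: "\<exists>e. N2.orthonormal m2 e" "\<And>m. (\<exists>e. N2.orthonormal m e) \<Longrightarrow> m \<le> m2"
  proof -
    have "\<exists>e. N2.orthonormal 0 e" by (simp add: N2.orthonormal_def)
    then show ?thesis
      using Nat.ex_has_greatest_nat[of "\<lambda>m. \<exists>e. N2.orthonormal m e" 0 r2] b2 that by blast
  qed
  obtain e1 where e1: "N1.orthonormal m1 e1" using m1 by blast
  obtain e2 where e2: "N2.orthonormal m2 e2" using m2 by blast
  have "n \<le> m1 + m2"
  proof (rule ccontr)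
    assume "\<not> n \<le> m1 + m2"
    then have less: "m1 + m2 < card {..<n}" by simp
    define u where "u i = (\<lambda>j. if j = i then 1 else 0 :: real)" for i :: nat
    \<comment> \<open>One equation per family member: the indices below \<open>m1\<close> express
      orthogonality to \<open>e1\<close>, the next \<open>m2\<close> orthogonality to
      \<open>e2\<close>.\<close>
    define a where "a k i = (if k < m1 then N1.form (u i) (e1 k) else N2.form (u i) (e2 (k - m1)))" for k i
    obtain v where v: "\<exists>i\<in>{..<n}. v i \<noteq> 0" "\<And>k. k < m1 + m2 \<Longrightarrow> (\<Sum>i<n. a k i * v i) = 0"
      using homogeneous_system_nontrivial[OF _ less, of a] by auto
    define w where "w = (\<Sum>i<n. v i *\<^sub>R u i)"
    have wi: "w i = v i" if "i < n" for i
      using that by (simp add: w_def sum_fun_apply u_def if_distrib cong: if_cong)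
    have o1: "N1.form (e1 k) w = 0" if "k < m1" for k
      using v(2)[of k] that by (subst N1.form_sym) (simp add: w_def N1.form_sum a_def mult.commute)
    have o2: "N2.form (e2 k) w = 0" if "k < m2" for k
      using v(2)[of "m1 + k"] that by (subst N2.form_sym) (simp add: w_def N2.form_sum a_def mult.commute)
    have "N1 w = 0"
    proof (rule ccontr)
      assume "N1 w \<noteq> 0"
      then show False using N1.orthonormal_extend[OF e1 _ o1] m1(2)[of "Suc m1"] by auto
    qed
    moreover have "N2 w = 0"
    proof (rule ccontr)
      assume "N2 w \<noteq> 0"
      then show False using N2.orthonormal_extend[OF e2 _ o2] m2(2)[of "Suc m2"] by auto
    qed
    \<comment> \<open>By \<open>eq\<close> the squared Euclidean length of \<open>w\<close> is the
      sum of the squares of the two seminorms.\<close>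
    ultimately have "L2_set w {..<n} = 0"
      using eq[of w 0] N1(2)[of w 0] N2(2)[of w 0] by simp
    then show False using v(1) wi by (auto simp: L2_set_eq_0_iff)
  qed
  moreover have "m1 \<le> r1" "m2 \<le> r2" using b1[OF e1] b2[OF e2] .
  ultimately show ?thesis by (simp add: r1 r2)
qed

text \<open>The coordinates are split: the first \<open>m\<close> go to the map into the first
  factor, the next \<open>n\<close>, shifted down by \<open>m\<close>, to the other map.\<close>

lemma euclidean_space_embeds_product:
  assumes D: "\<And>p q p' q'. \<lbrakk>p \<in> X\<^sub>1; q \<in> X\<^sub>2; p' \<in> X\<^sub>1; q' \<in> X\<^sub>2\<rbrakk> \<Longrightarrow>
      D (p, q) (p', q') = sqrt ((d\<^sub>1 p p')\<^sup>2 + (d\<^sub>2 q q')\<^sup>2)"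
    and emb: "euclidean_space_embeds m X\<^sub>1 d\<^sub>1" "euclidean_space_embeds n X\<^sub>2 d\<^sub>2"
  shows "euclidean_space_embeds (m + n) (X\<^sub>1 \<times> X\<^sub>2) D"
proof -
  obtain f where f: "\<And>x. f x \<in> X\<^sub>1" "\<And>x y. d\<^sub>1 (f x) (f y) = L2_set (x - y) {..<m}"
    using emb(1) by (auto simp: euclidean_space_embeds_iff)
  obtain g where g: "\<And>x. g x \<in> X\<^sub>2" "\<And>x y. d\<^sub>2 (g x) (g y) = L2_set (x - y) {..<n}"
    using emb(2) by (auto simp: euclidean_space_embeds_iff)
  have "D (f x, g (\<lambda>i. x (m + i))) (f y, g (\<lambda>i. y (m + i))) = L2_set (x - y) {..<m + n}" for x y
  proof -
    have "(\<Sum>i<m + n. (x i - y i)\<^sup>2) = (\<Sum>i<m. (x i - y i)\<^sup>2) + (\<Sum>i<n. (x (m + i) - y (m + i))\<^sup>2)"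
      by (induction n) simp_all
    then show ?thesis
      by (simp add: D f g L2_set_def sum_nonneg)
  qed
  then show ?thesis
    unfolding euclidean_space_embeds_iff using f(1) g(1)
    by (intro exI[of _ "\<lambda>x. (f x, g (\<lambda>i. x (m + i)))"]) auto
qed

theorem euclidean_rank_product:
  assumes p1: "pseudometric X\<^sub>1 d\<^sub>1" and p2: "pseudometric X\<^sub>2 d\<^sub>2"
    and ne: "X\<^sub>1 \<noteq> {}" "X\<^sub>2 \<noteq> {}"
    and q1: "locally_quadrilateral X\<^sub>1 d\<^sub>1" and q2: "locally_quadrilateral X\<^sub>2 d\<^sub>2"
    and D: "\<And>p q p' q'. \<lbrakk>p \<in> X\<^sub>1; q \<in> X\<^sub>2; p' \<in> X\<^sub>1; q' \<in> X\<^sub>2\<rbrakk> \<Longrightarrow>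
      D (p, q) (p', q') = sqrt ((d\<^sub>1 p p')\<^sup>2 + (d\<^sub>2 q q')\<^sup>2)"
  shows "euclidean_rank X\<^sub>1 d\<^sub>1 + euclidean_rank X\<^sub>2 d\<^sub>2 = euclidean_rank (X\<^sub>1 \<times> X\<^sub>2) D"
proof (rule antisym)
  show "euclidean_rank (X\<^sub>1 \<times> X\<^sub>2) D \<le> euclidean_rank X\<^sub>1 d\<^sub>1 + euclidean_rank X\<^sub>2 d\<^sub>2"
    unfolding euclidean_rank_eq[of "X\<^sub>1 \<times> X\<^sub>2"]
    by (rule Sup_least) (use euclidean_space_embeds_product_le[OF p1 p2 q1 q2 D] in blast)
  have *: "enat (m + n) \<le> euclidean_rank (X\<^sub>1 \<times> X\<^sub>2) D"
    if mn: "enat m \<le> euclidean_rank X\<^sub>1 d\<^sub>1" "enat n \<le> euclidean_rank X\<^sub>2 d\<^sub>2" for m n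
  proof -
    obtain m' where m': "m \<le> m'" "euclidean_space_embeds m' X\<^sub>1 d\<^sub>1"
      using euclidean_rank_attained[OF euclidean_space_embeds_0[OF p1 ne(1)] mn(1)] by blast
    obtain n' where n': "n \<le> n'" "euclidean_space_embeds n' X\<^sub>2 d\<^sub>2"
      using euclidean_rank_attained[OF euclidean_space_embeds_0[OF p2 ne(2)] mn(2)] by blast
    have "enat (m' + n') \<le> euclidean_rank (X\<^sub>1 \<times> X\<^sub>2) D"
      by (rule euclidean_space_embeds_le_rank,
          rule euclidean_space_embeds_product[of X\<^sub>1 X\<^sub>2 D d\<^sub>1 d\<^sub>2]) (use D m' n' in auto)
    moreover have "enat (m + n) \<le> enat (m' + n')" using m'(1) n'(1) by simp
    ultimately show ?thesis by (rule order_trans[rotated])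
  qed
  show "euclidean_rank X\<^sub>1 d\<^sub>1 + euclidean_rank X\<^sub>2 d\<^sub>2 \<le> euclidean_rank (X\<^sub>1 \<times> X\<^sub>2) D"
  proof (cases "euclidean_rank (X\<^sub>1 \<times> X\<^sub>2) D")
    case (enat k)
    \<comment> \<open>A factor of rank above \<open>k\<close>, paired with a point of the other
      factor, would give the product a rank above \<open>k\<close>. Hence both ranks are
      finite.\<close>
    have "\<not> enat (Suc k) \<le> euclidean_rank X\<^sub>1 d\<^sub>1" "\<not> enat (Suc k) \<le> euclidean_rank X\<^sub>2 d\<^sub>2"
      using *[of "Suc k" 0] *[of 0 "Suc k"] enat by (auto simp: zero_enat_def[symmetric])
    then obtain r1 r2 where r: "euclidean_rank X\<^sub>1 d\<^sub>1 = enat r1" "euclidean_rank X\<^sub>2 d\<^sub>2 = enat r2"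
      by (cases "euclidean_rank X\<^sub>1 d\<^sub>1"; cases "euclidean_rank X\<^sub>2 d\<^sub>2") auto
    show ?thesis using *[of r1 r2] by (simp add: r)
  qed auto
qed

subsection \<open>Curves in charts\<close>

text \<open>Meant for functions such as velocities and speeds, which have a usable formula only near
  each single point, where one chart or one local extension serves.\<close>

lemma continuous_on_local:
  fixes f :: "'a::t2_space \<Rightarrow> 'b::topological_space"
  assumes "\<And>t. t \<in> A \<Longrightarrow> \<exists>W g. open W \<and> t \<in> W \<and> continuous_on (A \<inter> W) g \<and> (\<forall>s\<in>A \<inter> W. f s = g s)"
  shows "continuous_on A f"
  unfolding continuous_on_eq_continuous_within
proof
  fix t assume t: "t \<in> A"
  then obtain W g where W: "open W" "t \<in> W" "continuous_on (A \<inter> W) g" "\<forall>s\<in>A \<inter> W. f s = g s"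
    using assms by blast
  then have "continuous_on (A \<inter> W) f" by (auto intro: continuous_on_eq[of _ g])
  then have "continuous (at t within A \<inter> W) f"
    using t W by (simp add: continuous_on_eq_continuous_within)
  moreover have "at t within A \<inter> W = at t within A"
    by (rule at_within_nhd[OF W(2,1)]) auto
  ultimately show "continuous (at t within A) f" by simp
qed

lemma continuous_map_preimage_nhd:
  assumes "continuous_map (top_of_set T) X c" "openin X U" "t \<in> T" "c t \<in> U"
  obtains W where "open W" "t \<in> W" "\<And>s. s \<in> T \<inter> W \<longleftrightarrow> s \<in> T \<and> c s \<in> U"
proof -
  have "openin (top_of_set T) {s \<in> T. c s \<in> U}"
    using openin_continuous_map_preimage[OF assms(1,2)] by simp
  then obtain W where "open W" "{s \<in> T. c s \<in> U} = T \<inter> W"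
    unfolding openin_open by blast
  then show ?thesis using that[of W] assms(3,4) by blast
qed

text \<open>Velocities are computed in the ambient type, while the tensor axioms speak of vectors of
  \<open>model\<close>. Expanding in an orthonormal basis of the subspace shows that f is its own
  projection, and differentiating gives the same for v.\<close>

lemma vector_derivative_in_subspace:
  fixes f :: "real \<Rightarrow> 'a::euclidean_space"
  assumes d: "(f has_vector_derivative v) (at t within T)" and nb: "at t within T \<noteq> bot"
    and S: "subspace S" "\<And>s. s \<in> T \<Longrightarrow> f s \<in> S" "t \<in> T"
  shows "v \<in> S"
proof -
  obtain B where B: "B \<subseteq> S" "pairwise orthogonal B" "\<And>x. x \<in> B \<Longrightarrow> norm x = 1" "independent B" "span B = S"
    using orthonormal_basis_subspace[OF S(1)] by metis
  have fB: "finite B" using B(4) by (rule independent_imp_finite)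
  have e: "(\<Sum>b\<in>B. (f s \<bullet> b) *\<^sub>R b) = f s" if "s \<in> T" for s
    using orthonormal_basis_expand[OF B(2,3)] S(2)[OF that] B(5) fB by blast
  have "((\<lambda>s. \<Sum>b\<in>B. (f s \<bullet> b) *\<^sub>R b) has_vector_derivative (\<Sum>b\<in>B. (v \<bullet> b) *\<^sub>R b)) (at t within T)"
    using d unfolding has_vector_derivative_def
    by (auto intro!: derivative_eq_intros sum.cong simp: scaleR_sum_right)
  then have "(f has_vector_derivative (\<Sum>b\<in>B. (v \<bullet> b) *\<^sub>R b)) (at t within T)"
    by (rule has_vector_derivative_transform[rotated 2]) (use S e in auto)
  then have "v = (\<Sum>b\<in>B. (v \<bullet> b) *\<^sub>R b)"
    using vector_derivative_unique_within[OF nb d] by simp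
  also have "\<dots> \<in> S" using B(1) S(1) by (auto intro!: subspace_sum subspace_scale)
  finally show ?thesis .
qed

text \<open>The parameter set is left open because two choices matter: on a piece
  \<open>{u..v}\<close> the one-sided derivatives make the speed continuous up to the ends, while
  \<open>UNIV\<close> allows different pieces to be treated by one function. Both agree inside a
  piece.\<close>

definition speed_within :: "('i, 'm, 'a::euclidean_space) riemannian \<Rightarrow> real set \<Rightarrow> (real \<Rightarrow> 'm) \<Rightarrow> real \<Rightarrow> real"
  where
  "speed_within M T c t =
     (let i = (SOME i. i \<in> charts M \<and> c t \<in> cdom M i);
          v = vector_derivative (cmap M i \<circ> c) (at t within T)
      in sqrt (tensor M i (cmap M i (c t)) v v))"

lemma speed_eq: "speed M c = speed_within M {0..1} c"
  by (simp add: fun_eq_iff speed_def speed_within_def)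

lemma speed_within_interior:
  "u < t \<Longrightarrow> t < v \<Longrightarrow> speed_within M {u..v} c t = speed_within M UNIV c t"
  by (simp add: speed_within_def at_within_Icc_at)

lemma C1_curve_on_subset: "C1_curve_on M T c \<Longrightarrow> S \<subseteq> T \<Longrightarrow> C1_curve_on M S c"
  unfolding C1_curve_on_def
proof (intro ballI)
  fix i assume *: "\<forall>i\<in>charts M. \<exists>D. continuous_on {t \<in> T. c t \<in> cdom M i} D \<and>
        (\<forall>t\<in>T. c t \<in> cdom M i \<longrightarrow> (cmap M i \<circ> c has_vector_derivative D t) (at t within T))"
    and S: "S \<subseteq> T" and i: "i \<in> charts M"
  then obtain D where "continuous_on {t \<in> T. c t \<in> cdom M i} D"
        "\<forall>t\<in>T. c t \<in> cdom M i \<longrightarrow> (cmap M i \<circ> c has_vector_derivative D t) (at t within T)" by blast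
  then show "\<exists>D. continuous_on {t \<in> S. c t \<in> cdom M i} D \<and>
        (\<forall>t\<in>S. c t \<in> cdom M i \<longrightarrow> (cmap M i \<circ> c has_vector_derivative D t) (at t within S))"
    using S by (intro exI[of _ D]) (auto intro: continuous_on_subset has_vector_derivative_within_subset)
qed

section \<open>Charts along a curve and changes of coordinates\<close>

context smooth_manifold
begin

lemma cdom_subset: "i \<in> charts M \<Longrightarrow> cdom M i \<subseteq> topspace (mtop M)"
  using charts_cover by blast

lemma ex_chart: "q \<in> topspace (mtop M) \<Longrightarrow> \<exists>i. i \<in> charts M \<and> q \<in> cdom M i"
  using charts_cover by blast

lemma cmap_in_model: "i \<in> charts M \<Longrightarrow> q \<in> cdom M i \<Longrightarrow> cmap M i q \<in> model M"
  using openin_subset[OF chart_image] by auto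

lemma topspace_cdom: "i \<in> charts M \<Longrightarrow> topspace (subtopology (mtop M) (cdom M i)) = cdom M i"
  using cdom_subset by auto

lemma inj_on_cmap: "i \<in> charts M \<Longrightarrow> inj_on (cmap M i) (cdom M i)"
  using homeomorphic_imp_injective_map[OF chart_homeomorphic] topspace_cdom by simp

lemma continuous_map_cmap:
  "i \<in> charts M \<Longrightarrow> continuous_map (subtopology (mtop M) (cdom M i)) euclidean (cmap M i)"
  using homeomorphic_imp_continuous_map[OF chart_homeomorphic] continuous_map_into_fulltopology by blast

lemma continuous_map_inv_cmap:
  assumes i: "i \<in> charts M"
  shows "continuous_map (top_of_set (cmap M i ` cdom M i)) (mtop M) (inv_into (cdom M i) (cmap M i))"
proof -
  obtain g where g: "homeomorphic_maps (subtopology (mtop M) (cdom M i)) (top_of_set (cmap M i ` cdom M i)) (cmap M i) g"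
    using chart_homeomorphic[OF i] homeomorphic_map_maps by blast
  then have "continuous_map (top_of_set (cmap M i ` cdom M i)) (mtop M) g"
    unfolding homeomorphic_maps_def using continuous_map_into_fulltopology by blast
  moreover have "g y = inv_into (cdom M i) (cmap M i) y" if "y \<in> cmap M i ` cdom M i" for y
    using that g i inj_on_cmap[OF i] topspace_cdom[OF i] by (auto simp: homeomorphic_maps_def)
  ultimately show ?thesis by (auto intro: continuous_map_eq)
qed

lemma transition_cmap: "i \<in> charts M \<Longrightarrow> q \<in> cdom M i \<Longrightarrow> transition M i j (cmap M i q) = cmap M j q"
  using inj_on_cmap by (simp add: transition_def)

lemma continuous_on_cmap_curve:
  assumes "continuous_map (top_of_set T) (mtop M) c" "i \<in> charts M" "S \<subseteq> T" "c ` S \<subseteq> cdom M i"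
  shows "continuous_on S (cmap M i \<circ> c)"
proof -
  have "continuous_map (top_of_set S) (mtop M) c"
    using assms(1,3) by (metis continuous_map_from_subtopology_mono)
  then have "continuous_map (top_of_set S) (subtopology (mtop M) (cdom M i)) c"
    using assms(4) by (auto simp: continuous_map_in_subtopology)
  then have "continuous_map (top_of_set S) euclidean (cmap M i \<circ> c)"
    using continuous_map_cmap[OF assms(2)] by (rule continuous_map_compose)
  then show ?thesis by simp
qed

lemma curve_in_chart_nhd:
  assumes "continuous_map (top_of_set T) (mtop M) c" "i \<in> charts M" "t \<in> T" "c t \<in> cdom M i"
  obtains W where "open W" "t \<in> W" "\<And>s. s \<in> T \<inter> W \<longleftrightarrow> s \<in> T \<and> c s \<in> cdom M i"
  using continuous_map_preimage_nhd[OF assms(1) chart_domain[OF assms(2)] assms(3,4)] by blast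

lemma velocity_in_model:
  assumes c: "continuous_map (top_of_set T) (mtop M) c" and i: "i \<in> charts M" and t: "t \<in> T" "c t \<in> cdom M i"
    and d: "(cmap M i \<circ> c has_vector_derivative v) (at t within T)" and nb: "at t within T \<noteq> bot"
  shows "v \<in> model M"
proof -
  obtain W where W: "open W" "t \<in> W" "\<And>s. s \<in> T \<inter> W \<longleftrightarrow> s \<in> T \<and> c s \<in> cdom M i"
    using curve_in_chart_nhd[OF c i t] by blast
  have eq: "at t within T \<inter> W = at t within T" by (rule at_within_nhd[OF W(2,1)]) auto
  have "(cmap M i \<circ> c) s \<in> model M" if "s \<in> T \<inter> W" for s
    using W(3) that cmap_in_model[OF i] by simp
  then show ?thesis
    using vector_derivative_in_subspace[of "cmap M i \<circ> c" v t "T \<inter> W"] d nb subspace_model t(1) W(2)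
    unfolding eq by blast
qed

text \<open>Chart images are open only relative to \<open>model\<close>, so coordinate changes are
  differentiated through ambient extensions. This extracts from \<open>smooth_on\<close> the
  first-order information about such an extension.\<close>

lemma transition_extension:
  assumes i: "i \<in> charts M" and j: "j \<in> charts M" and q: "q \<in> cdom M i" "q \<in> cdom M j"
  obtains W h where "open W" "cmap M i q \<in> W" "continuous_on W h" "\<And>x. x \<in> W \<Longrightarrow> h differentiable (at x)"
    "\<And>v. continuous_on W (\<lambda>x. frechet_derivative h (at x) v)"
    "\<And>p. \<lbrakk>p \<in> cdom M i; p \<in> cdom M j; cmap M i p \<in> W\<rbrakk> \<Longrightarrow> h (cmap M i p) = cmap M j p"
    "\<And>x. x \<in> W \<Longrightarrow> x \<in> cmap M i ` (cdom M i \<inter> cdom M j) \<Longrightarrow> h x = transition M i j x"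
proof -
  let ?A = "cmap M i ` (cdom M i \<inter> cdom M j)"
  have "cmap M i q \<in> ?A" using q by blast
  then have "\<exists>W h. open W \<and> cmap M i q \<in> W \<and> (\<forall>k. Ck_on k W h) \<and> (\<forall>y\<in>?A \<inter> W. h y = transition M i j y)"
    using transition_smooth[OF i j] unfolding smooth_on_def by (rule bspec[rotated])
  then obtain W h where W: "open W" "cmap M i q \<in> W" "\<forall>k. Ck_on k W h" "\<forall>y\<in>?A \<inter> W. h y = transition M i j y"
    by (elim exE conjE)
  show ?thesis
  proof (rule that[OF W(1,2)])
    show "continuous_on W h" using W(3)[rule_format, of 0] by simp
    show "h differentiable (at x)" if "x \<in> W" for x
      using W(3)[rule_format, of "Suc 0"] that by simp
    show "continuous_on W (\<lambda>x. frechet_derivative h (at x) v)" for v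
      using W(3)[rule_format, of "Suc 0"] by simp
    show *: "h x = transition M i j x" if "x \<in> W" "x \<in> ?A" for x using W(4) that by blast
    show "h (cmap M i p) = cmap M j p" if "p \<in> cdom M i" "p \<in> cdom M j" "cmap M i p \<in> W" for p
      using *[OF that(3)] that transition_cmap[OF i that(1)] by simp
  qed
qed

text \<open>The chain rule. The derivative of an ambient extension serves as \<open>D\<close>, in
  the form that the transformation law of the tensor asks for: a derivative within the image of the
  overlap.\<close>

lemma coordinate_change:
  assumes c: "continuous_map (top_of_set T) (mtop M) c" and i: "i \<in> charts M" and j: "j \<in> charts M"
    and t: "t \<in> T" "c t \<in> cdom M i" "c t \<in> cdom M j"
    and d: "(cmap M i \<circ> c has_vector_derivative v) (at t within T)"
  obtains D where "(transition M i j has_derivative D) (at (cmap M i (c t)) within cmap M i ` (cdom M i \<inter> cdom M j))"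
    "(cmap M j \<circ> c has_vector_derivative D v) (at t within T)"
proof -
  obtain W h where h: "open W" "cmap M i (c t) \<in> W" "\<And>x. x \<in> W \<Longrightarrow> h differentiable (at x)"
    "\<And>x. x \<in> W \<Longrightarrow> x \<in> cmap M i ` (cdom M i \<inter> cdom M j) \<Longrightarrow> h x = transition M i j x"
    using transition_extension[OF i j t(2,3)] by metis
  let ?A = "cmap M i ` (cdom M i \<inter> cdom M j)" and ?x = "cmap M i (c t)"
  let ?D = "frechet_derivative h (at ?x)"
  have "(h has_derivative ?D) (at ?x)" using h(2,3) frechet_derivative_works by blast
  then have "(h has_derivative ?D) (at ?x within ?A \<inter> W)" by (rule has_derivative_at_withinI)
  then have "(transition M i j has_derivative ?D) (at ?x within ?A \<inter> W)"
    by (rule has_derivative_transform[rotated 2]) (use h(2,4) t in auto)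
  then have trd: "(transition M i j has_derivative ?D) (at ?x within ?A)"
    by (subst (asm) at_within_nhd[OF h(2,1)]) auto
  obtain W1 where W1: "open W1" "t \<in> W1" "\<And>s. s \<in> T \<inter> W1 \<longleftrightarrow> s \<in> T \<and> c s \<in> cdom M i"
    using curve_in_chart_nhd[OF c i t(1,2)] by blast
  obtain W2 where W2: "open W2" "t \<in> W2" "\<And>s. s \<in> T \<inter> W2 \<longleftrightarrow> s \<in> T \<and> c s \<in> cdom M j"
    using curve_in_chart_nhd[OF c j t(1,3)] by blast
  \<comment> \<open>Near t the curve lies in both chart domains; restricting to such parameters does
    not alter derivatives at t.\<close>
  let ?T = "T \<inter> (W1 \<inter> W2)"
  have eq: "at t within ?T = at t within T" by (rule at_within_nhd[of t "W1 \<inter> W2"]) (use W1(1,2) W2(1,2) in auto)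
  have tT: "t \<in> ?T" using t(1) W1(2) W2(2) by blast
  have dom: "c s \<in> cdom M i \<and> c s \<in> cdom M j" if "s \<in> ?T" for s using that W1(3) W2(3) by blast
  have "(cmap M i \<circ> c has_vector_derivative v) (at t within ?T)" using d by (simp add: eq)
  moreover have "(transition M i j has_derivative ?D) (at ((cmap M i \<circ> c) t) within (cmap M i \<circ> c) ` ?T)"
    unfolding comp_apply by (rule has_derivative_subset[OF trd]) (use dom in auto)
  ultimately have "(transition M i j \<circ> (cmap M i \<circ> c) has_vector_derivative ?D v) (at t within ?T)"
    by (rule vector_derivative_diff_chain_within)
  then have "(cmap M j \<circ> c has_vector_derivative ?D v) (at t within ?T)"
    by (rule has_vector_derivative_transform[rotated 2, OF _ tT]) (use dom transition_cmap[OF i] in auto)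
  then show ?thesis using that[OF trd] by (simp add: eq)
qed

end

subsection \<open>The metric tensor\<close>

lemma smooth_on_imp_continuous_on:
  assumes "smooth_on S f" shows "continuous_on S f"
proof (rule continuous_on_local)
  fix x assume "x \<in> S"
  then have "\<exists>W h. open W \<and> x \<in> W \<and> (\<forall>k. Ck_on k W h) \<and> (\<forall>y\<in>S \<inter> W. h y = f y)"
    using assms unfolding smooth_on_def by (rule bspec[rotated])
  then obtain W h where W: "open W" "x \<in> W" "\<forall>k. Ck_on k W h" "\<forall>y\<in>S \<inter> W. h y = f y"
    by (elim exE conjE)
  have "continuous_on W h" using W(3)[rule_format, of 0] by simp
  then have "continuous_on (S \<inter> W) h" by (rule continuous_on_subset) simp
  then show "\<exists>W g. open W \<and> x \<in> W \<and> continuous_on (S \<inter> W) g \<and> (\<forall>s\<in>S \<inter> W. f s = g s)"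
    using W(1,2,4) by (intro exI[of _ W] exI[of _ h]) simp
qed

context riemannian_manifold
begin

text \<open>The chart selected by \<open>SOME\<close> is compared with the given one: its velocity
  is the image of v under the differential of the coordinate change, which the tensor transformation
  law absorbs.\<close>

lemma speed_within_eq:
  assumes c: "continuous_map (top_of_set T) (mtop M) c" and t: "t \<in> T" "at t within T \<noteq> bot"
    and i: "i \<in> charts M" "c t \<in> cdom M i"
    and d: "(cmap M i \<circ> c has_vector_derivative v) (at t within T)"
  shows "speed_within M T c t = sqrt (tensor M i (cmap M i (c t)) v v)"
proof -
  define j where "j = (SOME j. j \<in> charts M \<and> c t \<in> cdom M j)"
  have j: "j \<in> charts M" "c t \<in> cdom M j"
    using someI[of "\<lambda>j. j \<in> charts M \<and> c t \<in> cdom M j" i] i unfolding j_def by auto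
  obtain D where D: "(transition M i j has_derivative D) (at (cmap M i (c t)) within cmap M i ` (cdom M i \<inter> cdom M j))"
    "(cmap M j \<circ> c has_vector_derivative D v) (at t within T)"
    using coordinate_change[OF c i(1) j(1) t(1) i(2) j(2) d] by blast
  have v: "v \<in> model M" using velocity_in_model[OF c i(1) t(1) i(2) d t(2)] .
  have x: "cmap M i (c t) \<in> cmap M i ` (cdom M i \<inter> cdom M j)" using i(2) j(2) by blast
  have "vector_derivative (cmap M j \<circ> c) (at t within T) = D v"
    using vector_derivative_within[OF t(2) D(2)] .
  then have "speed_within M T c t = sqrt (tensor M j (cmap M j (c t)) (D v) (D v))"
    by (simp add: speed_within_def Let_def flip: j_def)
  also have "tensor M j (cmap M j (c t)) (D v) (D v) = tensor M i (cmap M i (c t)) v v"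
    using tensor_transform[OF i(1) j(1) x D(1) v v] transition_cmap[OF i] by simp
  finally show ?thesis .
qed

lemma tensor_zero:
  assumes "i \<in> charts M" "x \<in> cmap M i ` cdom M i" "w \<in> model M"
  shows "tensor M i x 0 w = 0" "tensor M i x w 0 = 0"
proof -
  show *: "tensor M i x 0 w = 0"
    using tensor_linear[OF assms(1,2,3,3,3), of 0 0] by simp
  show "tensor M i x w 0 = 0"
    using tensor_sym[OF assms, of 0] * subspace_0[OF subspace_model] by simp
qed

lemma tensor_add_self:
  assumes i: "i \<in> charts M" "x \<in> cmap M i ` cdom M i" and u: "u \<in> model M" and v: "v \<in> model M"
  shows "tensor M i x (r *\<^sub>R u + s *\<^sub>R v) (r *\<^sub>R u + s *\<^sub>R v) =
     r\<^sup>2 * tensor M i x u u + 2 * r * s * tensor M i x u v + s\<^sup>2 * tensor M i x v v"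
proof -
  let ?w = "r *\<^sub>R u + s *\<^sub>R v"
  have w: "?w \<in> model M" using subspace_model u v by (simp add: subspace_add subspace_scale)
  have "tensor M i x ?w ?w = r * tensor M i x u ?w + s * tensor M i x v ?w"
    by (rule tensor_linear[OF i u v w])
  also have "tensor M i x u ?w = r * tensor M i x u u + s * tensor M i x v u"
    using tensor_sym[OF i u w] tensor_linear[OF i u v u] by simp
  also have "tensor M i x v ?w = r * tensor M i x u v + s * tensor M i x v v"
    using tensor_sym[OF i v w] tensor_linear[OF i u v v] by simp
  finally show ?thesis using tensor_sym[OF i v u] by (simp add: power2_eq_square algebra_simps)
qed

lemma tensor_add:
  assumes i: "i \<in> charts M" "x \<in> cmap M i ` cdom M i" and u: "u \<in> model M" and v: "v \<in> model M"
  shows "tensor M i x (u + v) (u + v) = tensor M i x u u + 2 * tensor M i x u v + tensor M i x v v"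
  using tensor_add_self[OF assms, of 1 1] by simp

lemma tensor_scale:
  assumes i: "i \<in> charts M" "x \<in> cmap M i ` cdom M i" and u: "u \<in> model M"
  shows "tensor M i x (r *\<^sub>R u) (r *\<^sub>R u) = r\<^sup>2 * tensor M i x u u"
  using tensor_add_self[OF i u u, of r 0] by simp

lemma tensor_nonneg:
  assumes i: "i \<in> charts M" "x \<in> cmap M i ` cdom M i" and u: "u \<in> model M"
  shows "0 \<le> tensor M i x u u"
  using tensor_pos[OF assms] tensor_zero[OF assms] by (cases "u = 0") auto

lemma tensor_Cauchy_Schwarz:
  assumes i: "i \<in> charts M" "x \<in> cmap M i ` cdom M i" and u: "u \<in> model M" and v: "v \<in> model M"
  shows "tensor M i x u v \<le> sqrt (tensor M i x u u) * sqrt (tensor M i x v v)"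
proof (cases "u = 0 \<or> v = 0")
  case True
  then show ?thesis using tensor_zero[OF i u] tensor_zero[OF i v] by auto
next
  case False
  define a b where "a = sqrt (tensor M i x u u)" and "b = sqrt (tensor M i x v v)"
  have ab: "0 < a" "0 < b" "a\<^sup>2 = tensor M i x u u" "b\<^sup>2 = tensor M i x v v"
    using False tensor_pos[OF i u] tensor_pos[OF i v] by (auto simp: a_def b_def)
  \<comment> \<open>With a and b the norms of u and v, the tensor of b u - a v with itself is 2 a b
    times the difference of the two sides of the claim.\<close>
  have m: "b *\<^sub>R u + (- a) *\<^sub>R v \<in> model M"
    using subspace_model u v by (meson subspace_add subspace_scale)
  have "0 \<le> b\<^sup>2 * a\<^sup>2 + 2 * b * (- a) * tensor M i x u v + (- a)\<^sup>2 * b\<^sup>2"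
    using tensor_nonneg[OF i m] unfolding tensor_add_self[OF i u v] ab .
  also have "\<dots> = (2 * a * b) * (a * b - tensor M i x u v)"
    by (simp add: power2_eq_square algebra_simps)
  finally have *: "0 \<le> (2 * a * b) * (a * b - tensor M i x u v)" .
  have "0 < 2 * a * b" using ab by simp
  then have "0 \<le> a * b - tensor M i x u v"
    using *[unfolded zero_le_mult_iff[of "2 * a * b"]] by linarith
  then show ?thesis by (simp add: a_def b_def)
qed

text \<open>The right side exceeds the left side by the tensor of a - b + c - e with itself, which
  is u + w in the notation of the proof.\<close>

lemma tensor_quadrilateral:
  assumes i: "i \<in> charts M" "x \<in> cmap M i ` cdom M i"
    and m: "a \<in> model M" "b \<in> model M" "c \<in> model M" "e \<in> model M"
  shows "tensor M i x (a - c) (a - c) + tensor M i x (b - e) (b - e) \<le>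
     tensor M i x (a - b) (a - b) + tensor M i x (b - c) (b - c) + tensor M i x (c - e) (c - e) + tensor M i x (e - a) (e - a)"
proof -
  note S = subspace_model
  define u v w where "u = a - b" and "v = b - c" and "w = c - e"
  have uvw: "u \<in> model M" "v \<in> model M" "w \<in> model M" "u + v \<in> model M"
    using m S by (auto simp: u_def v_def w_def subspace_diff subspace_add)
  have e: "a - c = u + v" "b - e = v + w" "e - a = (-1) *\<^sub>R (u + v + w)" "a - b = u" "b - c = v" "c - e = w"
    by (auto simp: u_def v_def w_def)
  have lin: "tensor M i x (u + v) w = tensor M i x u w + tensor M i x v w"
    using tensor_linear[OF i uvw(1,2,3), of 1 1] by simp
  have uvw': "u + v + w \<in> model M" using uvw S by (simp add: subspace_add)
  have "0 \<le> tensor M i x (u + w) (u + w)" using tensor_nonneg[OF i] uvw S by (simp add: subspace_add)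
  then show ?thesis
    unfolding e tensor_scale[OF i uvw'] tensor_add[OF i uvw(4,3)] tensor_add[OF i uvw(1,2)] tensor_add[OF i uvw(2,3)] lin
    using tensor_add[OF i uvw(1,3)] by simp
qed

lemma tensor_sum:
  assumes i: "i \<in> charts M" "x \<in> cmap M i ` cdom M i" and w: "w \<in> model M"
    and B: "B \<subseteq> model M"
  shows "tensor M i x (\<Sum>b\<in>B. a b *\<^sub>R b) w = (\<Sum>b\<in>B. a b * tensor M i x b w)"
  using B
proof (induction B rule: infinite_finite_induct)
  case (insert b B)
  then have b: "b \<in> model M" and s: "(\<Sum>b\<in>B. a b *\<^sub>R b) \<in> model M"
    using subspace_model by (auto intro!: subspace_sum subspace_scale)
  show ?case using tensor_linear[OF i b s w, of "a b" 1] insert by simp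
qed (use tensor_zero[OF i w] in simp_all)

lemma model_basis:
  obtains B where "finite B" "B \<subseteq> model M" "\<And>b. b \<in> B \<Longrightarrow> norm b = 1"
    "\<And>v. v \<in> model M \<Longrightarrow> (\<Sum>b\<in>B. (v \<bullet> b) *\<^sub>R b) = v"
proof -
  obtain B where B: "B \<subseteq> model M" "pairwise orthogonal B" "\<And>x. x \<in> B \<Longrightarrow> norm x = 1" "independent B" "span B = model M"
    using orthonormal_basis_subspace[OF subspace_model] by metis
  have fB: "finite B" using B(4) by (rule independent_imp_finite)
  show ?thesis
    by (rule that[OF fB B(1,3)]) (use orthonormal_basis_expand[OF B(2,3) _ fB] B(5) in auto)
qed

text \<open>Smoothness is assumed for fixed vectors only. The expansion reduces joint continuity and
  uniform estimates to the finitely many coefficients.\<close>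

lemma tensor_expand:
  assumes i: "i \<in> charts M" "x \<in> cmap M i ` cdom M i" and v: "v \<in> model M" and w: "w \<in> model M"
    and B: "B \<subseteq> model M" "\<And>v. v \<in> model M \<Longrightarrow> (\<Sum>b\<in>B. (v \<bullet> b) *\<^sub>R b) = v"
  shows "tensor M i x v w = (\<Sum>b\<in>B. \<Sum>b'\<in>B. (v \<bullet> b) * (w \<bullet> b') * tensor M i x b b')"
proof -
  have "tensor M i x v w = (\<Sum>b\<in>B. (v \<bullet> b) * tensor M i x b w)"
    using tensor_sum[OF i w B(1), of "\<lambda>b. v \<bullet> b"] B(2)[OF v] by simp
  also have "\<dots> = (\<Sum>b\<in>B. (v \<bullet> b) * (\<Sum>b'\<in>B. (w \<bullet> b') * tensor M i x b b'))"
  proof (rule sum.cong[OF refl])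
    fix b assume "b \<in> B"
    then have b: "b \<in> model M" using B(1) by blast
    have "tensor M i x b w = tensor M i x w b" by (rule tensor_sym[OF i b w])
    also have "\<dots> = (\<Sum>b'\<in>B. (w \<bullet> b') * tensor M i x b' b)"
      using tensor_sum[OF i b B(1), of "\<lambda>b. w \<bullet> b"] B(2)[OF w] by simp
    also have "\<dots> = (\<Sum>b'\<in>B. (w \<bullet> b') * tensor M i x b b')"
      using B(1) b by (intro sum.cong) (auto simp: tensor_sym[OF i b])
    finally show "(v \<bullet> b) * tensor M i x b w = (v \<bullet> b) * (\<Sum>b'\<in>B. (w \<bullet> b') * tensor M i x b b')"
      by simp
  qed
  finally show ?thesis by (simp add: sum_distrib_left mult.assoc)
qed

text \<open>Turns a product in the tensor into an ambient inner product, which is defined on the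
  whole type and can be differentiated along curves.\<close>

lemma tensor_Riesz:
  assumes i: "i \<in> charts M" "x \<in> cmap M i ` cdom M i" and w: "w \<in> model M"
  obtains z where "\<And>v. v \<in> model M \<Longrightarrow> tensor M i x w v = z \<bullet> v"
proof -
  obtain B where B: "finite B" "B \<subseteq> model M" "\<And>v. v \<in> model M \<Longrightarrow> (\<Sum>b\<in>B. (v \<bullet> b) *\<^sub>R b) = v"
    using model_basis by metis
  have "tensor M i x w v = (\<Sum>b\<in>B. tensor M i x b w *\<^sub>R b) \<bullet> v" if v: "v \<in> model M" for v
    using tensor_sum[OF i w B(2), of "\<lambda>b. v \<bullet> b"] B(3)[OF v] tensor_sym[OF i v w]
    by (simp add: inner_sum_left inner_sum_right inner_commute mult.commute)
  then show ?thesis by (rule that)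
qed

lemma continuous_on_tensor:
  fixes x v :: "'t::t2_space \<Rightarrow> 'a"
  assumes i: "i \<in> charts M" and "continuous_on T x" "continuous_on T v"
    and xv: "\<And>t. t \<in> T \<Longrightarrow> x t \<in> cmap M i ` cdom M i" "\<And>t. t \<in> T \<Longrightarrow> v t \<in> model M"
  shows "continuous_on T (\<lambda>t. tensor M i (x t) (v t) (v t))"
proof -
  obtain B where B: "finite B" "B \<subseteq> model M" "\<And>v. v \<in> model M \<Longrightarrow> (\<Sum>b\<in>B. (v \<bullet> b) *\<^sub>R b) = v"
    using model_basis by metis
  have "continuous_on T (\<lambda>t. tensor M i (x t) b b')" if "b \<in> B" "b' \<in> B" for b b'
    by (rule continuous_on_compose2[OF smooth_on_imp_continuous_on[OF tensor_smooth[OF i]] assms(2)])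
      (use B(2) that xv(1) in auto)
  then have "continuous_on T (\<lambda>t. \<Sum>b\<in>B. \<Sum>b'\<in>B. (v t \<bullet> b) * (v t \<bullet> b') * tensor M i (x t) b b')"
    using assms(3) by (intro continuous_intros)
  then show ?thesis
    by (rule continuous_on_eq) (use tensor_expand[OF i xv(1) xv(2) xv(2) B(2,3)] in auto)
qed

text \<open>By compactness the tensor has a positive minimum on the unit sphere of
  \<open>model\<close>, and homogeneity extends the bound to all vectors.\<close>

lemma tensor_lower_bound:
  assumes i: "i \<in> charts M" "x \<in> cmap M i ` cdom M i"
  obtains m where "m > 0" "\<And>v. v \<in> model M \<Longrightarrow> m * (norm v)\<^sup>2 \<le> tensor M i x v v"
proof -
  let ?K = "model M \<inter> sphere 0 1"
  have "\<exists>m>0. \<forall>v\<in>?K. m \<le> tensor M i x v v"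
  proof (cases "?K = {}")
    \<comment> \<open>The unit sphere is empty when \<open>model\<close> is the zero space; any
      positive constant will do.\<close>
    case True then show ?thesis by (auto intro: exI[of _ 1])
  next
    case False
    have "compact ?K" using closed_subspace[OF subspace_model] by (simp add: closed_Int_compact)
    moreover have "continuous_on ?K (\<lambda>v. tensor M i x v v)"
      by (rule continuous_on_tensor[OF i(1)]) (use i in \<open>auto intro: continuous_intros\<close>)
    ultimately obtain v0 where v0: "v0 \<in> ?K" "\<forall>v\<in>?K. tensor M i x v0 v0 \<le> tensor M i x v v"
      using continuous_attains_inf[OF _ False] by blast
    have "v0 \<noteq> 0" using v0(1) by auto
    then have "tensor M i x v0 v0 > 0" using tensor_pos[OF i] v0(1) by blast
    then show ?thesis using v0(2) by blast
  qed
  then obtain m where m: "m > 0" "\<And>v. v \<in> ?K \<Longrightarrow> m \<le> tensor M i x v v" by blast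
  have "m * (norm v)\<^sup>2 \<le> tensor M i x v v" if v: "v \<in> model M" for v
  proof (cases "v = 0")
    case True then show ?thesis using tensor_nonneg[OF i v] by simp
  next
    case False
    let ?u = "(1 / norm v) *\<^sub>R v"
    have u: "?u \<in> ?K" using v subspace_model False by (simp add: subspace_scale)
    have "m \<le> (1 / norm v)\<^sup>2 * tensor M i x v v"
      using m(2)[OF u] tensor_scale[OF i v] by simp
    then show ?thesis using False by (simp add: field_simps)
  qed
  then show ?thesis using that[OF m(1)] by blast
qed

text \<open>Near \<open>x0\<close> the finitely many coefficients deviate in sum by less than
  \<open>\<eta> * m\<close>; the lower bound by m at \<open>x0\<close> turns this additive error
  into a relative error \<open>\<eta>\<close>.\<close>

lemma tensor_comparison:
  assumes i: "i \<in> charts M" "x0 \<in> cmap M i ` cdom M i" and \<eta>: "0 < \<eta>" "\<eta> < 1"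
  obtains r m where "r > 0" "m > 0" "cball x0 r \<inter> model M \<subseteq> cmap M i ` cdom M i"
    "\<And>v. v \<in> model M \<Longrightarrow> m * norm v \<le> sqrt (tensor M i x0 v v)"
    "\<And>x v. \<lbrakk>x \<in> cball x0 r; x \<in> model M; v \<in> model M\<rbrakk> \<Longrightarrow>
       (1 - \<eta>) * sqrt (tensor M i x0 v v) \<le> sqrt (tensor M i x v v)"
    "\<And>x v. \<lbrakk>x \<in> cball x0 r; x \<in> model M; v \<in> model M\<rbrakk> \<Longrightarrow>
       sqrt (tensor M i x v v) \<le> (1 + \<eta>) * sqrt (tensor M i x0 v v)"
proof -
  let ?A = "cmap M i ` cdom M i"
  obtain m where m: "m > 0" "\<And>v. v \<in> model M \<Longrightarrow> m * (norm v)\<^sup>2 \<le> tensor M i x0 v v"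
    using tensor_lower_bound[OF i] by blast
  obtain B where B: "finite B" "B \<subseteq> model M" "\<And>b. b \<in> B \<Longrightarrow> norm b = 1"
    "\<And>v. v \<in> model M \<Longrightarrow> (\<Sum>b\<in>B. (v \<bullet> b) *\<^sub>R b) = v"
    using model_basis by metis
  define F where "F x = (\<Sum>b\<in>B. \<Sum>b'\<in>B. \<bar>tensor M i x b b' - tensor M i x0 b b'\<bar>)" for x
  have "continuous_on ?A (\<lambda>x. tensor M i x b b')" if "b \<in> B" "b' \<in> B" for b b'
    using smooth_on_imp_continuous_on[OF tensor_smooth[OF i(1)]] B(2) that by blast
  then have "continuous_on ?A F" unfolding F_def by (intro continuous_intros)
  then obtain \<delta> where \<delta>: "\<delta> > 0" "\<And>x. x \<in> ?A \<Longrightarrow> dist x x0 < \<delta> \<Longrightarrow> dist (F x) (F x0) < \<eta> * m"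
  proof -
    have "0 < \<eta> * m" using \<eta> m(1) by simp
    then have "\<exists>d>0. \<forall>x\<in>?A. dist x x0 < d \<longrightarrow> dist (F x) (F x0) < \<eta> * m"
      using \<open>continuous_on ?A F\<close>[unfolded continuous_on_iff, rule_format, OF i(2)] by blast
    then show ?thesis using that by blast
  qed
  obtain r0 where r0: "r0 > 0" "ball x0 r0 \<inter> model M \<subseteq> ?A"
    using conjunct2[OF chart_image[OF i(1), unfolded openin_contains_ball], rule_format, OF i(2)] by blast
  \<comment> \<open>Halving makes the closed ball of radius r fit into the open balls of radii
    \<open>\<delta>\<close> and \<open>r0\<close>.\<close>
  define r where "r = min \<delta> r0 / 2"
  have r: "r > 0" "r < \<delta>" "r < r0" using \<delta> r0 by (auto simp: r_def)
  have sub: "cball x0 r \<inter> model M \<subseteq> ?A" using r r0(2) by auto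
  have diff: "\<bar>tensor M i x v v - tensor M i x0 v v\<bar> \<le> \<eta> * tensor M i x0 v v"
    if x: "x \<in> cball x0 r" "x \<in> model M" and v: "v \<in> model M" for x v
  proof -
    have xA: "x \<in> ?A" using x sub by blast
    have "dist (F x) (F x0) < \<eta> * m" using \<delta>(2)[OF xA] x r by (auto simp: dist_commute)
    then have F: "F x < \<eta> * m" by (simp add: F_def)
    have nb: "\<bar>v \<bullet> b\<bar> \<le> norm v" if "b \<in> B" for b using Cauchy_Schwarz_ineq2[of v b] B(3)[OF that] by simp
    have "tensor M i x v v - tensor M i x0 v v =
        (\<Sum>b\<in>B. \<Sum>b'\<in>B. (v \<bullet> b) * (v \<bullet> b') * (tensor M i x b b' - tensor M i x0 b b'))"
      using tensor_expand[OF i(1) xA v v B(2,4)] tensor_expand[OF i v v B(2,4)]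
      by (simp only: sum_subtractf right_diff_distrib)
    also have "\<bar>\<dots>\<bar> \<le> (\<Sum>b\<in>B. \<Sum>b'\<in>B. \<bar>(v \<bullet> b) * (v \<bullet> b') * (tensor M i x b b' - tensor M i x0 b b')\<bar>)"
      by (intro order_trans[OF sum_abs] sum_mono) (rule order_refl)
    also have "\<dots> \<le> (\<Sum>b\<in>B. \<Sum>b'\<in>B. (norm v)\<^sup>2 * \<bar>tensor M i x b b' - tensor M i x0 b b'\<bar>)"
      by (intro sum_mono) (auto simp: abs_mult power2_eq_square intro!: mult_right_mono mult_mono nb)
    also have "\<dots> = (norm v)\<^sup>2 * F x" by (simp add: F_def sum_distrib_left)
    also have "\<dots> \<le> (norm v)\<^sup>2 * (\<eta> * m)" using F by (intro mult_left_mono) auto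
    also have "\<dots> \<le> \<eta> * tensor M i x0 v v" using mult_left_mono[OF m(2)[OF v], of \<eta>] \<eta> by (simp add: mult_ac)
    finally show ?thesis .
  qed
  show ?thesis
  proof (rule that[OF r(1) _ sub])
    \<comment> \<open>m compares squares, so its root compares norms.\<close>
    show "sqrt m > 0" using m by simp
    show "sqrt m * norm v \<le> sqrt (tensor M i x0 v v)" if "v \<in> model M" for v
      using real_sqrt_le_mono[OF m(2)[OF that]] by (simp add: real_sqrt_mult)
    fix x v assume *: "x \<in> cball x0 r" "x \<in> model M" "v \<in> model M"
    have t0: "0 \<le> tensor M i x0 v v" by (rule tensor_nonneg[OF i *(3)])
    \<comment> \<open>The bounds are weakened to the squares of 1 - \<open>\<eta>\<close> and 1 +
      \<open>\<eta>\<close>, so that taking roots returns exactly these factors.\<close>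
    have "(1 - \<eta>)\<^sup>2 \<le> 1 - \<eta>" using \<eta> by (simp add: power2_eq_square mult_left_le_one_le)
    then have "(1 - \<eta>)\<^sup>2 * tensor M i x0 v v \<le> (1 - \<eta>) * tensor M i x0 v v" by (rule mult_right_mono[OF _ t0])
    also have "\<dots> \<le> tensor M i x v v" using diff[OF *] by (simp add: left_diff_distrib)
    finally have "sqrt ((1 - \<eta>)\<^sup>2 * tensor M i x0 v v) \<le> sqrt (tensor M i x v v)" by simp
    then show "(1 - \<eta>) * sqrt (tensor M i x0 v v) \<le> sqrt (tensor M i x v v)"
      using \<eta> by (simp add: real_sqrt_mult)
    have "tensor M i x v v \<le> (1 + \<eta>) * tensor M i x0 v v" using diff[OF *] by (simp add: distrib_right)
    also have "\<dots> \<le> (1 + \<eta>)\<^sup>2 * tensor M i x0 v v"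
      using \<eta> by (intro mult_right_mono[OF _ t0]) (simp add: power2_eq_square)
    finally have "sqrt (tensor M i x v v) \<le> sqrt ((1 + \<eta>)\<^sup>2 * tensor M i x0 v v)" by simp
    then show "sqrt (tensor M i x v v) \<le> (1 + \<eta>) * sqrt (tensor M i x0 v v)"
      using \<eta> by (simp add: real_sqrt_mult)
  qed
qed

end

subsection \<open>Piecewise continuously differentiable curves\<close>

text \<open>A finite exceptional set replaces the increasing sequence of break points: it may be
  enlarged freely, so two curves get a common one by taking the union, and restriction needs no
  renumbering.\<close>

definition piecewise_C1_on ::
    "('i, 'm, 'a::euclidean_space) riemannian \<Rightarrow> real \<Rightarrow> real \<Rightarrow> (real \<Rightarrow> 'm) \<Rightarrow> real set \<Rightarrow> bool" where
  "piecewise_C1_on M a b c S \<longleftrightarrow>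
     finite S \<and> continuous_map (top_of_set {a..b}) (mtop M) c \<and>
     (\<forall>u v. a \<le> u \<longrightarrow> u < v \<longrightarrow> v \<le> b \<longrightarrow> {u<..<v} \<inter> S = {} \<longrightarrow> C1_curve_on M {u..v} c)"

lemma piecewise_C1_onD:
  assumes "piecewise_C1_on M a b c S"
  shows "finite S" "continuous_map (top_of_set {a..b}) (mtop M) c"
    "\<lbrakk>a \<le> u; u < v; v \<le> b; {u<..<v} \<inter> S = {}\<rbrakk> \<Longrightarrow> C1_curve_on M {u..v} c"
  using assms by (auto simp: piecewise_C1_on_def)

lemma piecewise_C1_on_restrict:
  assumes "piecewise_C1_on M a b c S" "a \<le> a'" "b' \<le> b" "{a'<..<b'} \<inter> S \<subseteq> S'" "finite S'"
  shows "piecewise_C1_on M a' b' c S'"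
  unfolding piecewise_C1_on_def
proof (intro conjI allI impI)
  show "continuous_map (top_of_set {a'..b'}) (mtop M) c"
    by (rule continuous_map_from_subtopology_mono[OF piecewise_C1_onD(2)[OF assms(1)]]) (use assms in auto)
  fix u v assume uv: "a' \<le> u" "u < v" "v \<le> b'" "{u<..<v} \<inter> S' = {}"
  have "{u<..<v} \<inter> S \<subseteq> {u<..<v} \<inter> S'" using assms(4) uv(1,3) by force
  then have "{u<..<v} \<inter> S = {}" using uv(4) by blast
  then show "C1_curve_on M {u..v} c" using piecewise_C1_onD(3)[OF assms(1), of u v] uv assms(2,3) by force
qed (use assms in auto)

text \<open>Each exceptional point inside the interval splits it, and the two sequences of break
  points are concatenated; points outside are dropped.\<close>

lemma piecewise_C1_on_imp_breakpoints:
  assumes "finite S" "a < b" "piecewise_C1_on M a b c S"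
  shows "\<exists>n s. s 0 = a \<and> s n = b \<and> (\<forall>k<n. s k < s (Suc k) \<and> C1_curve_on M {s k..s (Suc k)} c)"
  using assms
proof (induction S arbitrary: a b rule: finite_induct)
  case empty
  then have "C1_curve_on M {a..b} c" using piecewise_C1_onD(3)[OF empty(2), of a b] by simp
  then show ?case using empty(1) 
    by (intro exI[of _ "Suc 0"] exI[of _ "\<lambda>k. if k = 0 then a else b"]) auto
next
  case (insert x S)
  show ?case
  proof (cases "a < x \<and> x < b")
    case True
    have "piecewise_C1_on M a x c S" "piecewise_C1_on M x b c S"
      by (rule piecewise_C1_on_restrict[OF insert.prems(2)]; use True insert.hyps in auto)+
    then obtain n s n' s' where
      s: "s 0 = a" "s n = x" "\<And>k. k < n \<Longrightarrow> s k < s (Suc k) \<and> C1_curve_on M {s k..s (Suc k)} c" and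
      s': "s' 0 = x" "s' n' = b" "\<And>k. k < n' \<Longrightarrow> s' k < s' (Suc k) \<and> C1_curve_on M {s' k..s' (Suc k)} c"
      using insert.IH True by metis
    define r where "r k = (if k \<le> n then s k else s' (k - n))" for k
    have "r k < r (Suc k) \<and> C1_curve_on M {r k..r (Suc k)} c" if "k < n + n'" for k
    proof (cases "k < n")
      case True then show ?thesis using s(3)[of k] by (simp add: r_def)
    next
      case False
      then have "r k = s' (k - n)" "r (Suc k) = s' (Suc (k - n))"
        using s(2) s'(1) by (auto simp: r_def Suc_diff_le)
      then show ?thesis using s'(3)[of "k - n"] False that by simp
    qed
    moreover have "r 0 = a" "r (n + n') = b" using s s' by (auto simp: r_def)
    ultimately show ?thesis by blast
  next
    case False
    have "piecewise_C1_on M a b c S"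
      by (rule piecewise_C1_on_restrict[OF insert.prems(2)]) (use False insert.hyps in auto)
    then show ?thesis using insert.IH insert.prems(1) by blast
  qed
qed

lemma piecewise_C1_curve_iff: "piecewise_C1_curve M c \<longleftrightarrow> (\<exists>S. piecewise_C1_on M 0 1 c S)"
proof
  assume "piecewise_C1_curve M c"
  then obtain n s where p: "pathin (mtop M) c" and s: "s 0 = 0" "s n = 1"
    "\<And>k. k < n \<Longrightarrow> s k < s (Suc k)" "\<And>k. k < n \<Longrightarrow> C1_curve_on M {s k..s (Suc k)} c"
    unfolding piecewise_C1_curve_def by blast
  have "C1_curve_on M {u..v} c" if uv: "0 \<le> u" "u < v" "v \<le> 1" "{u<..<v} \<inter> s ` {..n} = {}" for u v
  proof -
    obtain k where k: "k \<le> n" "s k \<le> u" and max: "\<And>l. l \<le> n \<Longrightarrow> s l \<le> u \<Longrightarrow> l \<le> k"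
      using Nat.ex_has_greatest_nat[of "\<lambda>k. k \<le> n \<and> s k \<le> u" 0 n] s(1) uv(1) by auto
    have "k \<noteq> n" using k(2) s(2) uv by auto
    then have kn: "k < n" using k(1) by simp
    then have "\<not> s (Suc k) \<le> u" using max[of "Suc k"] by auto
    moreover have "s (Suc k) \<in> s ` {..n}" using kn by simp
    then have "s (Suc k) \<notin> {u<..<v}" using uv(4) by blast
    ultimately have "v \<le> s (Suc k)" by simp
    then show ?thesis
      using C1_curve_on_subset[OF s(4)[OF kn]] k(2) by auto
  qed
  then have "piecewise_C1_on M 0 1 c (s ` {..n})"
    using p by (auto simp: piecewise_C1_on_def pathin_def)
  then show "\<exists>S. piecewise_C1_on M 0 1 c S" by blast
next
  assume "\<exists>S. piecewise_C1_on M 0 1 c S"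
  then obtain S where S: "piecewise_C1_on M 0 1 c S" by blast
  then show "piecewise_C1_curve M c"
    using piecewise_C1_on_imp_breakpoints[OF _ _ S] piecewise_C1_onD(1,2)[OF S]
    unfolding piecewise_C1_curve_def pathin_def by auto
qed

lemma integrable_on_pieces:
  fixes f :: "real \<Rightarrow> real"
  assumes "finite S" "a \<le> b"
    and "\<And>u v. \<lbrakk>a \<le> u; u < v; v \<le> b; {u<..<v} \<inter> S = {}\<rbrakk> \<Longrightarrow> f integrable_on {u..v}"
  shows "f integrable_on {a..b}"
  using assms
proof (induction S arbitrary: a b rule: finite_induct)
  case empty
  show ?case
  proof (cases "a = b")
    case True
    then show ?thesis using integrable_on_refl[of f b] by simp
  qed (use empty in auto)
next
  case (insert x S)
  have pieces: "f integrable_on {u..v}" if "a \<le> u" "u \<le> v" "v \<le> b" "x \<le> u \<or> v \<le> x" for u v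
    by (rule insert.IH[OF that(2)], rule insert.prems(2)) (use that in auto)
  show ?case
  proof (cases "a < x \<and> x < b")
    case True
    then show ?thesis
      using Henstock_Kurzweil_Integration.integrable_combine[of a x b f] pieces[of a x] pieces[of x b] by simp
  next
    case False
    then show ?thesis using pieces[of a b] insert.prems(1) by auto
  qed
qed

lemma interval_avoiding_finite:
  fixes S :: "real set"
  assumes "finite S" "a < t" "t < b" "t \<notin> S"
  obtains u v where "a < u" "u < t" "t < v" "v < b" "{u..v} \<inter> S = {}"
proof -
  have "open ({a<..<b} - S)" using assms(1) by (intro open_Diff finite_imp_closed) auto
  moreover have "t \<in> {a<..<b} - S" using assms by simp
  ultimately obtain e where e: "e > 0" "cball t e \<subseteq> {a<..<b} - S"
    unfolding open_contains_cball by blast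
  have "{t - e..t + e} \<subseteq> {a<..<b} - S" using e(2) by (simp add: cball_eq_atLeastAtMost)
  then have *: "x \<in> {a<..<b} \<and> x \<notin> S" if "x \<in> {t - e..t + e}" for x using that by blast
  then have "{t - e..t + e} \<inter> S = {}" by blast
  then show ?thesis using that[of "t - e" "t + e"] e(1) *[of "t - e"] *[of "t + e"] by simp
qed

lemma at_within_Icc_neq_bot: "u < v \<Longrightarrow> t \<in> {u..v} \<Longrightarrow> at t within {u..v} \<noteq> bot" for t :: real
  using islimpt_Icc[of u v t] trivial_limit_within[of t "{u..v}"] by auto

section \<open>Agreement, change of parameter and concatenation of curves\<close>

lemma C1_curve_on_cong:
  assumes "\<And>t. t \<in> T \<Longrightarrow> c t = c' t" "C1_curve_on M T c"
  shows "C1_curve_on M T c'"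
  unfolding C1_curve_on_def
proof
  fix i assume "i \<in> charts M"
  then obtain D where D: "continuous_on {t \<in> T. c t \<in> cdom M i} D"
    "\<And>t. t \<in> T \<Longrightarrow> c t \<in> cdom M i \<Longrightarrow> (cmap M i \<circ> c has_vector_derivative D t) (at t within T)"
    using assms(2) unfolding C1_curve_on_def by blast
  have "{t \<in> T. c' t \<in> cdom M i} = {t \<in> T. c t \<in> cdom M i}" using assms(1) by auto
  moreover have "(cmap M i \<circ> c' has_vector_derivative D t) (at t within T)" if "t \<in> T" "c' t \<in> cdom M i" for t
    by (rule has_vector_derivative_transform[OF that(1) _ D(2)]) (use that assms(1) in auto)
  ultimately show "\<exists>D. continuous_on {t \<in> T. c' t \<in> cdom M i} D \<and>
        (\<forall>t\<in>T. c' t \<in> cdom M i \<longrightarrow> (cmap M i \<circ> c' has_vector_derivative D t) (at t within T))"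
    using D(1) by auto
qed

lemma speed_within_cong:
  assumes "open U" "t \<in> U" "\<And>s. s \<in> U \<Longrightarrow> c s = c' s"
  shows "speed_within M UNIV c t = speed_within M UNIV c' t"
proof -
  have ct: "c t = c' t" using assms by simp
  have "vector_derivative (cmap M i \<circ> c) (at t) = vector_derivative (cmap M i \<circ> c') (at t)" for i
    by (rule vector_derivative_cong_eq)
      (use assms in \<open>auto simp: eventually_nhds intro!: exI[of _ U]\<close>)
  then show ?thesis by (simp add: speed_within_def ct)
qed

lemma C1_curve_on_compose:
  assumes c: "C1_curve_on M {p..q} c" and \<phi>: "\<phi> ` {u..v} \<subseteq> {p..q}" "continuous_on {u..v} \<phi>'"
    and d: "\<And>t. t \<in> {u..v} \<Longrightarrow> (\<phi> has_vector_derivative \<phi>' t) (at t within {u..v})"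
  shows "C1_curve_on M {u..v} (c \<circ> \<phi>)"
  unfolding C1_curve_on_def
proof
  fix i assume "i \<in> charts M"
  then obtain D where D: "continuous_on {t \<in> {p..q}. c t \<in> cdom M i} D"
    "\<And>t. t \<in> {p..q} \<Longrightarrow> c t \<in> cdom M i \<Longrightarrow> (cmap M i \<circ> c has_vector_derivative D t) (at t within {p..q})"
    using c unfolding C1_curve_on_def by blast
  have \<phi>m: "\<phi> t \<in> {p..q}" if "t \<in> {u..v}" for t using \<phi>(1) that by blast
  have cont: "continuous_on {u..v} \<phi>"
    using d has_vector_derivative_continuous continuous_on_eq_continuous_within by blast
  have "continuous_on {t \<in> {u..v}. (c \<circ> \<phi>) t \<in> cdom M i} (\<lambda>t. \<phi>' t *\<^sub>R D (\<phi> t))"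
    by (intro continuous_on_scaleR continuous_on_subset[OF \<phi>(2)] continuous_on_compose2[OF D(1)] continuous_on_subset[OF cont])
      (use \<phi>m in auto)
  moreover have "(cmap M i \<circ> (c \<circ> \<phi>) has_vector_derivative \<phi>' t *\<^sub>R D (\<phi> t)) (at t within {u..v})"
    if "t \<in> {u..v}" "(c \<circ> \<phi>) t \<in> cdom M i" for t
  proof -
    have "\<phi> t \<in> {p..q}" using \<phi>(1) that(1) by blast
    then have "(cmap M i \<circ> c has_vector_derivative D (\<phi> t)) (at (\<phi> t) within \<phi> ` {u..v})"
      using D(2)[of "\<phi> t"] that(2) \<phi>(1) by (auto intro: has_vector_derivative_within_subset)
    from vector_diff_chain_within[OF d[OF that(1)] this] show ?thesis by (simp only: o_assoc)
  qed
  ultimately show "\<exists>D. continuous_on {t \<in> {u..v}. (c \<circ> \<phi>) t \<in> cdom M i} D \<and>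
        (\<forall>t\<in>{u..v}. (c \<circ> \<phi>) t \<in> cdom M i \<longrightarrow> (cmap M i \<circ> (c \<circ> \<phi>) has_vector_derivative D t) (at t within {u..v}))"
    by blast
qed

text \<open>A uniform speed bound is kept in place of a length because it survives pairing: curves
  with bounds K1 and K2 on the same interval pair to a curve with bound sqrt (K1^2 + K2^2), whereas
  their lengths alone control the pair only through K1 + K2.\<close>

definition speed_curve ::
    "('i, 'm, 'a::euclidean_space) riemannian \<Rightarrow> real \<Rightarrow> real \<Rightarrow> (real \<Rightarrow> 'm) \<Rightarrow> real \<Rightarrow> bool" where
  "speed_curve M a b c K \<longleftrightarrow>
     (\<exists>S. piecewise_C1_on M a b c S \<and> (\<forall>t\<in>{a<..<b} - S. speed_within M UNIV c t \<le> K))"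

lemma speed_curve_mono: "speed_curve M a b c K \<Longrightarrow> K \<le> K' \<Longrightarrow> speed_curve M a b c K'"
  unfolding speed_curve_def by (meson order_trans)

text \<open>The junction joins the exceptional set, so the velocities from its two sides may
  differ.\<close>

lemma speed_curve_join:
  assumes 1: "speed_curve M a b c K" and 2: "speed_curve M b e c' K" and eq: "c b = c' b" and ab: "a < b" "b < e"
  shows "speed_curve M a e (\<lambda>t. if t \<le> b then c t else c' t) K"
proof -
  let ?c = "\<lambda>t. if t \<le> b then c t else c' t"
  obtain S where S: "piecewise_C1_on M a b c S" "\<And>t. t \<in> {a<..<b} - S \<Longrightarrow> speed_within M UNIV c t \<le> K"
    using 1 unfolding speed_curve_def by blast
  obtain S' where S': "piecewise_C1_on M b e c' S'" "\<And>t. t \<in> {b<..<e} - S' \<Longrightarrow> speed_within M UNIV c' t \<le> K"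
    using 2 unfolding speed_curve_def by blast
  have *: "c' t = (if t \<le> b then c t else c' t)" if "b \<le> t" for t
    using eq that by (cases "t = b") auto
  have "continuous_map (top_of_set {a..e}) (mtop M) ?c"
  proof (rule continuous_map_cases_le)
    have "{a..e} \<inter> {x \<in> topspace (top_of_set {a..e}). x \<le> b} = {a..b}"
      "{a..e} \<inter> {x \<in> topspace (top_of_set {a..e}). b \<le> x} = {b..e}"
      using ab by auto
    then have "subtopology (top_of_set {a..e}) {x \<in> topspace (top_of_set {a..e}). x \<le> b} = top_of_set {a..b}"
      "subtopology (top_of_set {a..e}) {x \<in> topspace (top_of_set {a..e}). b \<le> x} = top_of_set {b..e}"
      by (simp_all only: subtopology_subtopology)
    then show "continuous_map (subtopology (top_of_set {a..e}) {x \<in> topspace (top_of_set {a..e}). x \<le> b}) (mtop M) c"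
      "continuous_map (subtopology (top_of_set {a..e}) {x \<in> topspace (top_of_set {a..e}). b \<le> x}) (mtop M) c'"
      using piecewise_C1_onD(2)[OF S(1)] piecewise_C1_onD(2)[OF S'(1)] by simp_all
    show "continuous_map (top_of_set {a..e}) euclideanreal (\<lambda>x. x)" "continuous_map (top_of_set {a..e}) euclideanreal (\<lambda>_. b)"
      by simp_all
    show "c x = c' x" if "x \<in> topspace (top_of_set {a..e})" "x = b" for x using eq that by simp
  qed
  moreover have "C1_curve_on M {u..v} ?c" if uv: "a \<le> u" "u < v" "v \<le> e" "{u<..<v} \<inter> insert b (S \<union> S') = {}" for u v
  proof -
    consider "v \<le> b" | "b \<le> u" using uv(2,4) by force
    then show ?thesis
    proof cases
      case 1
      show ?thesis
        by (rule C1_curve_on_cong[OF _ piecewise_C1_onD(3)[OF S(1), of u v]]) (use 1 uv in auto)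
    next
      case 2
      show ?thesis
        by (rule C1_curve_on_cong[OF _ piecewise_C1_onD(3)[OF S'(1), of u v]], rule *) (use 2 uv in auto)
    qed
  qed
  ultimately have "piecewise_C1_on M a e ?c (insert b (S \<union> S'))"
    using piecewise_C1_onD(1)[OF S(1)] piecewise_C1_onD(1)[OF S'(1)] by (simp add: piecewise_C1_on_def)
  moreover have "speed_within M UNIV ?c t \<le> K" if t: "t \<in> {a<..<e} - insert b (S \<union> S')" for t
  proof (cases "t < b")
    case True
    have "speed_within M UNIV ?c t = speed_within M UNIV c t"
      by (rule speed_within_cong[of "{..<b}"]) (use True in auto)
    then show ?thesis using S(2)[of t] t True by auto
  next
    case False
    then have "t > b" using t by auto
    have "speed_within M UNIV ?c t = speed_within M UNIV c' t"
      by (rule speed_within_cong[of "{b<..}"]) (use \<open>t > b\<close> in auto)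
    then show ?thesis using S'(2)[of t] t \<open>t > b\<close> by auto
  qed
  ultimately show ?thesis unfolding speed_curve_def by blast
qed

section \<open>Velocity and speed of piecewise C1 curves\<close>

context riemannian_manifold
begin

lemma C1_curve_velocity:
  assumes c: "continuous_map (top_of_set {u..v}) (mtop M) c" "C1_curve_on M {u..v} c" "u < v"
    and t: "t \<in> {u..v}" "i \<in> charts M" "c t \<in> cdom M i"
  obtains w where "(cmap M i \<circ> c has_vector_derivative w) (at t within {u..v})" "w \<in> model M"
    "speed_within M {u..v} c t = sqrt (tensor M i (cmap M i (c t)) w w)"
proof -
  obtain w where w: "(cmap M i \<circ> c has_vector_derivative w) (at t within {u..v})"
    using c(2) t unfolding C1_curve_on_def by blast
  have nb: "at t within {u..v} \<noteq> bot" using at_within_Icc_neq_bot c(3) t(1) .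
  show ?thesis
    by (rule that[OF w]) (use velocity_in_model[OF c(1) t(2,1,3) w nb] speed_within_eq[OF c(1) t(1) nb t(2,3) w] in auto)
qed

lemma piecewise_C1_velocity:
  assumes c: "piecewise_C1_on M a b c S" and t: "t \<in> {a<..<b} - S" "i \<in> charts M" "c t \<in> cdom M i"
  obtains w where "(cmap M i \<circ> c has_vector_derivative w) (at t)" "w \<in> model M"
    "speed_within M UNIV c t = sqrt (tensor M i (cmap M i (c t)) w w)"
proof -
  obtain u v where uv: "a < u" "u < t" "t < v" "v < b" "{u..v} \<inter> S = {}"
    using interval_avoiding_finite[OF piecewise_C1_onD(1)[OF c], of a t b] t(1) by auto
  have 1: "continuous_map (top_of_set {u..v}) (mtop M) c"
    by (rule continuous_map_from_subtopology_mono[OF piecewise_C1_onD(2)[OF c]]) (use uv in auto)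
  have "{u<..<v} \<inter> S \<subseteq> {u..v} \<inter> S" by auto
  then have 2: "C1_curve_on M {u..v} c" using uv by (intro piecewise_C1_onD(3)[OF c]) auto
  have 3: "u < v" "t \<in> {u..v}" using uv by auto
  from C1_curve_velocity[OF 1 2 3 t(2,3)] show ?thesis
    using that uv by (metis at_within_Icc_at speed_within_interior)
qed

lemma speed_nonneg: 
  assumes "piecewise_C1_on M a b c S" "t \<in> {a<..<b} - S"
  shows "0 \<le> speed_within M UNIV c t"
proof -
  have "c t \<in> topspace (mtop M)"
    using continuous_map_image_subset_topspace[OF piecewise_C1_onD(2)[OF assms(1)]] assms(2) by auto
  then obtain i where i: "i \<in> charts M" "c t \<in> cdom M i" using ex_chart by blast
  from piecewise_C1_velocity[OF assms i] show ?thesis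
    by (metis i imageI real_sqrt_ge_0_iff tensor_nonneg)
qed

text \<open>The chart selected by \<open>SOME\<close> may jump from one parameter to the next, but
  near each t all speeds can be computed in one fixed chart, by
  \<open>speed_within_eq\<close>.\<close>

lemma continuous_on_speed:
  assumes c: "continuous_map (top_of_set {u..v}) (mtop M) c" "C1_curve_on M {u..v} c" "u < v"
  shows "continuous_on {u..v} (speed_within M {u..v} c)"
proof (rule continuous_on_local)
  fix t assume t: "t \<in> {u..v}"
  have "c t \<in> topspace (mtop M)"
    using continuous_map_image_subset_topspace[OF c(1)] t by auto
  then obtain i where i: "i \<in> charts M" "c t \<in> cdom M i" using ex_chart by blast
  obtain W where W: "open W" "t \<in> W" "\<And>s. s \<in> {u..v} \<inter> W \<longleftrightarrow> s \<in> {u..v} \<and> c s \<in> cdom M i"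
    using curve_in_chart_nhd[OF c(1) i(1) t i(2)] by blast
  have WT: "{s \<in> {u..v}. c s \<in> cdom M i} = {u..v} \<inter> W"
    by (rule set_eqI) (simp only: W(3) mem_Collect_eq)
  obtain D where D: "continuous_on ({u..v} \<inter> W) D"
    "\<And>s. s \<in> {u..v} \<Longrightarrow> c s \<in> cdom M i \<Longrightarrow> (cmap M i \<circ> c has_vector_derivative D s) (at s within {u..v})"
    using c(2)[unfolded C1_curve_on_def, rule_format, OF i(1)] unfolding WT[symmetric] by blast
  have dom: "c s \<in> cdom M i" "s \<in> {u..v}" "at s within {u..v} \<noteq> bot" if "s \<in> {u..v} \<inter> W" for s
    using that W(3)[of s] at_within_Icc_neq_bot[OF c(3), of s] by simp_all
  have "continuous_on ({u..v} \<inter> W) (\<lambda>s. sqrt (tensor M i ((cmap M i \<circ> c) s) (D s) (D s)))"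
  proof (rule continuous_on_real_sqrt, rule continuous_on_tensor[OF i(1) _ D(1)])
    show "continuous_on ({u..v} \<inter> W) (cmap M i \<circ> c)"
      by (rule continuous_on_cmap_curve[OF c(1) i(1)]) (use dom in auto)
    show "(cmap M i \<circ> c) s \<in> cmap M i ` cdom M i" if "s \<in> {u..v} \<inter> W" for s
      using dom(1)[OF that] by simp
    show "D s \<in> model M" if "s \<in> {u..v} \<inter> W" for s
      using velocity_in_model[OF c(1) i(1) dom(2,1)[OF that] D(2)[OF dom(2,1)[OF that]] dom(3)[OF that]] .
  qed
  moreover have "speed_within M {u..v} c s = sqrt (tensor M i ((cmap M i \<circ> c) s) (D s) (D s))"
    if "s \<in> {u..v} \<inter> W" for s
    using speed_within_eq[OF c(1) dom(2,3)[OF that] i(1) dom(1)[OF that] D(2)[OF dom(2,1)[OF that]]] by simp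
  ultimately show "\<exists>W g. open W \<and> t \<in> W \<and> continuous_on ({u..v} \<inter> W) g \<and> (\<forall>s\<in>{u..v} \<inter> W. speed_within M {u..v} c s = g s)"
    using W(1,2) by blast
qed

lemma speed_integrable:
  assumes c: "piecewise_C1_on M a b c S" and "a \<le> b"
  shows "speed_within M UNIV c integrable_on {a..b}"
proof (rule integrable_on_pieces[OF piecewise_C1_onD(1)[OF c] assms(2)])
  fix u v assume uv: "a \<le> u" "u < v" "v \<le> b" "{u<..<v} \<inter> S = {}"
  have "continuous_map (top_of_set {u..v}) (mtop M) c"
    by (rule continuous_map_from_subtopology_mono[OF piecewise_C1_onD(2)[OF c]]) (use uv in auto)
  then have "speed_within M {u..v} c integrable_on {u..v}"
    by (intro integrable_continuous_real continuous_on_speed piecewise_C1_onD(3)[OF c uv] uv(2))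
  \<comment> \<open>The speed within the piece and the speed on the whole line can differ only at
    the two ends.\<close>
  then show "speed_within M UNIV c integrable_on {u..v}"
    by (rule integrable_spike_finite[of "{u, v}", rotated 2]) (auto simp: speed_within_interior)
qed

end

lemma curve_length_eq: "curve_length M c = integral {0..1} (speed_within M UNIV c)"
  unfolding curve_length_def speed_eq
  by (rule integral_spike[of "{0, 1}"]) (auto simp: speed_within_interior)

subsection \<open>Reparametrisation and distance\<close>

context riemannian_manifold
begin

text \<open>The common part of affine and arc length changes of parameter. Each piece of the new
  interval has to be sent into a smooth piece of the old curve, interior to interior, so that the
  two-sided chain rule applies off the exceptional set.\<close>

lemma speed_curve_reparam:
  assumes c: "piecewise_C1_on M a b c S"
    and \<phi>: "continuous_on {a'..b'} \<phi>" "\<phi> ` {a'..b'} \<subseteq> {a..b}" and S': "finite S'"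
    and piece: "\<And>u v. \<lbrakk>a' \<le> u; u < v; v \<le> b'; {u<..<v} \<inter> S' = {}\<rbrakk> \<Longrightarrow>
      \<exists>p q \<phi>'. a \<le> p \<and> p < q \<and> q \<le> b \<and> {p<..<q} \<inter> S = {} \<and> \<phi> ` {u..v} \<subseteq> {p..q} \<and> \<phi> ` {u<..<v} \<subseteq> {p<..<q} \<and>
        continuous_on {u..v} \<phi>' \<and> (\<forall>t\<in>{u..v}. (\<phi> has_vector_derivative \<phi>' t) (at t within {u..v})) \<and>
        (\<forall>t\<in>{u<..<v}. \<bar>\<phi>' t\<bar> * speed_within M UNIV c (\<phi> t) \<le> K)"
  shows "speed_curve M a' b' (c \<circ> \<phi>) K"
  unfolding speed_curve_def
proof (intro exI conjI ballI)
  have cont: "continuous_map (top_of_set {a'..b'}) (mtop M) (c \<circ> \<phi>)"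
    by (rule continuous_map_compose[OF _ piecewise_C1_onD(2)[OF c]])
      (use \<phi> in \<open>simp add: continuous_map_in_subtopology image_subset_iff_funcset\<close>)
  show "piecewise_C1_on M a' b' (c \<circ> \<phi>) S'"
    unfolding piecewise_C1_on_def
  proof (intro conjI allI impI cont S')
    fix u v assume uv: "a' \<le> u" "u < v" "v \<le> b'" "{u<..<v} \<inter> S' = {}"
    obtain p q \<phi>' where pq: "a \<le> p" "p < q" "q \<le> b" "{p<..<q} \<inter> S = {}" and im: "\<phi> ` {u..v} \<subseteq> {p..q}"
      and \<phi>': "continuous_on {u..v} \<phi>'" "\<And>t. t \<in> {u..v} \<Longrightarrow> (\<phi> has_vector_derivative \<phi>' t) (at t within {u..v})"
      using piece[OF uv] by blast
    show "C1_curve_on M {u..v} (c \<circ> \<phi>)"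
      by (rule C1_curve_on_compose[OF piecewise_C1_onD(3)[OF c pq] im \<phi>'])
  qed
  fix t assume t: "t \<in> {a'<..<b'} - S'"
  obtain u v where uv: "a' < u" "u < t" "t < v" "v < b'" "{u..v} \<inter> S' = {}"
    using interval_avoiding_finite[OF S', of a' t b'] t by auto
  have "{u<..<v} \<inter> S' \<subseteq> {u..v} \<inter> S'" by auto
  then have uv': "a' \<le> u" "u < v" "v \<le> b'" "{u<..<v} \<inter> S' = {}" "t \<in> {u<..<v}" "t \<in> {u..v}"
    using uv by simp_all
  obtain p q \<phi>' where pq: "a \<le> p" "p < q" "q \<le> b" "{p<..<q} \<inter> S = {}" and im: "\<phi> ` {u<..<v} \<subseteq> {p<..<q}"
    and \<phi>': "\<And>t. t \<in> {u..v} \<Longrightarrow> (\<phi> has_vector_derivative \<phi>' t) (at t within {u..v})"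
    and le: "\<And>t. t \<in> {u<..<v} \<Longrightarrow> \<bar>\<phi>' t\<bar> * speed_within M UNIV c (\<phi> t) \<le> K"
    using piece[OF uv'(1-4)] by (elim exE conjE) (rule that, (assumption | erule (1) bspec)+)
  have \<phi>t: "p < \<phi> t" "\<phi> t < q" "\<phi> t \<in> {p..q}" using im uv'(5) by force+
  have c1: "continuous_map (top_of_set {p..q}) (mtop M) c"
    by (rule continuous_map_from_subtopology_mono[OF piecewise_C1_onD(2)[OF c]]) (use pq in auto)
  have "c (\<phi> t) \<in> topspace (mtop M)"
    using continuous_map_image_subset_topspace[OF c1] \<phi>t(3) by auto
  then obtain i where i: "i \<in> charts M" "c (\<phi> t) \<in> cdom M i" using ex_chart by blast
  obtain w where w: "(cmap M i \<circ> c has_vector_derivative w) (at (\<phi> t) within {p..q})" "w \<in> model M"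
    "speed_within M {p..q} c (\<phi> t) = sqrt (tensor M i (cmap M i (c (\<phi> t))) w w)"
    using C1_curve_velocity[OF c1 piecewise_C1_onD(3)[OF c pq] pq(2) \<phi>t(3) i] by blast
  have w': "(cmap M i \<circ> c has_vector_derivative w) (at (\<phi> t))"
    "speed_within M UNIV c (\<phi> t) = sqrt (tensor M i (cmap M i (c (\<phi> t))) w w)"
    using w \<phi>t(1,2) by (simp_all add: at_within_Icc_at speed_within_interior)
  have "(\<phi> has_vector_derivative \<phi>' t) (at t)" using \<phi>'[OF uv'(6)] uv by (simp add: at_within_Icc_at)
  from vector_diff_chain_at[OF this w'(1)]
  have d: "(cmap M i \<circ> (c \<circ> \<phi>) has_vector_derivative \<phi>' t *\<^sub>R w) (at t)" by (simp only: o_assoc)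
  have tab: "t \<in> {a'..b'}" "a' < t" "t < b'" using uv by auto
  have "speed_within M {a'..b'} (c \<circ> \<phi>) t = sqrt (tensor M i (cmap M i ((c \<circ> \<phi>) t)) (\<phi>' t *\<^sub>R w) (\<phi>' t *\<^sub>R w))"
    by (rule speed_within_eq[OF cont tab(1) _ i(1)])
      (use i(2) d tab in \<open>auto simp: at_within_Icc_at\<close>)
  also have "\<dots> = \<bar>\<phi>' t\<bar> * speed_within M UNIV c (\<phi> t)"
    using tensor_scale[OF i(1) imageI[OF i(2)] w(2)] by (simp add: w'(2) real_sqrt_mult)
  finally show "speed_within M UNIV (c \<circ> \<phi>) t \<le> K"
    using le[OF uv'(5)] speed_within_interior[OF tab(2,3), of M "c \<circ> \<phi>"] by simp
qed

lemma speed_curve_affine: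
  assumes c: "speed_curve M a b c K" and m: "m \<noteq> 0"
    and im: "\<And>t. t \<in> {a'..b'} \<Longrightarrow> m * t + k \<in> {a..b}"
  shows "speed_curve M a' b' (\<lambda>t. c (m * t + k)) (\<bar>m\<bar> * K)"
proof -
  let ?\<phi> = "\<lambda>t. m * t + k"
  obtain S where S: "piecewise_C1_on M a b c S" "\<And>t. t \<in> {a<..<b} - S \<Longrightarrow> speed_within M UNIV c t \<le> K"
    using c unfolding speed_curve_def by blast
  have inj: "inj ?\<phi>" using m by (auto simp: inj_on_def)
  have "speed_curve M a' b' (c \<circ> ?\<phi>) (\<bar>m\<bar> * K)"
  proof (rule speed_curve_reparam[OF S(1), where S' = "?\<phi> -` S"])
    show "finite (?\<phi> -` S)" using finite_vimageI[OF piecewise_C1_onD(1)[OF S(1)] inj] .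
    fix u v assume uv: "a' \<le> u" "u < v" "v \<le> b'" "{u<..<v} \<inter> ?\<phi> -` S = {}"
    \<comment> \<open>A negative \<open>m\<close> reverses the piece, so the ends of the image are
      taken in order.\<close>
    let ?p = "min (?\<phi> u) (?\<phi> v)" and ?q = "max (?\<phi> u) (?\<phi> v)"
    have mono: "?\<phi> s < ?\<phi> t \<longleftrightarrow> (if m > 0 then s < t else t < s)" for s t
      using m by (auto simp: not_less)
    have im1: "?\<phi> ` {u..v} \<subseteq> {?p..?q}" 
      using mono by (auto simp: min_le_iff_disj le_max_iff_disj not_less[symmetric] split: if_splits simp del: not_less)
    have im2: "?\<phi> ` {u<..<v} \<subseteq> {?p<..<?q}" using mono by (auto simp: min_less_iff_disj less_max_iff_disj)
    have pq: "a \<le> ?p" "?q \<le> b" using im[of u] im[of v] uv by auto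
    have "?p < ?q" using uv(2) mono[of u v] mono[of v u] by (auto simp: min_def max_def split: if_splits)
    have disj: "{?p<..<?q} \<inter> S = {}"
    proof (rule ccontr)
      assume "{?p<..<?q} \<inter> S \<noteq> {}"
      then obtain y where y: "y \<in> S" "?p < y" "y < ?q" by auto
      have e: "?\<phi> ((y - k) / m) = y" using m by simp
      have "u < (y - k) / m" "(y - k) / m < v"
        using y(2,3) mono[of u "(y - k) / m"] mono[of "(y - k) / m" v] mono[of v "(y - k) / m"] mono[of "(y - k) / m" u] mono[of u v] uv(2)
        unfolding e by (auto simp: min_less_iff_disj less_max_iff_disj split: if_splits)
      then have "(y - k) / m \<in> {u<..<v} \<inter> ?\<phi> -` S" using y(1) e by simp
      then show False using uv(4) by blast
    qed
    have dt: "((\<lambda>t. m * t + k) has_vector_derivative m) (at t within {u..v})" for t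
      unfolding has_vector_derivative_def by (auto intro!: derivative_eq_intros)
    have sp: "\<bar>m\<bar> * speed_within M UNIV c (?\<phi> t) \<le> \<bar>m\<bar> * K" if t: "t \<in> {u<..<v}" for t
    proof (rule mult_left_mono[OF S(2)])
      have "?\<phi> t \<in> {?p<..<?q}" using im2 t by blast
      then show "?\<phi> t \<in> {a<..<b} - S" using pq disj by auto
    qed auto
    show "\<exists>p q \<phi>'. a \<le> p \<and> p < q \<and> q \<le> b \<and> {p<..<q} \<inter> S = {} \<and> ?\<phi> ` {u..v} \<subseteq> {p..q} \<and> ?\<phi> ` {u<..<v} \<subseteq> {p<..<q} \<and>
        continuous_on {u..v} \<phi>' \<and> (\<forall>t\<in>{u..v}. (?\<phi> has_vector_derivative \<phi>' t) (at t within {u..v})) \<and>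
        (\<forall>t\<in>{u<..<v}. \<bar>\<phi>' t\<bar> * speed_within M UNIV c (?\<phi> t) \<le> \<bar>m\<bar> * K)"
      by (rule exI[of _ ?p], rule exI[of _ ?q], rule exI[of _ "\<lambda>_. m"])
        (intro conjI ballI pq im1 im2 disj \<open>?p < ?q\<close> dt sp continuous_on_const; assumption)
  qed (use im in \<open>auto intro!: continuous_intros\<close>)
  then show ?thesis by (simp add: comp_def)
qed

text \<open>On the unit interval K bounds the speed and the length alike. For points that can be
  joined at all, the infimum of the admissible K is the Riemannian distance.\<close>

definition joinable :: "'m \<Rightarrow> 'm \<Rightarrow> real \<Rightarrow> bool" where
  "joinable p q K \<longleftrightarrow> (\<exists>c. speed_curve M 0 1 c K \<and> c 0 = p \<and> c 1 = q)"

lemma joinable_mono: "joinable p q K \<Longrightarrow> K \<le> K' \<Longrightarrow> joinable p q K'"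
  unfolding joinable_def using speed_curve_mono by blast

lemma joinable_sym:
  assumes "joinable p q K"
  shows "joinable q p K"
proof -
  obtain c where c: "speed_curve M 0 1 c K" "c 0 = p" "c 1 = q" using assms unfolding joinable_def by blast
  have "speed_curve M 0 1 (\<lambda>t. c (- 1 * t + 1)) (\<bar>- 1\<bar> * K)"
    by (rule speed_curve_affine[OF c(1)]) auto
  then show ?thesis unfolding joinable_def using c(2,3) by (intro exI[of _ "\<lambda>t. c (- 1 * t + 1)"]) simp
qed

lemma joinable_trans:
  assumes "joinable p q K" "joinable q r K'" and pos: "K > 0" "K' > 0"
  shows "joinable p r (K + K')"
proof -
  obtain c where c: "speed_curve M 0 1 c K" "c 0 = p" "c 1 = q" using assms(1) unfolding joinable_def by blast
  obtain c' where c': "speed_curve M 0 1 c' K'" "c' 0 = q" "c' 1 = r" using assms(2) unfolding joinable_def by blast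
  \<comment> \<open>The unit interval is divided in proportion to the two bounds: rescaling by 1 / b
    and 1 / (1 - b) gives both parts the same bound K + K'.\<close>
  define b where "b = K / (K + K')"
  have b: "0 < b" "b < 1" "1 / b * K = K + K'" "1 / (1 - b) * K' = K + K'"
    using pos by (auto simp: b_def field_simps)
  have "speed_curve M 0 b (\<lambda>t. c (1 / b * t + 0)) (\<bar>1 / b\<bar> * K)"
    by (rule speed_curve_affine[OF c(1)]) (use b in \<open>auto simp: divide_simps\<close>)
  then have 1: "speed_curve M 0 b (\<lambda>t. c (1 / b * t + 0)) (K + K')" using b by simp
  have "speed_curve M b 1 (\<lambda>t. c' (1 / (1 - b) * t + (- b / (1 - b)))) (\<bar>1 / (1 - b)\<bar> * K')"
  proof (rule speed_curve_affine[OF c'(1)])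
    fix t assume "t \<in> {b..1}"
    then have "(t - b) / (1 - b) \<in> {0..1}" using b(2) by simp
    moreover have "1 / (1 - b) * t + (- b / (1 - b)) = (t - b) / (1 - b)" by (simp add: diff_divide_distrib)
    ultimately show "1 / (1 - b) * t + (- b / (1 - b)) \<in> {0..1}" by simp
  qed (use b in auto)
  then have 2: "speed_curve M b 1 (\<lambda>t. c' (1 / (1 - b) * t + (- b / (1 - b)))) (K + K')" using b by simp
  let ?c = "\<lambda>t. if t \<le> b then c (1 / b * t + 0) else c' (1 / (1 - b) * t + (- b / (1 - b)))"
  have "1 / (1 - b) * b + (- b / (1 - b)) = 0" "1 / (1 - b) * 1 + (- b / (1 - b)) = 1"
    using b(2) by (auto simp: field_simps)
  then have e: "c' (1 / (1 - b) * b + (- b / (1 - b))) = q" "c' (1 / (1 - b) * 1 + (- b / (1 - b))) = r"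
    using c' by simp_all
  have "c (1 / b * b + 0) = q" using b c by simp
  then have "speed_curve M 0 1 ?c (K + K')"
    using speed_curve_join[OF 1 2] b(1,2) e(1) by simp
  moreover have "?c 0 = p" using b c by simp
  moreover have "?c 1 = r" using b e(2) by simp
  ultimately show ?thesis unfolding joinable_def by blast
qed

lemma joinable_refl:
  assumes p: "p \<in> topspace (mtop M)" 
  shows "joinable p p 0"
proof -
  have cont: "continuous_map (top_of_set T) (mtop M) (\<lambda>t::real. p)" for T using p by simp
  have "C1_curve_on M T (\<lambda>t. p)" for T
    unfolding C1_curve_on_def by (intro ballI exI[of _ "\<lambda>_. 0"]) (auto simp: comp_def)
  then have "piecewise_C1_on M 0 1 (\<lambda>t. p) {}" using cont by (simp add: piecewise_C1_on_def)
  moreover obtain i where i: "i \<in> charts M" "p \<in> cdom M i" using ex_chart[OF p] by blast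
  have "speed_within M UNIV (\<lambda>t. p) t = sqrt (tensor M i (cmap M i p) 0 0)" for t
    by (rule speed_within_eq[OF cont _ _ i]) (auto simp: comp_def)
  then have "speed_within M UNIV (\<lambda>t. p) t = 0" for t
    using tensor_zero[OF i(1) imageI[OF i(2)] subspace_0[OF subspace_model]] by simp
  ultimately show ?thesis unfolding joinable_def speed_curve_def by fastforce
qed

text \<open>At the finitely many exceptional parameters the value of the speed is uncontrolled.
  Replacing it there by a constant leaves the integral unchanged and allows pointwise comparison on
  the whole interval.\<close>

lemma speed_modification:
  fixes K :: real
  assumes c: "piecewise_C1_on M 0 1 c S"
  defines "f \<equiv> \<lambda>t. if t \<in> {0<..<1} - S then speed_within M UNIV c t else K"
  shows "f integrable_on {0..1}" "integral {0..1} f = curve_length M c"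
proof -
  have fin: "finite (insert 0 (insert 1 S))" using piecewise_C1_onD(1)[OF c] by simp
  have eq: "f t = speed_within M UNIV c t" if "t \<in> {0..1} - insert 0 (insert 1 S)" for t
    using that by (auto simp: f_def less_le)
  show "f integrable_on {0..1}"
    by (rule integrable_spike_finite[OF fin eq speed_integrable[OF c]]) auto
  show "integral {0..1} f = curve_length M c"
    unfolding curve_length_eq
    by (rule integral_spike[OF negligible_finite[OF fin]]) (use eq in auto)
qed

lemma curve_length_nonneg:
  assumes "piecewise_C1_on M 0 1 c S"
  shows "0 \<le> curve_length M c"
  unfolding speed_modification(2)[OF assms, of 0, symmetric]
  by (rule Henstock_Kurzweil_Integration.integral_nonneg[OF speed_modification(1)[OF assms]])
    (use speed_nonneg[OF assms] in auto)

section \<open>The distance as an infimum of lengths and of speed bounds\<close>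

abbreviation lengths :: "'m \<Rightarrow> 'm \<Rightarrow> real set" where
  "lengths p q \<equiv> {curve_length M c | c. piecewise_C1_curve M c \<and> c 0 = p \<and> c 1 = q}"

lemma bdd_below_lengths: "bdd_below (lengths p q)"
  by (rule bdd_belowI[of _ 0]) (auto simp: piecewise_C1_curve_iff intro: curve_length_nonneg)

lemma riemannian_dist_le_length:
  "piecewise_C1_curve M c \<Longrightarrow> c 0 = p \<Longrightarrow> c 1 = q \<Longrightarrow> riemannian_dist M p q \<le> curve_length M c"
  unfolding riemannian_dist_def by (rule cInf_lower[OF _ bdd_below_lengths]) blast

lemma joinable_imp_piecewise: "joinable p q K \<Longrightarrow> \<exists>c. piecewise_C1_curve M c \<and> c 0 = p \<and> c 1 = q"
  unfolding joinable_def speed_curve_def piecewise_C1_curve_iff by blast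

lemma joinable_imp_dist_le:
  assumes "joinable p q K"
  shows "riemannian_dist M p q \<le> K"
proof -
  obtain c S where c: "piecewise_C1_on M 0 1 c S" "c 0 = p" "c 1 = q"
    "\<And>t. t \<in> {0<..<1} - S \<Longrightarrow> speed_within M UNIV c t \<le> K"
    using assms unfolding joinable_def speed_curve_def by blast
  have "riemannian_dist M p q \<le> curve_length M c"
    using c by (intro riemannian_dist_le_length) (auto simp: piecewise_C1_curve_iff)
  also have "\<dots> = integral {0..1} (\<lambda>t. if t \<in> {0<..<1} - S then speed_within M UNIV c t else K)"
    by (rule speed_modification(2)[OF c(1), symmetric])
  also have "\<dots> \<le> integral {0..1} (\<lambda>t::real. K)"
    by (rule Henstock_Kurzweil_Integration.integral_le[OF speed_modification(1)[OF c(1), of K]])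
      (use c(4) in \<open>auto simp: integrable_const_ivl\<close>)
  finally show ?thesis by simp
qed

text \<open>
  Reparametrise proportionally to arc length plus a small multiple of the old parameter;
  the extra term makes the parameter change a piecewise diffeomorphism even where the speed vanishes.
\<close>

lemma length_less_imp_joinable:
  assumes "piecewise_C1_curve M c" and pq: "c 0 = p" "c 1 = q" and less: "curve_length M c < K"
  shows "joinable p q K"
proof -
  obtain S where S: "piecewise_C1_on M 0 1 c S" using assms(1) piecewise_C1_curve_iff by blast
  note finS = piecewise_C1_onD(1)[OF S]
  define f where "f t = (if t \<in> {0<..<1} - S then speed_within M UNIV c t else 0)" for t
  \<comment> \<open>The spare length: adding this constant to the speed raises the total from the
    length of \<open>c\<close> to exactly K.\<close>
  define \<epsilon> where "\<epsilon> = K - curve_length M c"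
  have \<epsilon>: "\<epsilon> > 0" using less by (simp add: \<epsilon>_def)
  have K: "K > 0" using curve_length_nonneg[OF S] less by simp
  have f0: "f t \<ge> 0" for t using speed_nonneg[OF S, of t] by (simp add: f_def)
  have fi: "f integrable_on {0..1}" "integral {0..1} f = curve_length M c"
    using speed_modification[OF S, of 0] unfolding f_def .
  define g where "g t = f t + \<epsilon>" for t
  have gi: "g integrable_on {0..1}" unfolding g_def by (intro integrable_add fi integrable_const_ivl)
  have gi': "g integrable_on {s..t}" if "0 \<le> s" "t \<le> 1" for s t
    by (rule integrable_on_subinterval[OF gi]) (use that in auto)
  have gK: "integral {0..1} g = K"
    unfolding g_def by (subst Henstock_Kurzweil_Integration.integral_add[OF fi(1) integrable_const_ivl]) (simp add: fi \<epsilon>_def)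
  \<comment> \<open>Modified arc length, normalised to total 1. It is an increasing bijection of the
    unit interval, and its inverse is the new parameter change.\<close>
  define H where "H t = integral {0..t} g / K" for t
  have Hd: "H t = H s + integral {s..t} g / K" if "0 \<le> s" "s \<le> t" "t \<le> 1" for s t
    using Henstock_Kurzweil_Integration.integral_combine[OF that(1,2) gi'[of 0 t]] that
    by (simp add: H_def flip: add_divide_distrib)
  have Hmono: "H s < H t" if "0 \<le> s" "s < t" "t \<le> 1" for s t
  proof -
    have "\<epsilon> * (t - s) = integral {s..t} (\<lambda>_. \<epsilon>)" using that by simp
    also have "\<dots> \<le> integral {s..t} g"
      by (rule Henstock_Kurzweil_Integration.integral_le[OF integrable_const_ivl gi']) (use that f0 in \<open>auto simp: g_def\<close>)
    finally have "0 < integral {s..t} g" using \<epsilon> that by (smt (verit) mult_pos_pos)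
    then show ?thesis using Hd[of s t] that K by simp
  qed
  have H01: "H 0 = 0" "H 1 = 1" using gK K by (simp_all add: H_def)
  have Hcont: "continuous_on {0..1} H"
    unfolding H_def using K by (intro continuous_on_divide indefinite_integral_continuous_1 gi) auto
  have Hinj: "inj_on H {0..1}" 
    by (rule linorder_inj_onI) (use Hmono in \<open>force+\<close>)
  have Hle: "H s \<le> H t \<longleftrightarrow> s \<le> t" "H s < H t \<longleftrightarrow> s < t" if "s \<in> {0..1}" "t \<in> {0..1}" for s t
    using Hmono[of s t] Hmono[of t s] that by (cases s t rule: linorder_cases; force)+
  have Him: "H ` {0..1} = {0..1}"
  proof
    show "H ` {0..1} \<subseteq> {0..1}" using Hle(1)[of 0] Hle(1)[of _ 1] H01 by auto
    show "{0..1} \<subseteq> H ` {0..1}"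
    proof
      fix y :: real assume "y \<in> {0..1}"
      then show "y \<in> H ` {0..1}" using IVT'[of H 0 y 1] H01 Hcont by (auto simp: image_iff)
    qed
  qed
  define \<phi> where "\<phi> = inv_into {0..1} H"
  have \<phi>H: "\<phi> (H t) = t" if "t \<in> {0..1}" for t using that Hinj by (simp add: \<phi>_def)
  have \<phi>m: "\<phi> y \<in> {0..1}" if "y \<in> {0..1}" for y unfolding \<phi>_def by (rule inv_into_into) (use that Him in simp)
  have H\<phi>: "H (\<phi> y) = y" if "y \<in> {0..1}" for y unfolding \<phi>_def by (rule f_inv_into_f) (use that Him in simp)
  have \<phi>cont: "continuous_on {0..1} \<phi>"
    using continuous_on_inv[OF Hcont compact_Icc, of \<phi>] \<phi>H Him by simp
  have \<phi>less: "\<phi> x < \<phi> y" if "x \<in> {0..1}" "y \<in> {0..1}" "x < y" for x y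
    using Hle(2)[OF \<phi>m[OF that(1)] \<phi>m[OF that(2)]] that H\<phi> by simp
  have "speed_curve M 0 1 (c \<circ> \<phi>) K"
  proof (rule speed_curve_reparam[OF S \<phi>cont])
    show "\<phi> ` {0..1} \<subseteq> {0..1}" using \<phi>m by blast
    show "finite (H ` S)" using finS by simp
    fix u v :: real assume uv: "0 \<le> u" "u < v" "v \<le> 1" "{u<..<v} \<inter> H ` S = {}"
    let ?p = "\<phi> u" and ?q = "\<phi> v"
    have uvm: "u \<in> {0..1}" "v \<in> {0..1}" using uv by auto
    have pq: "0 \<le> ?p" "?p < ?q" "?q \<le> 1" using \<phi>m[OF uvm(1)] \<phi>m[OF uvm(2)] \<phi>less[OF uvm uv(2)] by auto
    have sub: "s \<in> {0..1}" if "s \<in> {?p..?q}" for s using that pq by auto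
    have Hpq: "H ?p = u" "H ?q = v" using H\<phi> uvm by auto
    have disj: "{?p<..<?q} \<inter> S = {}"
    proof (rule ccontr)
      assume "{?p<..<?q} \<inter> S \<noteq> {}"
      then obtain s where s: "s \<in> S" "?p < s" "s < ?q" by auto
      then have "u < H s" "H s < v" using Hmono[of ?p s] Hmono[of s ?q] pq Hpq by auto
      then show False using uv(4) s(1) by auto
    qed
    have im: "H ` {?p..?q} = {u..v}"
    proof
      show "H ` {?p..?q} \<subseteq> {u..v}" using Hle(1)[OF _ sub] Hle(1)[OF sub] pq Hpq by (smt (verit) atLeastAtMost_iff image_subsetI)
      show "{u..v} \<subseteq> H ` {?p..?q}"
        using IVT'[of H ?p _ ?q] Hpq pq continuous_on_subset[OF Hcont, of "{?p..?q}"] sub by (force simp: image_iff)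
    qed
    have \<phi>im: "\<phi> s \<in> {?p..?q}" if "s \<in> {u..v}" for s 
      using that \<phi>H[OF sub] unfolding im[symmetric] by force
    have \<phi>im2: "\<phi> s \<in> {?p<..<?q}" if "s \<in> {u<..<v}" for s
      using \<phi>less[of u s] \<phi>less[of s v] that uvm by auto
    \<comment> \<open>The modified speed on one piece, with one-sided derivatives at the ends: it
      agrees with \<open>g\<close> inside and is continuous on the closed piece.\<close>
    define gl where "gl t = speed_within M {?p..?q} c t + \<epsilon>" for t
    have cc: "continuous_map (top_of_set {?p..?q}) (mtop M) c"
      by (rule continuous_map_from_subtopology_mono[OF piecewise_C1_onD(2)[OF S]]) (use pq in auto)
    have glc: "continuous_on {?p..?q} gl"
      unfolding gl_def by (intro continuous_intros continuous_on_speed cc piecewise_C1_onD(3)[OF S pq disj] pq(2))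
    have fe: "f t = speed_within M {?p..?q} c t" if "t \<in> {?p<..<?q}" for t
    proof -
      have "t \<in> {0<..<1} - S" using that disj pq by auto
      then show ?thesis using speed_within_interior[of ?p t ?q M c] that by (simp add: f_def)
    qed
    \<comment> \<open>Nonnegativity of the speed is available in the interior; continuity carries
      the bound to the ends.\<close>
    have gl\<epsilon>: "gl t \<ge> \<epsilon>" if "t \<in> {?p..?q}" for t
    proof -
      have "continuous_on (closure {?p<..<?q}) gl" using glc pq(2) by simp
      moreover have "t \<in> closure {?p<..<?q}" using that pq(2) by simp
      moreover have "gl s \<ge> \<epsilon>" if "s \<in> {?p<..<?q}" for s using fe[OF that] f0[of s] by (simp add: gl_def)
      ultimately show ?thesis by (rule continuous_ge_on_closure)
    qed
    have Hder: "(H has_vector_derivative gl t / K) (at t within {?p..?q})" if t: "t \<in> {?p..?q}" for t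
    proof -
      have "((\<lambda>t. integral {?p..t} gl) has_vector_derivative gl t) (at t within {?p..?q})"
        by (rule integral_has_vector_derivative[OF glc t])
      then have "((\<lambda>t. H ?p + integral {?p..t} gl / K) has_vector_derivative gl t / K) (at t within {?p..?q})"
        using K unfolding has_real_derivative_iff_has_vector_derivative[symmetric]
        by (auto intro!: derivative_eq_intros)
      then show ?thesis
      proof (rule has_vector_derivative_transform[OF t, rotated])
        fix s assume s: "s \<in> {?p..?q}"
        have "integral {?p..s} g = integral {?p..s} gl"
          by (rule integral_spike[of "{?p, ?q}"]) (use s fe in \<open>auto simp: g_def gl_def less_le\<close>)
        then show "H s = H ?p + integral {?p..s} gl / K"
          using Hd[of ?p s] s pq by auto
      qed
    qed
    have \<phi>der: "(\<phi> has_vector_derivative K / gl (\<phi> t)) (at t within {u..v})" if t: "t \<in> {u..v}" for t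
    proof -
      have m: "\<phi> t \<in> {?p..?q}" and t01: "t \<in> {0..1}" using \<phi>im[OF t] t uvm by auto
      have g0: "gl (\<phi> t) > 0" using gl\<epsilon>[OF m] \<epsilon> by simp
      have "(\<phi> has_derivative (\<lambda>y. y * (K / gl (\<phi> t)))) (at (H (\<phi> t)) within H ` {?p..?q})"
      proof (rule has_derivative_inverse_within)
        show "(H has_derivative (\<lambda>x. x * (gl (\<phi> t) / K))) (at (\<phi> t) within {?p..?q})"
          using Hder[OF m] by (simp add: has_vector_derivative_def)
        show "continuous (at (H (\<phi> t)) within H ` {?p..?q}) \<phi>"
          unfolding H\<phi>[OF t01] im using continuous_on_subset[OF \<phi>cont, of "{u..v}"] t uvm
          by (auto simp: continuous_on_eq_continuous_within)
        show "linear (\<lambda>y. y * (K / gl (\<phi> t)))" by (auto intro!: linearI simp: algebra_simps add_divide_distrib)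
        show "(\<lambda>y. y * (K / gl (\<phi> t))) \<circ> (\<lambda>x. x * (gl (\<phi> t) / K)) = id"
          using K g0 by (auto simp: fun_eq_iff)
      qed (use m \<phi>H sub in auto)
      then show ?thesis unfolding has_vector_derivative_def im H\<phi>[OF t01] by simp
    qed
    have contd: "continuous_on {u..v} (\<lambda>t. K / gl (\<phi> t))"
    proof (intro continuous_intros continuous_on_compose2[OF glc] continuous_on_subset[OF \<phi>cont])
      show "\<forall>t\<in>{u..v}. gl (\<phi> t) \<noteq> 0" using gl\<epsilon>[OF \<phi>im] \<epsilon> by fastforce
    qed (use uv \<phi>im in auto)
    \<comment> \<open>The new speed is K (gl - \<open>\<epsilon>\<close>) / gl, with gl taken at the
      old parameter, and this is at most K.\<close>
    have sp: "\<bar>K / gl (\<phi> t)\<bar> * speed_within M UNIV c (\<phi> t) \<le> K" if "t \<in> {u<..<v}" for t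
    proof -
      have m: "\<phi> t \<in> {?p<..<?q}" using \<phi>im2[OF that] .
      then have e: "speed_within M UNIV c (\<phi> t) = gl (\<phi> t) - \<epsilon>"
        using speed_within_interior[of ?p "\<phi> t" ?q M c] by (simp add: gl_def)
      have "gl (\<phi> t) \<ge> \<epsilon>" using gl\<epsilon> m by auto
      then show ?thesis unfolding e using \<epsilon> K by (simp add: field_simps)
    qed
    have im1: "\<phi> ` {u..v} \<subseteq> {?p..?q}" and im2: "\<phi> ` {u<..<v} \<subseteq> {?p<..<?q}"
      by (rule image_subsetI, erule \<phi>im, rule image_subsetI, erule \<phi>im2)
    have d: "\<forall>t\<in>{u..v}. (\<phi> has_vector_derivative K / gl (\<phi> t)) (at t within {u..v})"
      and s: "\<forall>t\<in>{u<..<v}. \<bar>K / gl (\<phi> t)\<bar> * speed_within M UNIV c (\<phi> t) \<le> K"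
      by (rule ballI, erule \<phi>der, rule ballI, erule sp)
    show "\<exists>p q \<phi>'. 0 \<le> p \<and> p < q \<and> q \<le> 1 \<and> {p<..<q} \<inter> S = {} \<and> \<phi> ` {u..v} \<subseteq> {p..q} \<and> \<phi> ` {u<..<v} \<subseteq> {p<..<q} \<and>
        continuous_on {u..v} \<phi>' \<and> (\<forall>t\<in>{u..v}. (\<phi> has_vector_derivative \<phi>' t) (at t within {u..v})) \<and>
        (\<forall>t\<in>{u<..<v}. \<bar>\<phi>' t\<bar> * speed_within M UNIV c (\<phi> t) \<le> K)"
    proof (rule exI[of _ ?p], rule exI[of _ ?q], rule exI[of _ "\<lambda>t. K / gl (\<phi> t)"], intro conjI)
      show "0 \<le> ?p" "?p < ?q" "?q \<le> 1" by fact+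
      show "{?p<..<?q} \<inter> S = {}" by fact
      show "\<phi> ` {u..v} \<subseteq> {?p..?q}" by fact
      show "\<phi> ` {u<..<v} \<subseteq> {?p<..<?q}" by fact
      show "continuous_on {u..v} (\<lambda>t. K / gl (\<phi> t))" by fact
    qed fact+
  qed
  moreover have "\<phi> 0 = 0" "\<phi> 1 = 1" using \<phi>H[of 0] \<phi>H[of 1] H01 by simp_all
  ultimately show ?thesis unfolding joinable_def using pq by (intro exI[of _ "c \<circ> \<phi>"]) simp
qed

text \<open>The first assumption makes the set of lengths nonempty; only then does a number above
  the infimum lie above some length.\<close>

lemma dist_less_imp_joinable:
  assumes "joinable p q K'" "riemannian_dist M p q < K"
  shows "joinable p q K"
proof -
  have "lengths p q \<noteq> {}" using joinable_imp_piecewise[OF assms(1)] by blast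
  then have "\<exists>l\<in>lengths p q. l < K"
    using assms(2) cInf_lessD[of "lengths p q" K] unfolding riemannian_dist_def by blast
  then show ?thesis using length_less_imp_joinable by blast
qed

end

subsection \<open>Comparison with a Euclidean norm\<close>

context smooth_manifold
begin

text \<open>Being C1 refers to all charts. For a curve that is a straight line in chart i, the
  velocity in another chart is the derivative of the coordinate change in the fixed direction w,
  hence continuous.\<close>

lemma C1_curve_in_chart:
  assumes c: "continuous_map (top_of_set {u..v}) (mtop M) c" "u < v" "c ` {u..v} \<subseteq> cdom M i" and i: "i \<in> charts M"
    and d: "\<And>t. t \<in> {u..v} \<Longrightarrow> (cmap M i \<circ> c has_vector_derivative w) (at t within {u..v})"
  shows "C1_curve_on M {u..v} c"
  unfolding C1_curve_on_def
proof (intro ballI exI conjI impI)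
  let ?T = "{u..v}"
  fix j assume j: "j \<in> charts M"
  let ?D = "\<lambda>t. vector_derivative (cmap M j \<circ> c) (at t within ?T)" and ?A = "{t \<in> ?T. c t \<in> cdom M j}"
  have dom: "c t \<in> cdom M i" if "t \<in> ?T" for t using c(3) that by blast
  have xc: "continuous_map (top_of_set ?T) euclidean (cmap M i \<circ> c)"
    using continuous_on_cmap_curve[OF c(1) i order_refl c(3)] by simp
  show "(cmap M j \<circ> c has_vector_derivative ?D t) (at t within ?T)" if t: "t \<in> ?T" "c t \<in> cdom M j" for t
  proof -
    obtain D where D: "(cmap M j \<circ> c has_vector_derivative D w) (at t within ?T)"
      using coordinate_change[OF c(1) i j t(1) dom[OF t(1)] t(2) d[OF t(1)]] by blast
    then show ?thesis
      unfolding vector_derivative_within[OF at_within_Icc_neq_bot[OF c(2) t(1)] D] .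
  qed
  show "continuous_on ?A ?D"
  proof (rule continuous_on_local)
    fix t assume "t \<in> ?A"
    then have t: "t \<in> ?T" "c t \<in> cdom M j" by auto
    obtain W h where h: "open W" "cmap M i (c t) \<in> W" "\<And>x. x \<in> W \<Longrightarrow> h differentiable (at x)"
      "\<And>v. continuous_on W (\<lambda>x. frechet_derivative h (at x) v)"
      "\<And>p. \<lbrakk>p \<in> cdom M i; p \<in> cdom M j; cmap M i p \<in> W\<rbrakk> \<Longrightarrow> h (cmap M i p) = cmap M j p"
      using transition_extension[OF i j dom[OF t(1)] t(2)] by metis
    have "openin euclidean W" "(cmap M i \<circ> c) t \<in> W" using h(1,2) by simp_all
    then obtain W1 where W1: "open W1" "t \<in> W1" "\<And>s. s \<in> ?T \<inter> W1 \<longleftrightarrow> s \<in> ?T \<and> (cmap M i \<circ> c) s \<in> W"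
      using continuous_map_preimage_nhd[OF xc _ t(1)] by blast
    obtain W2 where W2: "open W2" "t \<in> W2" "\<And>s. s \<in> ?T \<inter> W2 \<longleftrightarrow> s \<in> ?T \<and> c s \<in> cdom M j"
      using curve_in_chart_nhd[OF c(1) j t] by blast
    \<comment> \<open>The velocity in chart j, computed from a local ambient extension of the
      coordinate change.\<close>
    let ?g = "\<lambda>s. frechet_derivative h (at ((cmap M i \<circ> c) s)) w"
    have in1: "(cmap M i \<circ> c) s \<in> W" if "s \<in> ?T" "s \<in> W1" for s using W1(3)[of s] that by simp
    have in2: "c s \<in> cdom M j" if "s \<in> ?T" "s \<in> W2" for s using W2(3)[of s] that by simp
    have "continuous_on (?A \<inter> W1) ?g"
    proof (rule continuous_on_compose2[OF h(4)])
      show "continuous_on (?A \<inter> W1) (cmap M i \<circ> c)"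
        by (rule continuous_on_cmap_curve[OF c(1) i]) (use dom in auto)
      show "(cmap M i \<circ> c) ` (?A \<inter> W1) \<subseteq> W" using in1 by blast
    qed
    then have "continuous_on (?A \<inter> (W1 \<inter> W2)) ?g" by (rule continuous_on_subset) auto
    moreover have "?D s = ?g s" if "s \<in> ?A \<inter> (W1 \<inter> W2)" for s
    proof -
      have s: "s \<in> ?T" "s \<in> W1" "s \<in> W2" using that by auto
      have "(h has_derivative frechet_derivative h (at ((cmap M i \<circ> c) s))) (at ((cmap M i \<circ> c) s))"
        using h(3)[OF in1[OF s(1,2)]] frechet_derivative_works by blast
      then have "(h has_derivative frechet_derivative h (at ((cmap M i \<circ> c) s))) (at ((cmap M i \<circ> c) s) within (cmap M i \<circ> c) ` ?T)"
        by (rule has_derivative_at_withinI)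
      from vector_derivative_diff_chain_within[OF d[OF s(1)] this]
      have "(h \<circ> (cmap M i \<circ> c) has_vector_derivative ?g s) (at s within ?T)" .
      then have "(h \<circ> (cmap M i \<circ> c) has_vector_derivative ?g s) (at s within ?T \<inter> (W1 \<inter> W2))"
        by (rule has_vector_derivative_within_subset) auto
      then have "(cmap M j \<circ> c has_vector_derivative ?g s) (at s within ?T \<inter> (W1 \<inter> W2))"
        by (rule has_vector_derivative_transform[rotated 2])
          (use s h(5) in1 in2 dom in auto)
      moreover have "at s within ?T \<inter> (W1 \<inter> W2) = at s within ?T"
        by (rule at_within_nhd[of s "W1 \<inter> W2"]) (use s W1(1) W2(1) in auto)
      ultimately show ?thesis
        using vector_derivative_within[OF at_within_Icc_neq_bot[OF c(2) s(1)]] by simp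
    qed
    ultimately show "\<exists>W g. open W \<and> t \<in> W \<and> continuous_on (?A \<inter> W) g \<and> (\<forall>s\<in>?A \<inter> W. ?D s = g s)"
      using W1(1,2) W2(1,2) by (intro exI[of _ "W1 \<inter> W2"] exI[of _ ?g]) auto
  qed
qed

end

text \<open>The outcome of \<open>tensor_comparison\<close> at \<open>p\<close>, kept as a context:
  in the closed coordinate ball all lengths are compared with the single norm at the centre, and
  \<open>m\<close> relates that norm to the ambient one.\<close>

locale comparison_chart = riemannian_manifold M for M :: "('i, 'm, 'a::euclidean_space) riemannian" +
  fixes i :: 'i and p :: 'm and \<eta> r m :: real
  assumes i: "i \<in> charts M" and p: "p \<in> cdom M i" and \<eta>: "0 < \<eta>" "\<eta> < 1" and r: "0 < r" and m: "0 < m"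
    and ball: "cball (cmap M i p) r \<inter> model M \<subseteq> cmap M i ` cdom M i"
    and m_le: "\<And>v. v \<in> model M \<Longrightarrow> m * norm v \<le> sqrt (tensor M i (cmap M i p) v v)"
    and lower: "\<And>x v. \<lbrakk>x \<in> cball (cmap M i p) r; x \<in> model M; v \<in> model M\<rbrakk> \<Longrightarrow>
       (1 - \<eta>) * sqrt (tensor M i (cmap M i p) v v) \<le> sqrt (tensor M i x v v)"
    and upper: "\<And>x v. \<lbrakk>x \<in> cball (cmap M i p) r; x \<in> model M; v \<in> model M\<rbrakk> \<Longrightarrow>
       sqrt (tensor M i x v v) \<le> (1 + \<eta>) * sqrt (tensor M i (cmap M i p) v v)"
begin

definition nrm :: "'a \<Rightarrow> real" where
  "nrm v = sqrt (tensor M i (cmap M i p) v v)"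

abbreviation x0 :: 'a where "x0 \<equiv> cmap M i p"
abbreviation B :: "'a set" where "B \<equiv> cball x0 r \<inter> model M"
abbreviation \<psi> :: "'a \<Rightarrow> 'm" where "\<psi> \<equiv> inv_into (cdom M i) (cmap M i)"

lemma x0: "x0 \<in> cmap M i ` cdom M i" using p by blast

lemma nrm_minus: "v \<in> model M \<Longrightarrow> nrm (- v) = nrm v"
  using tensor_scale[OF i x0, of v "-1"] by (simp add: nrm_def)

lemma nrm_nonneg: "v \<in> model M \<Longrightarrow> 0 \<le> nrm v"
  using tensor_nonneg[OF i x0] by (simp add: nrm_def)

lemma nrm_diff_commute: "v \<in> model M \<Longrightarrow> w \<in> model M \<Longrightarrow> nrm (v - w) = nrm (w - v)"
  using nrm_minus[of "v - w"] subspace_model by (simp add: subspace_diff)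

lemma \<psi>_cmap: "q \<in> cdom M i \<Longrightarrow> \<psi> (cmap M i q) = q"
  using inj_on_cmap[OF i] by simp

lemma \<psi>:
  assumes "x \<in> B"
  shows "\<psi> x \<in> cdom M i" "cmap M i (\<psi> x) = x"
proof -
  have "x \<in> cmap M i ` cdom M i" using assms ball by blast
  then show "\<psi> x \<in> cdom M i" "cmap M i (\<psi> x) = x" by (rule inv_into_into, rule f_inv_into_f)
qed

text \<open>The coordinate segment stays in the ball by convexity, and its speed is controlled by
  \<open>upper\<close>.\<close>

lemma joinable_segment:
  assumes x: "x \<in> B" and y: "y \<in> B"
  shows "joinable (\<psi> x) (\<psi> y) ((1 + \<eta>) * nrm (y - x))"
proof -
  let ?s = "\<lambda>t::real. x + t *\<^sub>R (y - x)" and ?T = "{0..1::real}"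
  have conv: "convex B" using subspace_model by (intro convex_Int convex_cball subspace_imp_convex)
  have sB: "?s t \<in> B" if "t \<in> ?T" for t
    using convexD_alt[OF conv x y, of t] that by (simp add: algebra_simps)
  have yx: "y - x \<in> model M" using x y subspace_model by (simp add: subspace_diff)
  let ?c = "\<lambda>t. \<psi> (?s t)"
  have "continuous_map (top_of_set ?T) (top_of_set (cmap M i ` cdom M i)) ?s"
    using sB ball by (auto simp: continuous_map_in_subtopology intro!: continuous_intros)
  from continuous_map_compose[OF this continuous_map_inv_cmap[OF i]]
  have cont: "continuous_map (top_of_set ?T) (mtop M) ?c" by (simp add: comp_def)
  have d: "(cmap M i \<circ> ?c has_vector_derivative (y - x)) (at t within ?T)" if t: "t \<in> ?T" for t
  proof (rule has_vector_derivative_transform[OF t])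
    show "(?s has_vector_derivative (y - x)) (at t within ?T)"
      unfolding has_vector_derivative_def by (auto intro!: derivative_eq_intros)
    show "(cmap M i \<circ> ?c) s = ?s s" if "s \<in> ?T" for s using \<psi>(2)[OF sB[OF that]] by simp
  qed
  have im: "?c ` ?T \<subseteq> cdom M i" using \<psi>(1)[OF sB] by blast
  have C1: "C1_curve_on M ?T ?c" by (rule C1_curve_in_chart[OF cont _ im i d]) auto
  then have "piecewise_C1_on M 0 1 ?c {}"
    using cont by (auto simp: piecewise_C1_on_def intro: C1_curve_on_subset)
  moreover have "speed_within M UNIV ?c t \<le> (1 + \<eta>) * nrm (y - x)" if t: "t \<in> {0<..<1}" for t
  proof -
    have tT: "t \<in> ?T" and t': "0 < t" "t < 1" using t by auto
    have "speed_within M ?T ?c t = sqrt (tensor M i (cmap M i (?c t)) (y - x) (y - x))"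
      using speed_within_eq[OF cont tT at_within_Icc_neq_bot[OF zero_less_one tT] i \<psi>(1)[OF sB[OF tT]] d[OF tT]] .
    also have "\<dots> \<le> (1 + \<eta>) * nrm (y - x)"
      unfolding nrm_def \<psi>(2)[OF sB[OF tT]] using sB[OF tT] yx by (intro upper) auto
    finally show ?thesis using speed_within_interior[OF t', of M ?c] by simp
  qed
  ultimately have "speed_curve M 0 1 ?c ((1 + \<eta>) * nrm (y - x))" unfolding speed_curve_def by blast
  then show ?thesis unfolding joinable_def by (intro exI[of _ ?c]) simp
qed

text \<open>The displacement w is tested against the velocity in the tensor at the centre:
  Cauchy-Schwarz and \<open>lower\<close> bound the product by nrm w times K / (1 -
  \<open>\<eta>\<close>), while its integral is the square of nrm w.\<close>

lemma displacement_le: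
  assumes c: "piecewise_C1_on M 0 1 c S" "\<And>t. t \<in> {0<..<1} - S \<Longrightarrow> speed_within M UNIV c t \<le> K"
    and \<tau>: "0 \<le> \<tau>" "\<tau> \<le> 1" and inB: "\<And>t. t \<in> {0..\<tau>} \<Longrightarrow> c t \<in> cdom M i \<and> cmap M i (c t) \<in> B" 
    and K: "0 \<le> K"
  shows "nrm (cmap M i (c \<tau>) - cmap M i (c 0)) \<le> K / (1 - \<eta>)"
proof -
  define X where "X = cmap M i \<circ> c"
  define w where "w = X \<tau> - X 0"
  define C where "C = nrm w * (K / (1 - \<eta>))"
  have XB: "X t \<in> B" if "t \<in> {0..\<tau>}" for t using inB[OF that] by (simp add: X_def)
  have w: "w \<in> model M" using XB[of \<tau>] XB[of 0] \<tau> subspace_model by (simp add: w_def subspace_diff)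
  obtain z where z: "\<And>v. v \<in> model M \<Longrightarrow> tensor M i x0 w v = z \<bullet> v"
    using tensor_Riesz[OF i x0 w] by blast
  \<comment> \<open>The default \<open>C\<close> at exceptional parameters is the very bound to be
    shown, so \<open>f\<close> is at most \<open>C\<close> everywhere.\<close>
  define f where "f t = (if t \<in> {0<..<\<tau>} - S then z \<bullet> vector_derivative X (at t) else C)" for t
  have vel: "((\<lambda>t. z \<bullet> X t) has_vector_derivative f t) (at t)" "f t \<le> C" if t: "t \<in> {0<..<\<tau>} - S" for t
  proof -
    have t1: "t \<in> {0<..<1} - S" and t2: "t \<in> {0..\<tau>}" using t \<tau> by auto
    obtain v where v: "(X has_vector_derivative v) (at t)" "v \<in> model M"
      "speed_within M UNIV c t = sqrt (tensor M i (cmap M i (c t)) v v)"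
      using piecewise_C1_velocity[OF c(1) t1 i] inB[OF t2] unfolding X_def by blast
    have fv: "f t = z \<bullet> v" using t vector_derivative_at[OF v(1)] by (simp add: f_def)
    show "((\<lambda>t. z \<bullet> X t) has_vector_derivative f t) (at t)"
      using v(1) unfolding fv has_vector_derivative_def by (auto intro!: derivative_eq_intros)
    have "(1 - \<eta>) * nrm v \<le> sqrt (tensor M i (cmap M i (c t)) v v)"
      unfolding nrm_def using inB[OF t2] v(2) by (intro lower) auto
    also have "\<dots> \<le> K" using c(2)[OF t1] v(3) by simp
    finally have "nrm v \<le> K / (1 - \<eta>)" using \<eta> by (simp add: field_simps)
    then have "nrm w * nrm v \<le> C" unfolding C_def by (rule mult_left_mono[OF _ nrm_nonneg[OF w]])
    moreover have "f t \<le> nrm w * nrm v"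
      using tensor_Cauchy_Schwarz[OF i x0 w v(2)] z[OF v(2)] fv by (simp add: nrm_def)
    ultimately show "f t \<le> C" by simp
  qed
  have "continuous_on {0..\<tau>} X" unfolding X_def
    by (rule continuous_on_cmap_curve[OF piecewise_C1_onD(2)[OF c(1)] i]) (use \<tau> inB in auto)
  then have "continuous_on {0..\<tau>} (\<lambda>t. z \<bullet> X t)" by (intro continuous_intros)
  then have "(f has_integral (z \<bullet> X \<tau> - z \<bullet> X 0)) {0..\<tau>}"
    using fundamental_theorem_of_calculus_interior_strong[OF piecewise_C1_onD(1)[OF c(1)] \<tau>(1), of "\<lambda>t. z \<bullet> X t" f] vel(1)
    by blast
  moreover have "((\<lambda>_. C) has_integral (\<tau> * C)) {0..\<tau>}"
    using has_integral_const_real[of C 0 \<tau>] \<tau> by simp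
  moreover have "f t \<le> C" if "t \<in> {0..\<tau>}" for t
    using vel(2)[of t] by (cases "t \<in> {0<..<\<tau>} - S") (auto simp: f_def)
  ultimately have "z \<bullet> X \<tau> - z \<bullet> X 0 \<le> \<tau> * C" by (rule has_integral_le)
  moreover have "z \<bullet> X \<tau> - z \<bullet> X 0 = (nrm w)\<^sup>2"
    using z[OF w] tensor_nonneg[OF i x0 w] by (simp add: w_def inner_diff_right nrm_def)
  moreover have C0: "0 \<le> C" unfolding C_def using nrm_nonneg[OF w] K \<eta> by simp
  then have "\<tau> * C \<le> C" using \<tau> by (simp add: mult_left_le_one_le)
  ultimately have "(nrm w)\<^sup>2 \<le> nrm w * (K / (1 - \<eta>))" by (simp add: C_def)
  then have "nrm w \<le> K / (1 - \<eta>)"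
  proof (cases "nrm w = 0")
    case True
    then show ?thesis using K \<eta> by simp
  next
    case False
    then have "0 < nrm w" using nrm_nonneg[OF w] by simp
    then show ?thesis
      using \<open>(nrm w)\<^sup>2 \<le> nrm w * (K / (1 - \<eta>))\<close> unfolding power2_eq_square by (rule mult_left_le_imp_le[rotated])
  qed
  then show ?thesis by (simp add: w_def X_def)
qed

lemma openin_coordinate_ball: "openin (mtop M) {q \<in> cdom M i. cmap M i q \<in> ball x0 r}"
proof -
  have "openin (subtopology (mtop M) (cdom M i)) {q \<in> topspace (subtopology (mtop M) (cdom M i)). cmap M i q \<in> ball x0 r}"
    by (rule openin_continuous_map_preimage[OF continuous_map_cmap[OF i]]) simp
  then show ?thesis
    unfolding topspace_cdom[OF i] using chart_domain[OF i] openin_trans_full by blast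
qed

text \<open>A curve too short to leave the coordinate ball is at least as long as its coordinate displacement.\<close>

lemma joinable_lower:
  assumes j: "joinable (\<psi> x) q K" and x: "x \<in> model M" "dist x0 x \<le> r / 2"
    and K: "0 \<le> K" "K < (1 - \<eta>) * m * (r / 2)"
  shows "q \<in> cdom M i" "cmap M i q \<in> B" "nrm (cmap M i q - x) \<le> K / (1 - \<eta>)"
proof -
  have xB: "x \<in> B" using x r by simp
  obtain c S where c: "piecewise_C1_on M 0 1 c S" "\<And>t. t \<in> {0<..<1} - S \<Longrightarrow> speed_within M UNIV c t \<le> K"
    and c01: "c 0 = \<psi> x" "c 1 = q"
    using j unfolding joinable_def speed_curve_def by blast
  have c0: "c 0 \<in> cdom M i" "cmap M i (c 0) = x" using \<psi>[OF xB] c01 by simp_all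
  note cc = piecewise_C1_onD(2)[OF c(1)]
  define V where "V = {q \<in> cdom M i. cmap M i q \<in> ball x0 r}"
  have V: "openin (mtop M) V" unfolding V_def by (rule openin_coordinate_ball)
  \<comment> \<open>Compactness and the Hausdorff property make the image of the closed coordinate
    ball closed in the manifold, so a limit of curve points in the ball is still in the chart
    domain.\<close>
  have "compact B" using closed_subspace[OF subspace_model] by (simp add: closed_Int_compact compact_Int_closed)
  then have "compactin (top_of_set (cmap M i ` cdom M i)) B" using ball by (simp add: compactin_subtopology)
  then have "compactin (mtop M) (\<psi> ` B)" by (rule image_compactin[OF _ continuous_map_inv_cmap[OF i]])
  then have F: "closedin (mtop M) (\<psi> ` B)" by (rule compactin_imp_closedin[OF Hausdorff])
  have VF: "V \<subseteq> \<psi> ` B"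
  proof
    fix q assume "q \<in> V"
    then have "q = \<psi> (cmap M i q)" "cmap M i q \<in> B" using \<psi>_cmap cmap_in_model[OF i] by (auto simp: V_def)
    then show "q \<in> \<psi> ` B" by blast
  qed
  have FB: "q \<in> cdom M i \<and> cmap M i q \<in> B" if "q \<in> \<psi> ` B" for q using that \<psi> by auto
  have stay: "c \<tau> \<in> V" if \<tau>: "0 \<le> \<tau>" "\<tau> \<le> 1" and F\<tau>: "\<And>t. t \<in> {0..\<tau>} \<Longrightarrow> c t \<in> \<psi> ` B" for \<tau>
  proof -
    let ?y = "cmap M i (c \<tau>)"
    have dl: "nrm (?y - x) \<le> K / (1 - \<eta>)"
      using displacement_le[OF c \<tau> FB[OF F\<tau>] K(1)] c0(2) by simp
    have y: "c \<tau> \<in> cdom M i" "?y \<in> B" using FB[OF F\<tau>[of \<tau>]] \<tau> by auto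
    \<comment> \<open>The bound on \<open>K\<close> is made for this estimate: a displacement below
      r / 2, starting within r / 2 of the centre, stays in the open ball of radius r.\<close>
    have "m * norm (?y - x) \<le> K / (1 - \<eta>)"
      using m_le[of "?y - x"] dl y(2) x(1) subspace_model by (simp add: nrm_def subspace_diff)
    also have "\<dots> < m * (r / 2)" using K(2) \<eta> by (simp add: field_simps)
    finally have "dist x ?y < r / 2" using m by (simp add: dist_norm norm_minus_commute)
    then have "dist x0 ?y < r" using x(2) dist_triangle[of x0 ?y x] by simp
    then show ?thesis using y by (simp add: V_def)
  qed
  have all: "c t \<in> V" if t: "t \<in> {0..1}" for t
  proof (rule ccontr)
    assume not: "c t \<notin> V"
    \<comment> \<open>If the curve left the open ball, there would be a first parameter
      \<open>\<tau>\<close> outside. Up to and including \<open>\<tau>\<close> the curve lies in the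
      closed image of \<open>B\<close>, and \<open>stay\<close> then puts it into the open ball at
      \<open>\<tau>\<close> as well.\<close>
    let ?N = "{s \<in> {0..1}. c s \<notin> V}"
    have "openin (top_of_set {0..1}) {s \<in> {0..1}. c s \<in> V}"
      using openin_continuous_map_preimage[OF cc V] by simp
    then have "closedin (top_of_set {0..1}) ({0..1} - {s \<in> {0..1}. c s \<in> V})"
      unfolding openin_closedin_eq topspace_euclidean_subtopology by (rule conjunct2)
    also have "{0..1} - {s \<in> {0..1}. c s \<in> V} = ?N" by auto
    finally have "compact ?N" by (rule closedin_compact[OF compact_Icc])
    moreover have "?N \<noteq> {}" using t not by blast
    ultimately have "\<exists>\<tau>\<in>?N. \<forall>s\<in>?N. \<tau> \<le> s" by (rule compact_attains_inf)
    then obtain \<tau> where \<tau>: "\<tau> \<in> ?N" "\<And>s. s \<in> ?N \<Longrightarrow> \<tau> \<le> s" by blast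
    have \<tau>01: "0 \<le> \<tau>" "\<tau> \<le> 1" "c \<tau> \<notin> V" using \<tau>(1) by auto
    have before: "c s \<in> V" if "s \<in> {0..<\<tau>}" for s using \<tau>(2)[of s] that \<tau>01 by force
    have "dist x0 x < r" using x(2) r by simp
    then have "c 0 \<in> V" using c0 by (simp add: V_def)
    then have \<tau>0: "0 < \<tau>" using \<tau>01 by (cases "\<tau> = 0") auto
    have "closedin (top_of_set {0..1}) {s \<in> {0..1}. c s \<in> \<psi> ` B}"
      using closedin_continuous_map_preimage[OF cc F] by simp
    then have cl: "closed {s \<in> {0..1}. c s \<in> \<psi> ` B}" using closedin_closed_eq by blast
    have "{0..<\<tau>} \<subseteq> {s \<in> {0..1}. c s \<in> \<psi> ` B}" using before VF \<tau>01 by auto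
    then have "closure {0..<\<tau>} \<subseteq> {s \<in> {0..1}. c s \<in> \<psi> ` B}" by (rule closure_minimal[OF _ cl])
    then have "c s \<in> \<psi> ` B" if "s \<in> {0..\<tau>}" for s using that \<tau>0 by auto
    then show False using stay[OF \<tau>01(1,2)] \<tau>01(3) by blast
  qed
  have inB: "c t \<in> cdom M i \<and> cmap M i (c t) \<in> B" if "t \<in> {0..1}" for t using FB all[OF that] VF by blast
  show "q \<in> cdom M i" "cmap M i q \<in> B" using inB[of 1] c01 by auto
  show "nrm (cmap M i q - x) \<le> K / (1 - \<eta>)"
    using displacement_le[OF c zero_le_one order_refl inB K(1)] c0(2) c01(2) by simp
qed

end

lemma (in riemannian_manifold) ex_comparison_chart:
  assumes "p \<in> topspace (mtop M)" "0 < \<eta>" "\<eta> < 1"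
  obtains i r m where "comparison_chart M i p \<eta> r m"
proof -
  obtain i where i: "i \<in> charts M" "p \<in> cdom M i" using ex_chart[OF assms(1)] by blast
  obtain r m where rm: "r > 0" "m > 0" "cball (cmap M i p) r \<inter> model M \<subseteq> cmap M i ` cdom M i"
    "\<And>v. v \<in> model M \<Longrightarrow> m * norm v \<le> sqrt (tensor M i (cmap M i p) v v)"
    "\<And>x v. \<lbrakk>x \<in> cball (cmap M i p) r; x \<in> model M; v \<in> model M\<rbrakk> \<Longrightarrow>
       (1 - \<eta>) * sqrt (tensor M i (cmap M i p) v v) \<le> sqrt (tensor M i x v v)"
    "\<And>x v. \<lbrakk>x \<in> cball (cmap M i p) r; x \<in> model M; v \<in> model M\<rbrakk> \<Longrightarrow>
       sqrt (tensor M i x v v) \<le> (1 + \<eta>) * sqrt (tensor M i (cmap M i p) v v)"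
    using tensor_comparison[OF i(1) imageI[OF i(2)] assms(2,3)] by blast
  have "comparison_chart M i p \<eta> r m"
    by unfold_locales (fact i rm assms)+
  then show ?thesis by (rule that)
qed

lemma (in comparison_chart) joinable_coordinate_ball:
  assumes "q \<in> cdom M i" "cmap M i q \<in> ball x0 r"
  shows "\<exists>K. joinable p q K"
proof -
  have "cmap M i q \<in> B" "x0 \<in> B" using assms r cmap_in_model[OF i] p by auto
  then show ?thesis using joinable_segment[of x0 "cmap M i q"] \<psi>_cmap p assms(1) by metis
qed

section \<open>The distance on a connected manifold\<close>

locale connected_riemannian_manifold = riemannian_manifold M for M :: "('i, 'm, 'a::euclidean_space) riemannian" +
  assumes connected: "connected_space (mtop M)"
begin

lemma ex_joinable_nbhd:
  assumes "p \<in> topspace (mtop M)"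
  shows "\<exists>U. openin (mtop M) U \<and> p \<in> U \<and> (\<forall>q\<in>U. \<exists>K. joinable p q K)"
proof -
  obtain i r m where "comparison_chart M i p (1/2) r m"
    using ex_comparison_chart[OF assms, of "1/2"] by auto
  then interpret comparison_chart M i p "1/2" r m .
  show ?thesis
    using openin_coordinate_ball joinable_coordinate_ball p r
    by (intro exI[of _ "{q \<in> cdom M i. cmap M i q \<in> ball (cmap M i p) r}"]) auto
qed

text \<open>Raising both bounds to at least 1 provides the positivity that concatenation asks
  for.\<close>

lemma joinable_trans': "joinable p q K \<Longrightarrow> joinable q r K' \<Longrightarrow> \<exists>K. joinable p r K"
  using joinable_trans[of p q "max K 1" r "max K' 1"] joinable_mono[of p q K "max K 1"] joinable_mono[of q r K' "max K' 1"]
  by fastforce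

text \<open>The points that can be joined to p form an open set with open complement, since every
  point has a neighbourhood whose points can be joined to it.\<close>

lemma ex_joinable:
  assumes pq: "p \<in> topspace (mtop M)" "q \<in> topspace (mtop M)"
  shows "\<exists>K. joinable p q K"
proof -
  define C where "C = {q \<in> topspace (mtop M). \<exists>K. joinable p q K}"
  have "openin (mtop M) C"
  proof (subst openin_subopen, intro ballI)
    fix q assume q: "q \<in> C"
    obtain U where U: "openin (mtop M) U" "q \<in> U" "\<And>q'. q' \<in> U \<Longrightarrow> \<exists>K. joinable q q' K"
      using ex_joinable_nbhd[of q] q unfolding C_def by blast
    have "U \<subseteq> C"
      using U(3) q openin_subset[OF U(1)] joinable_trans' unfolding C_def by blast
    then show "\<exists>T. openin (mtop M) T \<and> q \<in> T \<and> T \<subseteq> C" using U by blast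
  qed
  moreover have "openin (mtop M) (topspace (mtop M) - C)"
  proof (subst openin_subopen, intro ballI)
    fix q assume q: "q \<in> topspace (mtop M) - C"
    obtain U where U: "openin (mtop M) U" "q \<in> U" "\<And>q'. q' \<in> U \<Longrightarrow> \<exists>K. joinable q q' K"
      using ex_joinable_nbhd[of q] q by blast
    have "U \<subseteq> topspace (mtop M) - C"
    proof
      fix q' assume q': "q' \<in> U"
      have "q' \<notin> C"
      proof
        assume "q' \<in> C"
        then obtain K where "joinable p q' K" unfolding C_def by blast
        moreover obtain K' where "joinable q' q K'" using U(3)[OF q'] joinable_sym by blast
        ultimately have "q \<in> C" using joinable_trans' q unfolding C_def by blast
        then show False using q by blast
      qed
      then show "q' \<in> topspace (mtop M) - C" using openin_subset[OF U(1)] q' by blast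
    qed
    then show "\<exists>T. openin (mtop M) T \<and> q \<in> T \<and> T \<subseteq> topspace (mtop M) - C" using U by blast
  qed
  then have "closedin (mtop M) C" by (simp add: closedin_def C_def)
  moreover have "p \<in> C" using joinable_refl[OF pq(1)] pq(1) by (auto simp: C_def)
  ultimately have "C = topspace (mtop M)"
    using connected unfolding connected_space_clopen_in by blast
  then show ?thesis using pq(2) unfolding C_def by blast
qed

lemma dist_less_joinable:
  assumes "p \<in> topspace (mtop M)" "q \<in> topspace (mtop M)" "riemannian_dist M p q < K"
  shows "joinable p q K"
  using ex_joinable[OF assms(1,2)] dist_less_imp_joinable assms(3) by blast

lemma riemannian_dist_nonneg:
  assumes "p \<in> topspace (mtop M)" "q \<in> topspace (mtop M)"
  shows "0 \<le> riemannian_dist M p q"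
proof -
  have "lengths p q \<noteq> {}" using ex_joinable[OF assms] joinable_imp_piecewise by blast
  then show ?thesis
    unfolding riemannian_dist_def
    by (rule cInf_greatest) (auto simp: piecewise_C1_curve_iff intro: curve_length_nonneg)
qed

lemma riemannian_dist_sym_le:
  assumes "p \<in> topspace (mtop M)" "q \<in> topspace (mtop M)"
  shows "riemannian_dist M q p \<le> riemannian_dist M p q"
proof (rule field_le_epsilon)
  fix e :: real assume "0 < e"
  then have "joinable p q (riemannian_dist M p q + e)" by (intro dist_less_joinable assms) simp
  then show "riemannian_dist M q p \<le> riemannian_dist M p q + e"
    by (rule joinable_imp_dist_le[OF joinable_sym])
qed

sublocale pseudometric "topspace (mtop M)" "riemannian_dist M"
proof
  fix p q r assume p: "p \<in> topspace (mtop M)"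
  show "riemannian_dist M p p = 0"
    using joinable_imp_dist_le[OF joinable_refl[OF p]] riemannian_dist_nonneg[OF p p] by simp
  assume q: "q \<in> topspace (mtop M)"
  show "riemannian_dist M p q = riemannian_dist M q p"
    using riemannian_dist_sym_le p q by (simp add: antisym)
  assume r: "r \<in> topspace (mtop M)"
  show "riemannian_dist M p r \<le> riemannian_dist M p q + riemannian_dist M q r"
  proof (rule field_le_epsilon)
    fix e :: real assume e: "0 < e"
    have "joinable p q (riemannian_dist M p q + e / 2)" "joinable q r (riemannian_dist M q r + e / 2)"
      using e by (auto intro!: dist_less_joinable p q r)
    then have "joinable p r ((riemannian_dist M p q + e / 2) + (riemannian_dist M q r + e / 2))"
      by (rule joinable_trans) (use riemannian_dist_nonneg[OF p q] riemannian_dist_nonneg[OF q r] e in auto)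
    from joinable_imp_dist_le[OF this]
    show "riemannian_dist M p r \<le> riemannian_dist M p q + riemannian_dist M q r + e" by simp
  qed
qed

text \<open>Near p the distance lies between 1 - \<open>\<eta>\<close> and 1 + \<open>\<eta>\<close>
  times the norm of the coordinate difference. That norm satisfies the inequality exactly, and the
  two comparisons cost the square of (1 + \<open>\<eta>\<close>) / (1 -
  \<open>\<eta>\<close>).\<close>

lemma locally_quadrilateral: "locally_quadrilateral (topspace (mtop M)) (riemannian_dist M)"
  unfolding locally_quadrilateral_def
proof (intro ballI allI impI)
  fix p :: 'm and \<theta> :: real
  assume p: "p \<in> topspace (mtop M)" and \<theta>: "1 < \<theta>"
  define s where "s = sqrt \<theta>"
  \<comment> \<open>This solves (1 + \<open>\<eta>\<close>) / (1 - \<open>\<eta>\<close>) = s, so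
    the loss in the squares is exactly \<open>\<theta>\<close>.\<close>
  define \<eta> where "\<eta> = (s - 1) / (s + 1)"
  have s: "s > 1" "s\<^sup>2 = \<theta>" using \<theta> by (simp_all add: s_def)
  then have \<eta>: "0 < \<eta>" "\<eta> < 1" by (simp_all add: \<eta>_def)
  have "1 + \<eta> = s * (1 - \<eta>)" using s(1) by (simp add: \<eta>_def field_simps)
  then have \<eta>\<theta>: "(1 + \<eta>)\<^sup>2 = \<theta> * (1 - \<eta>)\<^sup>2" by (simp add: power_mult_distrib s(2))
  obtain i r m where "comparison_chart M i p \<eta> r m"
    using ex_comparison_chart[OF p \<eta>] by blast
  then interpret C: comparison_chart M i p \<eta> r m .
  let ?x = "cmap M i" and ?d = "riemannian_dist M"
  let ?X = "topspace (mtop M)"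
  \<comment> \<open>Half of the threshold in \<open>joinable_lower\<close>, since two points within
    \<open>\<delta>\<close> of p are less than 2 \<open>\<delta>\<close> apart.\<close>
  define \<delta> where "\<delta> = (1 - \<eta>) * m * (r / 2) / 2"
  have \<delta>: "\<delta> > 0" using \<eta> C.m C.r by (simp add: \<delta>_def)
  have \<delta>2: "(1 - \<eta>) * m * (r / 2) = 2 * \<delta>" by (simp add: \<delta>_def)
  \<comment> \<open>Such points have coordinates within r / 4 of the centre, so each may serve as a
    starting point for \<open>joinable_lower\<close>.\<close>
  have near: "q \<in> cdom M i \<and> ?x q \<in> C.B \<and> dist (?x p) (?x q) \<le> r / 2" if q: "q \<in> ?X" "?d p q < \<delta>" for q
  proof -
    have j: "joinable (C.\<psi> (?x p)) q \<delta>" using dist_less_joinable[OF p q] C.\<psi>_cmap[OF C.p] by simp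
    have "\<delta> < (1 - \<eta>) * m * (r / 2)" unfolding \<delta>2 using \<delta> by simp
    note L = C.joinable_lower[OF j cmap_in_model[OF C.i C.p] _ less_imp_le[OF \<delta>] this]
    have d0: "dist (?x p) (?x p) \<le> r / 2" using C.r by simp
    have "?x q - ?x p \<in> model M" using cmap_in_model[OF C.i] L(1)[OF d0] C.p subspace_model by (simp add: subspace_diff)
    then have "m * norm (?x q - ?x p) \<le> \<delta> / (1 - \<eta>)" using C.m_le L(3)[OF d0] unfolding C.nrm_def by (meson order_trans)
    also have "\<dots> = m * (r / 4)" using \<eta> by (simp add: \<delta>_def field_simps)
    finally have "norm (?x q - ?x p) \<le> r / 4" using C.m by simp
    then show ?thesis using L(1,2)[OF d0] C.r by (simp add: dist_norm norm_minus_commute)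
  qed
  have cmp: "(1 - \<eta>) * C.nrm (?x q - ?x q') \<le> ?d q q'" "?d q q' \<le> (1 + \<eta>) * C.nrm (?x q - ?x q')"
    if q: "q \<in> ?X" "?d p q < \<delta>" and q': "q' \<in> ?X" "?d p q' < \<delta>" for q q'
  proof -
    note n = near[OF q] and n' = near[OF q']
    have e: "C.\<psi> (?x q) = q" "C.\<psi> (?x q') = q'" using C.\<psi>_cmap n n' by auto
    have com: "C.nrm (?x q' - ?x q) = C.nrm (?x q - ?x q')" using n n' C.nrm_diff_commute by simp
    show "?d q q' \<le> (1 + \<eta>) * C.nrm (?x q - ?x q')"
      using joinable_imp_dist_le[OF C.joinable_segment[of "?x q" "?x q'"]] n n' by (simp add: e com)
    have "?d q q' < 2 * \<delta>" using d_triangle[OF q(1) p q'(1)] d_sym[OF p q(1)] q q' by simp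
    \<comment> \<open>The distance need not be attained by a curve; the estimate is proved for every
      K slightly above it, and density of the reals gives the limit.\<close>
    have "(1 - \<eta>) * C.nrm (?x q - ?x q') \<le> K" if K: "?d q q' < K" "K < 2 * \<delta>" for K
    proof -
      have j: "joinable (C.\<psi> (?x q)) q' K" using dist_less_joinable[OF q(1) q'(1) K(1)] e by simp
      have "0 \<le> K" using riemannian_dist_nonneg[OF q(1) q'(1)] K(1) by simp
      moreover have "K < (1 - \<eta>) * m * (r / 2)" unfolding \<delta>2 by (rule K(2))
      ultimately have "C.nrm (?x q' - ?x q) \<le> K / (1 - \<eta>)"
        using C.joinable_lower(3)[OF j] n by simp
      then show ?thesis using \<eta> com by (simp add: field_simps)
    qed
    then show "(1 - \<eta>) * C.nrm (?x q - ?x q') \<le> ?d q q'"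
      using dense_ge_bounded[OF \<open>?d q q' < 2 * \<delta>\<close>] by blast
  qed
  show "\<exists>\<delta>>0. \<forall>a\<in>?X. \<forall>b\<in>?X. \<forall>c\<in>?X. \<forall>e\<in>?X. ?d p a < \<delta> \<and> ?d p b < \<delta> \<and> ?d p c < \<delta> \<and> ?d p e < \<delta> \<longrightarrow>
        (?d a c)\<^sup>2 + (?d b e)\<^sup>2 \<le> \<theta> * ((?d a b)\<^sup>2 + (?d b c)\<^sup>2 + (?d c e)\<^sup>2 + (?d e a)\<^sup>2)"
  proof (rule exI[of _ \<delta>], intro conjI \<delta> ballI impI)
    fix a b c e assume X: "a \<in> ?X" "b \<in> ?X" "c \<in> ?X" "e \<in> ?X"
      and "?d p a < \<delta> \<and> ?d p b < \<delta> \<and> ?d p c < \<delta> \<and> ?d p e < \<delta>"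
    then have D: "?d p a < \<delta>" "?d p b < \<delta>" "?d p c < \<delta>" "?d p e < \<delta>" by auto
    let ?T = "\<lambda>q q'. (C.nrm (?x q - ?x q'))\<^sup>2"
    have mod: "?x a \<in> model M" "?x b \<in> model M" "?x c \<in> model M" "?x e \<in> model M"
      using near X D by blast+
    have T: "?T q q' = tensor M i (?x p) (?x q - ?x q') (?x q - ?x q')" if "?x q \<in> model M" "?x q' \<in> model M" for q q'
      using tensor_nonneg[OF C.i C.x0, of "?x q - ?x q'"] that subspace_model by (simp add: C.nrm_def subspace_diff)
    have quad: "?T a c + ?T b e \<le> ?T a b + ?T b c + ?T c e + ?T e a"
      using tensor_quadrilateral[OF C.i C.x0 mod] mod by (simp add: T)
    have up: "(?d q q')\<^sup>2 \<le> (1 + \<eta>)\<^sup>2 * ?T q q'" if "q \<in> ?X" "?d p q < \<delta>" "q' \<in> ?X" "?d p q' < \<delta>" for q q'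
      using power_mono[OF cmp(2)[OF that] riemannian_dist_nonneg[OF that(1,3)], of 2] by (simp add: power_mult_distrib)
    have lo: "(1 - \<eta>)\<^sup>2 * ?T q q' \<le> (?d q q')\<^sup>2" if q: "q \<in> ?X" "?d p q < \<delta>" "q' \<in> ?X" "?d p q' < \<delta>" for q q'
    proof -
      have "?x q - ?x q' \<in> model M" using near[OF q(1,2)] near[OF q(3,4)] subspace_model by (simp add: subspace_diff)
      then have "0 \<le> (1 - \<eta>) * C.nrm (?x q - ?x q')" using C.nrm_nonneg \<eta> by simp
      from power_mono[OF cmp(1)[OF that] this, of 2] show ?thesis by (simp add: power_mult_distrib)
    qed
    have "(?d a c)\<^sup>2 + (?d b e)\<^sup>2 \<le> (1 + \<eta>)\<^sup>2 * (?T a c + ?T b e)"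
      using up[OF X(1) D(1) X(3) D(3)] up[OF X(2) D(2) X(4) D(4)] by (simp add: distrib_left)
    also have "\<dots> \<le> (1 + \<eta>)\<^sup>2 * (?T a b + ?T b c + ?T c e + ?T e a)"
      using quad by (rule mult_left_mono) simp
    also have "\<dots> = \<theta> * ((1 - \<eta>)\<^sup>2 * ?T a b + (1 - \<eta>)\<^sup>2 * ?T b c + (1 - \<eta>)\<^sup>2 * ?T c e + (1 - \<eta>)\<^sup>2 * ?T e a)"
      unfolding \<eta>\<theta> by (simp only: distrib_left mult.assoc)
    also have "\<dots> \<le> \<theta> * ((?d a b)\<^sup>2 + (?d b c)\<^sup>2 + (?d c e)\<^sup>2 + (?d e a)\<^sup>2)"
      using \<theta> by (intro mult_left_mono add_mono lo X D) auto
    finally show "(?d a c)\<^sup>2 + (?d b e)\<^sup>2 \<le> \<theta> * ((?d a b)\<^sup>2 + (?d b c)\<^sup>2 + (?d c e)\<^sup>2 + (?d e a)\<^sup>2)" .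
  qed
qed

end

subsection \<open>The Riemannian product\<close>

lemma C1_curve_on_product:
  fixes M\<^sub>1 :: "('i, 'm, 'a::euclidean_space) riemannian" and M\<^sub>2 :: "('j, 'n, 'b::euclidean_space) riemannian"
  assumes "C1_curve_on M\<^sub>1 T c\<^sub>1" "C1_curve_on M\<^sub>2 T c\<^sub>2"
  shows "C1_curve_on (riemannian_product M\<^sub>1 M\<^sub>2) T (\<lambda>t. (c\<^sub>1 t, c\<^sub>2 t))"
  unfolding C1_curve_on_def
proof
  let ?P = "riemannian_product M\<^sub>1 M\<^sub>2"
  fix k assume "k \<in> charts ?P"
  then obtain i j where k: "k = (i, j)" and ij: "i \<in> charts M\<^sub>1" "j \<in> charts M\<^sub>2" by (auto simp: riemannian_product_def)
  obtain D1 where D1: "continuous_on {t \<in> T. c\<^sub>1 t \<in> cdom M\<^sub>1 i} D1"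
    "\<And>t. t \<in> T \<Longrightarrow> c\<^sub>1 t \<in> cdom M\<^sub>1 i \<Longrightarrow> (cmap M\<^sub>1 i \<circ> c\<^sub>1 has_vector_derivative D1 t) (at t within T)"
    using assms(1) ij unfolding C1_curve_on_def by blast
  obtain D2 where D2: "continuous_on {t \<in> T. c\<^sub>2 t \<in> cdom M\<^sub>2 j} D2"
    "\<And>t. t \<in> T \<Longrightarrow> c\<^sub>2 t \<in> cdom M\<^sub>2 j \<Longrightarrow> (cmap M\<^sub>2 j \<circ> c\<^sub>2 has_vector_derivative D2 t) (at t within T)"
    using assms(2) ij unfolding C1_curve_on_def by blast
  have dom: "(c\<^sub>1 t, c\<^sub>2 t) \<in> cdom ?P k \<longleftrightarrow> c\<^sub>1 t \<in> cdom M\<^sub>1 i \<and> c\<^sub>2 t \<in> cdom M\<^sub>2 j" for t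
    by (simp add: k riemannian_product_def)
  have "continuous_on {t \<in> T. (c\<^sub>1 t, c\<^sub>2 t) \<in> cdom ?P k} (\<lambda>t. (D1 t, D2 t))"
    by (intro continuous_on_Pair continuous_on_subset[OF D1(1)] continuous_on_subset[OF D2(1)]) (auto simp: dom)
  moreover have "cmap ?P k \<circ> (\<lambda>t. (c\<^sub>1 t, c\<^sub>2 t)) = (\<lambda>t. ((cmap M\<^sub>1 i \<circ> c\<^sub>1) t, (cmap M\<^sub>2 j \<circ> c\<^sub>2) t))"
    by (auto simp: k riemannian_product_def)
  then have "(cmap ?P k \<circ> (\<lambda>t. (c\<^sub>1 t, c\<^sub>2 t)) has_vector_derivative (D1 t, D2 t)) (at t within T)"
    if "t \<in> T" "(c\<^sub>1 t, c\<^sub>2 t) \<in> cdom ?P k" for t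
    using D1(2) D2(2) that by (simp only: dom has_vector_derivative_Pair)
  ultimately show "\<exists>D. continuous_on {t \<in> T. (c\<^sub>1 t, c\<^sub>2 t) \<in> cdom ?P k} D \<and>
        (\<forall>t\<in>T. (c\<^sub>1 t, c\<^sub>2 t) \<in> cdom ?P k \<longrightarrow>
          (cmap ?P k \<circ> (\<lambda>t. (c\<^sub>1 t, c\<^sub>2 t)) has_vector_derivative D t) (at t within T))"
    by (intro exI[of _ "\<lambda>t. (D1 t, D2 t)"]) simp
qed

text \<open>To see the first component in chart i, a chart j around the second component is added.
  As j depends on the parameter, the velocity is identified, and its continuity shown, only
  locally.\<close>

lemma C1_curve_on_fst:
  fixes M\<^sub>1 :: "('i, 'm, 'a::euclidean_space) riemannian" and M\<^sub>2 :: "('j, 'n, 'b::euclidean_space) riemannian"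
  assumes "smooth_manifold M\<^sub>1" "smooth_manifold M\<^sub>2"
    and cont: "continuous_map (top_of_set {u..v}) (mtop (riemannian_product M\<^sub>1 M\<^sub>2)) c"
    and C1: "C1_curve_on (riemannian_product M\<^sub>1 M\<^sub>2) {u..v} c" and uv: "u < v"
  shows "C1_curve_on M\<^sub>1 {u..v} (fst \<circ> c)"
  unfolding C1_curve_on_def
proof
  interpret M1: smooth_manifold M\<^sub>1 by fact
  interpret M2: smooth_manifold M\<^sub>2 by fact
  let ?P = "riemannian_product M\<^sub>1 M\<^sub>2" and ?T = "{u..v}"
  fix i assume i: "i \<in> charts M\<^sub>1"
  let ?A = "{t \<in> ?T. (fst \<circ> c) t \<in> cdom M\<^sub>1 i}"
  let ?D = "\<lambda>t. vector_derivative (cmap M\<^sub>1 i \<circ> (fst \<circ> c)) (at t within ?T)"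
  have *: "\<exists>W g. open W \<and> t \<in> W \<and> continuous_on (?A \<inter> W) g \<and> (\<forall>s\<in>?A \<inter> W. ?D s = g s) \<and>
      (cmap M\<^sub>1 i \<circ> (fst \<circ> c) has_vector_derivative ?D t) (at t within ?T)" if t: "t \<in> ?A" for t
  proof -
    have tT: "t \<in> ?T" using t by blast
    have "c t \<in> topspace (mtop ?P)" using continuous_map_image_subset_topspace[OF cont] tT by auto
    then have "snd (c t) \<in> topspace (mtop M\<^sub>2)" by (auto simp: riemannian_product_def)
    then obtain j where j: "j \<in> charts M\<^sub>2" "snd (c t) \<in> cdom M\<^sub>2 j" using M2.ex_chart by blast
    have "(i, j) \<in> charts ?P" using i j by (simp add: riemannian_product_def)
    then obtain D where D: "continuous_on {s \<in> ?T. c s \<in> cdom ?P (i, j)} D"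
      "\<And>s. s \<in> ?T \<Longrightarrow> c s \<in> cdom ?P (i, j) \<Longrightarrow> (cmap ?P (i, j) \<circ> c has_vector_derivative D s) (at s within ?T)"
      using C1 unfolding C1_curve_on_def by blast
    have dom: "cdom ?P (i, j) = cdom M\<^sub>1 i \<times> cdom M\<^sub>2 j" by (simp add: riemannian_product_def)
    have "openin (mtop ?P) (cdom ?P (i, j))"
      unfolding dom using M1.chart_domain[OF i] M2.chart_domain[OF j(1)]
      by (simp add: riemannian_product_def openin_prod_Times_iff)
    moreover have "c t \<in> cdom ?P (i, j)" using t j unfolding dom by (simp add: mem_Times_iff)
    ultimately obtain W where W: "open W" "t \<in> W" "\<And>s. s \<in> ?T \<inter> W \<longleftrightarrow> s \<in> ?T \<and> c s \<in> cdom ?P (i, j)"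
      using continuous_map_preimage_nhd[OF cont _ tT] by blast
    have in1: "c s \<in> cdom ?P (i, j)" if "s \<in> ?T" "s \<in> W" for s using W(3)[of s] that by simp
    have d: "(cmap M\<^sub>1 i \<circ> (fst \<circ> c) has_vector_derivative fst (D s)) (at s within ?T)" if "s \<in> ?T" "s \<in> W" for s
    proof -
      have "((\<lambda>t. fst ((cmap ?P (i, j) \<circ> c) t)) has_vector_derivative fst (D s)) (at s within ?T)"
        by (rule bounded_linear.has_vector_derivative[OF bounded_linear_fst D(2)[OF that(1) in1[OF that]]])
      moreover have "(\<lambda>t. fst ((cmap ?P (i, j) \<circ> c) t)) = cmap M\<^sub>1 i \<circ> (fst \<circ> c)"
        by (auto simp: riemannian_product_def)
      ultimately show ?thesis by simp
    qed
    have e: "?D s = fst (D s)" if "s \<in> ?T" "s \<in> W" for s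
      using vector_derivative_within[OF at_within_Icc_neq_bot[OF uv that(1)] d[OF that]] .
    have "continuous_on (?A \<inter> W) (\<lambda>s. fst (D s))"
      by (intro continuous_on_fst continuous_on_subset[OF D(1)]) (use in1 in auto)
    moreover have "(cmap M\<^sub>1 i \<circ> (fst \<circ> c) has_vector_derivative ?D t) (at t within ?T)"
      unfolding e[OF tT W(2)] by (rule d[OF tT W(2)])
    ultimately show ?thesis using W(1,2) e by (intro exI[of _ W] exI[of _ "\<lambda>s. fst (D s)"]) auto
  qed
  have "continuous_on ?A ?D" by (rule continuous_on_local) (use * in blast)
  moreover have "(cmap M\<^sub>1 i \<circ> (fst \<circ> c) has_vector_derivative ?D t) (at t within ?T)" if "t \<in> ?A" for t
    using *[OF that] by blast
  ultimately show "\<exists>D. continuous_on ?A D \<and>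
      (\<forall>t\<in>?T. (fst \<circ> c) t \<in> cdom M\<^sub>1 i \<longrightarrow> (cmap M\<^sub>1 i \<circ> (fst \<circ> c) has_vector_derivative D t) (at t within ?T))"
    by (intro exI[of _ ?D]) simp
qed

text \<open>Exchanging the factors reduces the second projection to the first.\<close>

lemma C1_curve_on_swap:
  fixes M\<^sub>1 :: "('i, 'm, 'a::euclidean_space) riemannian" and M\<^sub>2 :: "('j, 'n, 'b::euclidean_space) riemannian"
  assumes "C1_curve_on (riemannian_product M\<^sub>1 M\<^sub>2) T c"
  shows "C1_curve_on (riemannian_product M\<^sub>2 M\<^sub>1) T (prod.swap \<circ> c)"
  unfolding C1_curve_on_def
proof
  let ?P = "riemannian_product M\<^sub>1 M\<^sub>2" and ?Q = "riemannian_product M\<^sub>2 M\<^sub>1"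
  fix k assume "k \<in> charts ?Q"
  then obtain i j where k: "k = (j, i)" and ij: "(i, j) \<in> charts ?P" by (auto simp: riemannian_product_def)
  obtain D where D: "continuous_on {s \<in> T. c s \<in> cdom ?P (i, j)} D"
      "\<And>s. s \<in> T \<Longrightarrow> c s \<in> cdom ?P (i, j) \<Longrightarrow> (cmap ?P (i, j) \<circ> c has_vector_derivative D s) (at s within T)"
    using assms ij unfolding C1_curve_on_def by blast
  have dom: "(prod.swap \<circ> c) t \<in> cdom ?Q k \<longleftrightarrow> c t \<in> cdom ?P (i, j)" for t
    by (cases "c t") (auto simp: k riemannian_product_def)
  have e: "cmap ?Q k \<circ> (prod.swap \<circ> c) = (\<lambda>t. prod.swap ((cmap ?P (i, j) \<circ> c) t))"
    by (auto simp: k riemannian_product_def fun_eq_iff prod_eq_iff)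
  have bl: "bounded_linear (prod.swap :: 'a \<times> 'b \<Rightarrow> 'b \<times> 'a)"
    unfolding prod.swap_def by (intro bounded_linear_Pair bounded_linear_fst bounded_linear_snd)
  show "\<exists>D. continuous_on {t \<in> T. (prod.swap \<circ> c) t \<in> cdom ?Q k} D \<and>
        (\<forall>t\<in>T. (prod.swap \<circ> c) t \<in> cdom ?Q k \<longrightarrow> (cmap ?Q k \<circ> (prod.swap \<circ> c) has_vector_derivative D t) (at t within T))"
  proof (intro exI[of _ "\<lambda>t. prod.swap (D t)"] conjI ballI impI)
    show "continuous_on {t \<in> T. (prod.swap \<circ> c) t \<in> cdom ?Q k} (\<lambda>t. prod.swap (D t))"
      unfolding dom by (rule bounded_linear.continuous_on[OF bl D(1)])
    show "(cmap ?Q k \<circ> (prod.swap \<circ> c) has_vector_derivative prod.swap (D t)) (at t within T)"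
      if "t \<in> T" "(prod.swap \<circ> c) t \<in> cdom ?Q k" for t
      unfolding e using that by (intro bounded_linear.has_vector_derivative[OF bl D(2)]) (simp_all only: dom)
  qed
qed

lemma C1_curve_on_snd:
  fixes M\<^sub>1 :: "('i, 'm, 'a::euclidean_space) riemannian" and M\<^sub>2 :: "('j, 'n, 'b::euclidean_space) riemannian"
  assumes "smooth_manifold M\<^sub>1" "smooth_manifold M\<^sub>2"
    and cont: "continuous_map (top_of_set {u..v}) (mtop (riemannian_product M\<^sub>1 M\<^sub>2)) c"
    and C1: "C1_curve_on (riemannian_product M\<^sub>1 M\<^sub>2) {u..v} c" and uv: "u < v"
  shows "C1_curve_on M\<^sub>2 {u..v} (snd \<circ> c)"
proof -
  have "continuous_map (mtop (riemannian_product M\<^sub>1 M\<^sub>2)) (mtop (riemannian_product M\<^sub>2 M\<^sub>1)) prod.swap"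
    unfolding prod.swap_def riemannian_product_def
    by (simp add: continuous_map_pairedI continuous_map_fst continuous_map_snd)
  from C1_curve_on_fst[OF assms(2,1) continuous_map_compose[OF cont this] C1_curve_on_swap[OF C1] uv]
  show ?thesis by (simp add: comp_def)
qed

section \<open>Lengths and distances in the product\<close>

locale riemannian_pair =
  M\<^sub>1: connected_riemannian_manifold M\<^sub>1 + M\<^sub>2: connected_riemannian_manifold M\<^sub>2
  for M\<^sub>1 :: "('i, 'm, 'a::euclidean_space) riemannian" and M\<^sub>2 :: "('j, 'n, 'b::euclidean_space) riemannian"
begin

abbreviation P where "P \<equiv> riemannian_product M\<^sub>1 M\<^sub>2"

lemma mtop_P: "mtop P = prod_topology (mtop M\<^sub>1) (mtop M\<^sub>2)"
  by (simp add: riemannian_product_def)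

lemma piecewise_C1_on_product:
  assumes "piecewise_C1_on M\<^sub>1 a b c\<^sub>1 S\<^sub>1" "piecewise_C1_on M\<^sub>2 a b c\<^sub>2 S\<^sub>2"
  shows "piecewise_C1_on P a b (\<lambda>t. (c\<^sub>1 t, c\<^sub>2 t)) (S\<^sub>1 \<union> S\<^sub>2)"
  using assms unfolding piecewise_C1_on_def
  by (auto simp: mtop_P Int_Un_distrib intro: continuous_map_pairedI C1_curve_on_product)

lemma piecewise_C1_on_projections:
  assumes c: "piecewise_C1_on P a b c S"
  shows "piecewise_C1_on M\<^sub>1 a b (fst \<circ> c) S" "piecewise_C1_on M\<^sub>2 a b (snd \<circ> c) S"
proof -
  note cont = piecewise_C1_onD(2)[OF c]
  have "continuous_map (top_of_set {a..b}) (mtop M\<^sub>1) (fst \<circ> c)" "continuous_map (top_of_set {a..b}) (mtop M\<^sub>2) (snd \<circ> c)"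
    using cont unfolding mtop_P continuous_map_componentwise_UNIV by (simp_all add: continuous_map_pairwise)
  moreover have "C1_curve_on M\<^sub>1 {u..v} (fst \<circ> c)" "C1_curve_on M\<^sub>2 {u..v} (snd \<circ> c)"
    if uv: "a \<le> u" "u < v" "v \<le> b" "{u<..<v} \<inter> S = {}" for u v
  proof -
    have "continuous_map (top_of_set {u..v}) (mtop P) c"
      by (rule continuous_map_from_subtopology_mono[OF cont]) (use uv in auto)
    note r = M\<^sub>1.smooth_manifold_axioms M\<^sub>2.smooth_manifold_axioms this piecewise_C1_onD(3)[OF c uv] uv(2)
    show "C1_curve_on M\<^sub>1 {u..v} (fst \<circ> c)" "C1_curve_on M\<^sub>2 {u..v} (snd \<circ> c)"
      by (rule C1_curve_on_fst[OF r] C1_curve_on_snd[OF r])+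
  qed
  ultimately show "piecewise_C1_on M\<^sub>1 a b (fst \<circ> c) S" "piecewise_C1_on M\<^sub>2 a b (snd \<circ> c) S"
    using piecewise_C1_onD(1)[OF c] unfolding piecewise_C1_on_def by blast+
qed

lemma speed_product:
  assumes c: "piecewise_C1_on M\<^sub>1 a b c\<^sub>1 S" "piecewise_C1_on M\<^sub>2 a b c\<^sub>2 S" and t: "t \<in> {a<..<b} - S"
  shows "speed_within P UNIV (\<lambda>t. (c\<^sub>1 t, c\<^sub>2 t)) t =
    sqrt ((speed_within M\<^sub>1 UNIV c\<^sub>1 t)\<^sup>2 + (speed_within M\<^sub>2 UNIV c\<^sub>2 t)\<^sup>2)"
proof -
  let ?c = "\<lambda>t. (c\<^sub>1 t, c\<^sub>2 t)"
  \<comment> \<open>The chart selected for the product is a pair of charts; by chart independence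
    the factor speeds may be computed in its two components.\<close>
  define k where "k = (SOME k. k \<in> charts P \<and> ?c t \<in> cdom P k)"
  have "c\<^sub>1 t \<in> topspace (mtop M\<^sub>1)" "c\<^sub>2 t \<in> topspace (mtop M\<^sub>2)"
    using continuous_map_image_subset_topspace[OF piecewise_C1_onD(2)[OF c(1)]]
      continuous_map_image_subset_topspace[OF piecewise_C1_onD(2)[OF c(2)]] t by auto
  then obtain i j where "i \<in> charts M\<^sub>1" "c\<^sub>1 t \<in> cdom M\<^sub>1 i" "j \<in> charts M\<^sub>2" "c\<^sub>2 t \<in> cdom M\<^sub>2 j"
    using M\<^sub>1.ex_chart M\<^sub>2.ex_chart by metis
  then have "(i, j) \<in> charts P \<and> ?c t \<in> cdom P (i, j)" by (simp add: riemannian_product_def)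
  then have "k \<in> charts P \<and> ?c t \<in> cdom P k" unfolding k_def by (rule someI)
  moreover obtain i j where k: "k = (i, j)" by (cases k)
  ultimately have i: "i \<in> charts M\<^sub>1" "c\<^sub>1 t \<in> cdom M\<^sub>1 i" and j: "j \<in> charts M\<^sub>2" "c\<^sub>2 t \<in> cdom M\<^sub>2 j"
    by (auto simp: riemannian_product_def)
  obtain w1 where w1: "(cmap M\<^sub>1 i \<circ> c\<^sub>1 has_vector_derivative w1) (at t)" "w1 \<in> model M\<^sub>1"
    "speed_within M\<^sub>1 UNIV c\<^sub>1 t = sqrt (tensor M\<^sub>1 i (cmap M\<^sub>1 i (c\<^sub>1 t)) w1 w1)"
    using M\<^sub>1.piecewise_C1_velocity[OF c(1) t i] by blast
  obtain w2 where w2: "(cmap M\<^sub>2 j \<circ> c\<^sub>2 has_vector_derivative w2) (at t)" "w2 \<in> model M\<^sub>2"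
    "speed_within M\<^sub>2 UNIV c\<^sub>2 t = sqrt (tensor M\<^sub>2 j (cmap M\<^sub>2 j (c\<^sub>2 t)) w2 w2)"
    using M\<^sub>2.piecewise_C1_velocity[OF c(2) t j] by blast
  have "cmap P k \<circ> ?c = (\<lambda>t. ((cmap M\<^sub>1 i \<circ> c\<^sub>1) t, (cmap M\<^sub>2 j \<circ> c\<^sub>2) t))"
    by (auto simp: k riemannian_product_def)
  then have "vector_derivative (cmap P k \<circ> ?c) (at t) = (w1, w2)"
    using has_vector_derivative_Pair[OF w1(1) w2(1)] by (intro vector_derivative_at) simp
  then have "speed_within P UNIV ?c t = sqrt (tensor P k (cmap P k (?c t)) (w1, w2) (w1, w2))"
    by (simp add: speed_within_def Let_def flip: k_def)
  also have "\<dots> = sqrt (tensor M\<^sub>1 i (cmap M\<^sub>1 i (c\<^sub>1 t)) w1 w1 + tensor M\<^sub>2 j (cmap M\<^sub>2 j (c\<^sub>2 t)) w2 w2)"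
    by (simp add: k riemannian_product_def)
  finally show ?thesis
    using M\<^sub>1.tensor_nonneg[OF i(1) imageI[OF i(2)] w1(2)] M\<^sub>2.tensor_nonneg[OF j(1) imageI[OF j(2)] w2(2)]
    by (simp add: w1(3) w2(3))
qed

text \<open>On each closed piece the factor speeds are continuous, and in its interior the product
  speed is the Euclidean norm of the pair.\<close>

lemma speed_product_integrable:
  assumes c: "piecewise_C1_on M\<^sub>1 0 1 c\<^sub>1 S" "piecewise_C1_on M\<^sub>2 0 1 c\<^sub>2 S"
  shows "speed_within P UNIV (\<lambda>t. (c\<^sub>1 t, c\<^sub>2 t)) integrable_on {0..1}"
proof (rule integrable_on_pieces[OF piecewise_C1_onD(1)[OF c(1)] zero_le_one])
  fix u v :: real assume uv: "0 \<le> u" "u < v" "v \<le> 1" "{u<..<v} \<inter> S = {}"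
  have "continuous_map (top_of_set {u..v}) (mtop M\<^sub>1) c\<^sub>1" "continuous_map (top_of_set {u..v}) (mtop M\<^sub>2) c\<^sub>2"
    by (rule continuous_map_from_subtopology_mono[OF piecewise_C1_onD(2)[OF c(1)]]
        continuous_map_from_subtopology_mono[OF piecewise_C1_onD(2)[OF c(2)]]; use uv in auto)+
  note co = M\<^sub>1.continuous_on_speed[OF this(1) piecewise_C1_onD(3)[OF c(1) uv] uv(2)]
    M\<^sub>2.continuous_on_speed[OF this(2) piecewise_C1_onD(3)[OF c(2) uv] uv(2)]
  let ?g = "\<lambda>t. sqrt ((speed_within M\<^sub>1 {u..v} c\<^sub>1 t)\<^sup>2 + (speed_within M\<^sub>2 {u..v} c\<^sub>2 t)\<^sup>2)"
  have "?g integrable_on {u..v}" by (intro integrable_continuous_real continuous_intros co)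
  moreover have "speed_within P UNIV (\<lambda>t. (c\<^sub>1 t, c\<^sub>2 t)) t = ?g t" if "t \<in> {u..v} - {u, v}" for t
  proof -
    have t: "u < t" "t < v" using that by auto
    then have "t \<in> {u<..<v}" by simp
    then have "t \<in> {0<..<1} - S" using uv by auto
    from speed_product[OF c this] show ?thesis by (simp add: speed_within_interior[OF t])
  qed
  ultimately show "speed_within P UNIV (\<lambda>t. (c\<^sub>1 t, c\<^sub>2 t)) integrable_on {u..v}"
    using integrable_spike_finite[of "{u, v}" "{u..v}" "speed_within P UNIV (\<lambda>t. (c\<^sub>1 t, c\<^sub>2 t))" ?g] by blast
qed

lemma curve_length_product_le:
  assumes c: "piecewise_C1_on M\<^sub>1 0 1 c\<^sub>1 S" "piecewise_C1_on M\<^sub>2 0 1 c\<^sub>2 S"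
    and K: "\<And>t. t \<in> {0<..<1} - S \<Longrightarrow> speed_within M\<^sub>1 UNIV c\<^sub>1 t \<le> K\<^sub>1"
      "\<And>t. t \<in> {0<..<1} - S \<Longrightarrow> speed_within M\<^sub>2 UNIV c\<^sub>2 t \<le> K\<^sub>2"
  shows "curve_length P (\<lambda>t. (c\<^sub>1 t, c\<^sub>2 t)) \<le> sqrt (K\<^sub>1\<^sup>2 + K\<^sub>2\<^sup>2)"
proof -
  let ?f = "speed_within P UNIV (\<lambda>t. (c\<^sub>1 t, c\<^sub>2 t))" and ?R = "sqrt (K\<^sub>1\<^sup>2 + K\<^sub>2\<^sup>2)"
  let ?N = "insert 0 (insert 1 S)"
  have fin: "finite ?N" using piecewise_C1_onD(1)[OF c(1)] by simp
  have le: "?f t \<le> ?R" if "t \<in> {0..1} - ?N" for t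
  proof -
    have t: "t \<in> {0<..<1} - S" using that by (auto simp: less_le)
    show ?thesis
      unfolding speed_product[OF c t] using K[OF t] M\<^sub>1.speed_nonneg[OF c(1) t] M\<^sub>2.speed_nonneg[OF c(2) t]
      by (intro real_sqrt_le_mono add_mono power_mono)
  qed
  let ?g = "\<lambda>t. if t \<in> ?N then ?R else ?f t"
  have "?g integrable_on {0..1}"
    by (rule integrable_spike_finite[OF fin _ speed_product_integrable[OF c]]) auto
  then have "integral {0..1} ?g \<le> integral {0..1} (\<lambda>t::real. ?R)"
    by (rule Henstock_Kurzweil_Integration.integral_le) (use le in \<open>auto simp: integrable_const_ivl\<close>)
  moreover have "integral {0..1} ?g = integral {0..1} ?f"
    by (rule integral_spike[OF negligible_finite[OF fin]]) auto
  ultimately show ?thesis by (simp add: curve_length_eq)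
qed

text \<open>Minkowski's inequality for integrals: by Cauchy-Schwarz the product of the vector of
  speeds with the constant vector (A, B) of total lengths is at most R times the product speed;
  integration gives R^2 on one side and R L on the other.\<close>

lemma curve_length_product_ge:
  assumes c: "piecewise_C1_on M\<^sub>1 0 1 c\<^sub>1 S" "piecewise_C1_on M\<^sub>2 0 1 c\<^sub>2 S"
  shows "sqrt ((curve_length M\<^sub>1 c\<^sub>1)\<^sup>2 + (curve_length M\<^sub>2 c\<^sub>2)\<^sup>2) \<le> curve_length P (\<lambda>t. (c\<^sub>1 t, c\<^sub>2 t))"
proof -
  let ?f = "speed_within P UNIV (\<lambda>t. (c\<^sub>1 t, c\<^sub>2 t))"
  let ?f1 = "speed_within M\<^sub>1 UNIV c\<^sub>1" and ?f2 = "speed_within M\<^sub>2 UNIV c\<^sub>2"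
  define A B R L where "A = curve_length M\<^sub>1 c\<^sub>1" and "B = curve_length M\<^sub>2 c\<^sub>2" and "R = sqrt (A\<^sup>2 + B\<^sup>2)"
    and "L = curve_length P (\<lambda>t. (c\<^sub>1 t, c\<^sub>2 t))"
  have AB: "0 \<le> A" "0 \<le> B" unfolding A_def B_def
    using M\<^sub>1.curve_length_nonneg[OF c(1)] M\<^sub>2.curve_length_nonneg[OF c(2)] .
  let ?N = "insert 0 (insert 1 S)"
  have fin: "finite ?N" using piecewise_C1_onD(1)[OF c(1)] by simp
  have i1: "?f1 integrable_on {0..1}" and i2: "?f2 integrable_on {0..1}"
    using M\<^sub>1.speed_integrable[OF c(1) zero_le_one]
      M\<^sub>2.speed_integrable[OF c(2) zero_le_one] .
  \<comment> \<open>At exceptional parameters \<open>speed_product\<close> gives nothing, so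
    \<open>?h\<close> is set equal to \<open>?g\<close> there.\<close>
  let ?g = "\<lambda>t. A * ?f1 t + B * ?f2 t" and ?h = "\<lambda>t. if t \<in> ?N then A * ?f1 t + B * ?f2 t else R * ?f t"
  have le: "?g t \<le> ?h t" if "t \<in> {0..1}" for t
  proof (cases "t \<in> ?N")
    case False
    then have t: "t \<in> {0<..<1} - S" using that by (auto simp: less_le)
    have "(?g t)\<^sup>2 + (A * ?f2 t - B * ?f1 t)\<^sup>2 = (A\<^sup>2 + B\<^sup>2) * ((?f1 t)\<^sup>2 + (?f2 t)\<^sup>2)"
      by (simp add: power2_eq_square algebra_simps)
    then have "(?g t)\<^sup>2 \<le> (A\<^sup>2 + B\<^sup>2) * ((?f1 t)\<^sup>2 + (?f2 t)\<^sup>2)"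
      using zero_le_power2[of "A * ?f2 t - B * ?f1 t"] by linarith
    then have "?g t \<le> sqrt ((A\<^sup>2 + B\<^sup>2) * ((?f1 t)\<^sup>2 + (?f2 t)\<^sup>2))" by (rule real_le_rsqrt)
    then show ?thesis using False unfolding speed_product[OF c t] R_def by (simp add: real_sqrt_mult)
  qed simp
  have hi: "?h integrable_on {0..1}"
    by (rule integrable_spike_finite[OF fin _ integrable_on_cmult_left[OF speed_product_integrable[OF c], of R]]) auto
  have gi: "(?g has_integral (A * A + B * B)) {0..1}"
    using integrable_integral[OF i1] integrable_integral[OF i2]
    unfolding A_def B_def curve_length_eq by (intro has_integral_add has_integral_mult_right)
  have "A * A + B * B = integral {0..1} ?g" using gi by (simp add: integral_unique)
  also have "\<dots> \<le> integral {0..1} ?h"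
    by (rule Henstock_Kurzweil_Integration.integral_le[OF _ hi le]) (use gi in blast)
  also have "\<dots> = integral {0..1} (\<lambda>t. R * ?f t)"
    by (rule integral_spike[OF negligible_finite[OF fin]]) auto
  also have "\<dots> = R * L" by (simp add: L_def curve_length_eq)
  finally have "R * R \<le> R * L" by (simp add: R_def power2_eq_square)
  moreover have "0 \<le> L"
  proof -
    let ?k = "\<lambda>t. if t \<in> ?N then 0 else ?f t"
    have "0 \<le> ?k t" if "t \<in> {0..1}" for t
    proof (cases "t \<in> ?N")
      case False
      then have "t \<in> {0<..<1} - S" using that by (auto simp: less_le)
      from speed_product[OF c this] show ?thesis using False by simp
    qed simp
    then have "0 \<le> integral {0..1} ?k"
      by (intro Henstock_Kurzweil_Integration.integral_nonneg integrable_spike_finite[OF fin _ speed_product_integrable[OF c]]) auto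
    also have "\<dots> = L" unfolding L_def curve_length_eq
      by (rule integral_spike[OF negligible_finite[OF fin]]) auto
    finally show ?thesis .
  qed
  moreover have "0 \<le> R" by (simp add: R_def)
  \<comment> \<open>R cannot be cancelled when it is 0; the claim is then the nonnegativity of
    L.\<close>
  ultimately have "R \<le> L" by (cases "R = 0") (auto simp: mult_le_cancel_left)
  then show ?thesis by (simp add: R_def L_def A_def B_def)
qed

text \<open>Projecting a curve gives the lower bound. For the upper bound, curves in the factors
  with speed bounds just above the two distances are run simultaneously.\<close>

theorem riemannian_dist_product:
  assumes pq: "p \<in> topspace (mtop M\<^sub>1)" "q \<in> topspace (mtop M\<^sub>2)" "p' \<in> topspace (mtop M\<^sub>1)" "q' \<in> topspace (mtop M\<^sub>2)"
  shows "riemannian_dist P (p, q) (p', q') = sqrt ((riemannian_dist M\<^sub>1 p p')\<^sup>2 + (riemannian_dist M\<^sub>2 q q')\<^sup>2)"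
proof (rule antisym)
  define d1 d2 where "d1 = riemannian_dist M\<^sub>1 p p'" and "d2 = riemannian_dist M\<^sub>2 q q'"
  have d0: "0 \<le> d1" "0 \<le> d2" unfolding d1_def d2_def
    using M\<^sub>1.riemannian_dist_nonneg[OF pq(1,3)] M\<^sub>2.riemannian_dist_nonneg[OF pq(2,4)] .
  let ?L = "{curve_length P c | c. piecewise_C1_curve P c \<and> c 0 = (p, q) \<and> c 1 = (p', q')}"
  have lower: "sqrt (d1\<^sup>2 + d2\<^sup>2) \<le> l" if lL: "l \<in> ?L" for l
  proof -
    obtain c S where l: "l = curve_length P c" and c: "piecewise_C1_on P 0 1 c S" "c 0 = (p, q)" "c 1 = (p', q')"
      using lL unfolding piecewise_C1_curve_iff by blast
    note pr = piecewise_C1_on_projections[OF c(1)]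
    have "d1 \<le> curve_length M\<^sub>1 (fst \<circ> c)" unfolding d1_def
      by (rule M\<^sub>1.riemannian_dist_le_length) (use pr(1) c in \<open>auto simp: piecewise_C1_curve_iff\<close>)
    moreover have "d2 \<le> curve_length M\<^sub>2 (snd \<circ> c)" unfolding d2_def
      by (rule M\<^sub>2.riemannian_dist_le_length) (use pr(2) c in \<open>auto simp: piecewise_C1_curve_iff\<close>)
    ultimately have "sqrt (d1\<^sup>2 + d2\<^sup>2) \<le> sqrt ((curve_length M\<^sub>1 (fst \<circ> c))\<^sup>2 + (curve_length M\<^sub>2 (snd \<circ> c))\<^sup>2)"
      using d0 by (intro real_sqrt_le_mono add_mono power_mono)
    also have "\<dots> \<le> l" using curve_length_product_ge[OF pr] by (simp add: l)
    finally show ?thesis .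
  qed
  have upper: "\<exists>l\<in>?L. l \<le> sqrt (K1\<^sup>2 + K2\<^sup>2)" if K: "d1 < K1" "d2 < K2" for K1 K2
  proof -
    obtain c1 S1 where c1: "piecewise_C1_on M\<^sub>1 0 1 c1 S1" "c1 0 = p" "c1 1 = p'"
      "\<And>t. t \<in> {0<..<1} - S1 \<Longrightarrow> speed_within M\<^sub>1 UNIV c1 t \<le> K1"
      using M\<^sub>1.dist_less_joinable[OF pq(1,3) K(1)[unfolded d1_def]]
      unfolding M\<^sub>1.joinable_def speed_curve_def by blast
    obtain c2 S2 where c2: "piecewise_C1_on M\<^sub>2 0 1 c2 S2" "c2 0 = q" "c2 1 = q'"
      "\<And>t. t \<in> {0<..<1} - S2 \<Longrightarrow> speed_within M\<^sub>2 UNIV c2 t \<le> K2"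
      using M\<^sub>2.dist_less_joinable[OF pq(2,4) K(2)[unfolded d2_def]]
      unfolding M\<^sub>2.joinable_def speed_curve_def by blast
    let ?S = "S1 \<union> S2" and ?c = "\<lambda>t. (c1 t, c2 t)"
    have fin: "finite ?S" using piecewise_C1_onD(1)[OF c1(1)] piecewise_C1_onD(1)[OF c2(1)] by simp
    have "piecewise_C1_on M\<^sub>1 0 1 c1 ?S" "piecewise_C1_on M\<^sub>2 0 1 c2 ?S"
      by (rule piecewise_C1_on_restrict[OF c1(1)] piecewise_C1_on_restrict[OF c2(1)]; use fin in auto)+
    then have "curve_length P ?c \<le> sqrt (K1\<^sup>2 + K2\<^sup>2)"
      by (rule curve_length_product_le) (use c1(4) c2(4) in auto)
    moreover have "curve_length P ?c \<in> ?L"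
      using piecewise_C1_on_product[OF c1(1) c2(1)] c1(2,3) c2(2,3) by (auto simp: piecewise_C1_curve_iff)
    ultimately show ?thesis by blast
  qed
  have bdd: "bdd_below ?L" using lower by (rule bdd_belowI)
  have "?L \<noteq> {}" using upper[of "d1 + 1" "d2 + 1"] by auto
  then show "sqrt ((riemannian_dist M\<^sub>1 p p')\<^sup>2 + (riemannian_dist M\<^sub>2 q q')\<^sup>2) \<le> riemannian_dist P (p, q) (p', q')"
    unfolding riemannian_dist_def[of P] d1_def[symmetric] d2_def[symmetric] using lower by (rule cInf_greatest)
  \<comment> \<open>The infima in the factors need not be attained, so both bounds are taken e above
    the distances, and e tends to 0.\<close>
  have "riemannian_dist P (p, q) (p', q') \<le> sqrt ((d1 + e)\<^sup>2 + (d2 + e)\<^sup>2)" if "e > 0" for e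
  proof -
    have "\<exists>l\<in>?L. l \<le> sqrt ((d1 + e)\<^sup>2 + (d2 + e)\<^sup>2)" using that by (intro upper) auto
    then show ?thesis unfolding riemannian_dist_def[of P] using cInf_lower[OF _ bdd] order_trans by blast
  qed
  then have "\<forall>\<^sub>F e in at_right 0. riemannian_dist P (p, q) (p', q') \<le> sqrt ((d1 + e)\<^sup>2 + (d2 + e)\<^sup>2)"
    by (auto intro: eventually_at_right_less[THEN eventually_mono])
  moreover have "((\<lambda>e. sqrt ((d1 + e)\<^sup>2 + (d2 + e)\<^sup>2)) \<longlongrightarrow> sqrt ((d1 + 0)\<^sup>2 + (d2 + 0)\<^sup>2)) (at_right 0)"
    by (intro tendsto_intros)
  ultimately show "riemannian_dist P (p, q) (p', q') \<le> sqrt ((riemannian_dist M\<^sub>1 p p')\<^sup>2 + (riemannian_dist M\<^sub>2 q q')\<^sup>2)"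
    unfolding d1_def[symmetric] d2_def[symmetric]
    using tendsto_lowerbound[of "\<lambda>e. sqrt ((d1 + e)\<^sup>2 + (d2 + e)\<^sup>2)" "sqrt ((d1 + 0)\<^sup>2 + (d2 + 0)\<^sup>2)" "at_right 0"] by simp
qed

end

theorem corollary1:
  fixes M\<^sub>1 :: "('i, 'm, 'a::euclidean_space) riemannian"
    and M\<^sub>2 :: "('j, 'n, 'b::euclidean_space) riemannian"
  assumes "riemannian_manifold M\<^sub>1" "connected_space (mtop M\<^sub>1)" "topspace (mtop M\<^sub>1) \<noteq> {}"
    and "riemannian_manifold M\<^sub>2" "connected_space (mtop M\<^sub>2)" "topspace (mtop M\<^sub>2) \<noteq> {}"
  shows "euclidean_rank (topspace (mtop M\<^sub>1)) (riemannian_dist M\<^sub>1) +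
         euclidean_rank (topspace (mtop M\<^sub>2)) (riemannian_dist M\<^sub>2) =
         euclidean_rank (topspace (mtop (riemannian_product M\<^sub>1 M\<^sub>2)))
           (riemannian_dist (riemannian_product M\<^sub>1 M\<^sub>2))"
proof -
  interpret riemannian_pair M\<^sub>1 M\<^sub>2
    using assms by (simp add: riemannian_pair_def connected_riemannian_manifold_def connected_riemannian_manifold_axioms_def)
  have "topspace (mtop P) = topspace (mtop M\<^sub>1) \<times> topspace (mtop M\<^sub>2)" by (simp add: mtop_P)
  then show ?thesis
    using euclidean_rank_product[OF M\<^sub>1.pseudometric_axioms M\<^sub>2.pseudometric_axioms assms(3,6)
        M\<^sub>1.locally_quadrilateral M\<^sub>2.locally_quadrilateral riemannian_dist_product] by simp
qed

end
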